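(* For every fixed self-join-free Boolean conjunctive query $Q$ that is not hierarchical, the parameterized Bag-Set Maximization Decision problem for $Q$ is $\mathsf{W}[1]$-hard, both when the parameters are $\theta$ and $\tau$ and when the only parameter is $\tau$.
   Context: An atom is an expression $R(\boldsymbol X)$ where $R$ is a relation symbol and $\boldsymbol X$ is a finite set of variables. A self-join-free Boolean conjunctive query (SJF-BCQ) has the form $Q() \text{ :- } \bigwedge_{R(\boldsymbol X)\in \mathsf{at}(Q)} R(\boldsymbol X)$, where $\mathsf{at}(Q)$ is a finite nonempty set of atoms with pairwise distinct relation symbols. $\mathsf{vars}(Q)$ is the set of variables occurring in $Q$; for $Y\in\mathsf{vars}(Q)$, $\mathsf{at}(Y)$ is the set of atoms of $Q$ containing $Y$. $Q$ is hierarchical if for every two variables $X,Y\in\mathsf{vars}(Q)$ one has $\mathsf{at}(X)\subseteq\mathsf{at}(Y)$, or $\mathsf{at}(Y)\subseteq\mathsf{at}(X)$, or $\mathsf{at}(X)\cap\mathsf{at}(Y)=\emptyset$. Let $\mathsf{Dom}$ be a countably infinite domain. A fact over $\mathsf{at}(Q)$ is $R(\boldsymbol x)$ with $R(\boldsymbol X)\in\mathsf{at}(Q)$ and $\boldsymbol x:\boldsymbol X\to\mathsf{Dom}$. A (set) database instance for $Q$ is a finite set of facts over $\mathsf{at}(Q)$. Bag-set semantics: $Q(\mathcal D)$ is the number of satisfying assignments of $Q$ over $\mathcal D$, i.e. of functions $\boldsymbol w:\mathsf{vars}(Q)\to\mathsf{Dom}$ such that $R(\boldsymbol w|_{\boldsymbol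 X})\in\mathcal D$ for every $R(\boldsymbol X)\in\mathsf{at}(Q)$. Bag-Set Maximization Decision problem for a fixed SJF-BCQ $Q$: the input is $(\mathcal D,\mathcal D^{\mathsf r},\theta,\tau)$, where $\mathcal D,\mathcal D^{\mathsf r}$ are database instances for $Q$ and $\theta,\tau\in\mathbb N$. A valid repair of $\mathcal D$ is a set database $\mathcal D'$ with $\mathcal D\subseteq\mathcal D'\subseteq\mathcal D\cup\mathcal D^{\mathsf r}$ and $|\mathcal D'\setminus\mathcal D|\le\theta$. The question is whether the maximum of $Q(\mathcal D')$ over all valid repairs $\mathcal D'$ of $\mathcal D$ is at least $\tau$. The query $Q$ is fixed and is not part of the input. $\mathsf{W}[1]$-hardness is with respect to fpt-reductions. *)

theory Defs
  imports Main
begin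

section \<open>Machine model\<close>

text \<open>
  Words are binary trees (S-expressions), with lists, numbers and tuples represented inside
  them in the usual way; up to linear factors these are strings over a bracket alphabet.  The
  machine model is Jones' imperative WHILE language over trees.  In contrast to the unit-cost
  version, every evaluation of an expression is charged the total size of all (sub)results, so
  that values cannot grow faster than the charged time.  The cost is therefore polynomially
  related to Turing machine time.
\<close>

datatype data = Tip | Br data data

fun nodes :: "data \<Rightarrow> nat" where
  "nodes Tip = 1"
| "nodes (Br a b) = 1 + nodes a + nodes b"

type_synonym store = "nat \<Rightarrow> data"

datatype expr = Var nat | TipE | BrE expr expr | LeftE expr | RightE expr | EqE expr expr

fun eval_expr :: "expr \<Rightarrow> store \<Rightarrow> data" where
  "eval_expr (Var i) s = s i"
| "eval_expr TipE s = Tip"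
| "eval_expr (BrE e1 e2) s = Br (eval_expr e1 s) (eval_expr e2 s)"
| "eval_expr (LeftE e) s = (case eval_expr e s of Tip \<Rightarrow> Tip | Br a b \<Rightarrow> a)"
| "eval_expr (RightE e) s = (case eval_expr e s of Tip \<Rightarrow> Tip | Br a b \<Rightarrow> b)"
| "eval_expr (EqE e1 e2) s = (if eval_expr e1 s = eval_expr e2 s then Br Tip Tip else Tip)"

fun cost_expr :: "expr \<Rightarrow> store \<Rightarrow> nat" where
  "cost_expr (Var i) s = nodes (s i)"
| "cost_expr TipE s = 1"
| "cost_expr (BrE e1 e2) s = 1 + cost_expr e1 s + cost_expr e2 s"
| "cost_expr (LeftE e) s = 1 + cost_expr e s"
| "cost_expr (RightE e) s = 1 + cost_expr e s"
| "cost_expr (EqE e1 e2) s = 1 + cost_expr e1 s + cost_expr e2 s"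

lemma nodes_pos: "1 \<le> nodes d"
  by (cases d) auto

lemma cost_expr_pos: "1 \<le> cost_expr e s"
  by (cases e) (auto simp: nodes_pos simp del: One_nat_def)

lemma nodes_eval_expr_le_cost: "nodes (eval_expr e s) \<le> cost_expr e s"
proof (induction e)
  case (EqE e1 e2)
  then show ?case using cost_expr_pos[of e1 s] cost_expr_pos[of e2 s] by simp
qed (auto split: data.splits)

datatype prog =
    Assign nat expr
  | Seq prog prog
  | Cond expr prog prog
  | While expr prog

text \<open>\<open>exec p s t s'\<close>: started in store \<open>s\<close>, program \<open>p\<close> halts in store \<open>s'\<close> after time \<open>t\<close>.
  A test succeeds iff its value is not \<^const>\<open>Tip\<close>.\<close>

inductive exec :: "prog \<Rightarrow> store \<Rightarrow> nat \<Rightarrow> store \<Rightarrow> bool" where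
  exec_Assign: "exec (Assign i e) s (1 + cost_expr e s) (s(i := eval_expr e s))"
| exec_Seq: "exec p s t s' \<Longrightarrow> exec q s' u s'' \<Longrightarrow> exec (Seq p q) s (1 + t + u) s''"
| exec_Cond_true: "eval_expr e s \<noteq> Tip \<Longrightarrow> exec p s t s' \<Longrightarrow>
    exec (Cond e p q) s (1 + cost_expr e s + t) s'"
| exec_Cond_false: "eval_expr e s = Tip \<Longrightarrow> exec q s t s' \<Longrightarrow>
    exec (Cond e p q) s (1 + cost_expr e s + t) s'"
| exec_While_true: "eval_expr e s \<noteq> Tip \<Longrightarrow> exec p s t s' \<Longrightarrow> exec (While e p) s' u s'' \<Longrightarrow>
    exec (While e p) s (1 + cost_expr e s + t + u) s''"
| exec_While_false: "eval_expr e s = Tip \<Longrightarrow> exec (While e p) s (1 + cost_expr e s) s"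

inductive_cases exec_AssignE: "exec (Assign i e) s t s'"
inductive_cases exec_SeqE: "exec (Seq p q) s t s'"
inductive_cases exec_CondE: "exec (Cond e p q) s t s'"
inductive_cases exec_WhileE: "exec (While e p) s t s'"

lemma exec_deterministic:
  "exec p s t s' \<Longrightarrow> exec p s u s'' \<Longrightarrow> u = t \<and> s'' = s'"
proof (induction arbitrary: u s'' rule: exec.induct)
  case exec_Assign
  then show ?case by (auto elim: exec_AssignE)
next
  case (exec_Seq p s t s' q v s2)
  from exec_Seq.prems obtain t1 s1 u1
    where *: "exec p s t1 s1" "exec q s1 u1 s''" "u = 1 + t1 + u1"
    by (rule exec_SeqE) simp
  have "t1 = t" "s1 = s'" using exec_Seq.IH(1)[OF *(1)] by blast+
  with exec_Seq.IH(2)[of u1 s''] * show ?case by blast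
next
  case (exec_Cond_true e s p t s' q)
  from exec_Cond_true.prems obtain t1
    where *: "exec p s t1 s''" "u = 1 + cost_expr e s + t1"
    by (rule exec_CondE) (use exec_Cond_true.hyps(1) in simp_all)
  show ?case using exec_Cond_true.IH[OF *(1)] *(2) by blast
next
  case (exec_Cond_false e s q t s' p)
  from exec_Cond_false.prems obtain t1
    where *: "exec q s t1 s''" "u = 1 + cost_expr e s + t1"
    by (rule exec_CondE) (use exec_Cond_false.hyps(1) in simp_all)
  show ?case using exec_Cond_false.IH[OF *(1)] *(2) by blast
next
  case (exec_While_true e s p t s' v s2)
  from exec_While_true.prems obtain t1 s1 u1
    where *: "exec p s t1 s1" "exec (While e p) s1 u1 s''" "u = 1 + cost_expr e s + t1 + u1"
    by (rule exec_WhileE) (use exec_While_true.hyps(1) in simp_all)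
  have "t1 = t" "s1 = s'" using exec_While_true.IH(1)[OF *(1)] by blast+
  with exec_While_true.IH(2)[of u1 s''] * show ?case by blast
next
  case (exec_While_false e s p)
  from exec_While_false.prems show ?case
    by (rule exec_WhileE) (use exec_While_false.hyps in simp_all)
qed

text \<open>Input and output are in variable 0; all other variables are initially \<^const>\<open>Tip\<close>.\<close>

definition computes_in :: "prog \<Rightarrow> data \<Rightarrow> data \<Rightarrow> nat \<Rightarrow> bool" where
  "computes_in p x y t \<longleftrightarrow> (\<exists>s'. exec p ((\<lambda>_. Tip)(0 := x)) t s' \<and> s' 0 = y)"


section \<open>Encodings\<close>

fun enc_list :: "data list \<Rightarrow> data" where
  "enc_list [] = Tip"
| "enc_list (x # xs) = Br x (enc_list xs)"

definition enc_bool :: "bool \<Rightarrow> data" where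
  "enc_bool b = (if b then Br Tip Tip else Tip)"

definition enc_unary :: "nat \<Rightarrow> data" where
  "enc_unary n = enc_list (replicate n Tip)"

text \<open>Binary, least significant bit first.\<close>

fun enc_nat :: "nat \<Rightarrow> data" where
  "enc_nat n = (if n = 0 then Tip else Br (enc_bool (odd n)) (enc_nat (n div 2)))"

declare enc_nat.simps [simp del]


section \<open>Parameterized problems, fpt-reductions and W[1]\<close>

text \<open>A parameterized problem is a set of pairs (word, parameter).\<close>

type_synonym param_problem = "(data \<times> nat) set"

definition computable_nat :: "(nat \<Rightarrow> nat) \<Rightarrow> bool" where
  "computable_nat f \<longleftrightarrow> (\<exists>p. \<forall>n. \<exists>t. computes_in p (enc_unary n) (enc_unary (f n)) t)"

text \<open>As usual, the parameter is written in unary, and \<open>f\<close> and \<open>g\<close> are arbitrary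
  computable functions.\<close>

definition fpt_reducible :: "param_problem \<Rightarrow> param_problem \<Rightarrow> bool" where
  "fpt_reducible A B \<longleftrightarrow>
    (\<exists>p f g c. computable_nat f \<and> computable_nat g \<and>
      (\<forall>x k. \<exists>x' k' t.
         computes_in p (Br x (enc_unary k)) (Br x' (enc_unary k')) t \<and>
         t \<le> f k * nodes x ^ c \<and>
         ((x, k) \<in> A \<longleftrightarrow> (x', k') \<in> B) \<and>
         k' \<le> g k))"

text \<open>
  Formulas in the class \<open>\<Gamma>\<^bsub>1,d\<^esub>\<close>: conjunctions of disjunctions of at most \<open>d\<close> literals.
  A literal is a pair (sign, propositional variable).
\<close>

type_synonym literal = "bool \<times> nat"
type_synonym cnf = "literal list list"

definition Gamma1 :: "nat \<Rightarrow> cnf set" where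
  "Gamma1 d = {\<phi>. \<forall>C\<in>set \<phi>. length C \<le> d}"

definition cnf_vars :: "cnf \<Rightarrow> nat set" where
  "cnf_vars \<phi> = (\<Union>C\<in>set \<phi>. snd ` set C)"

text \<open>Assignments are identified with the set of variables that they make true.\<close>

definition cnf_sat :: "nat set \<Rightarrow> cnf \<Rightarrow> bool" where
  "cnf_sat S \<phi> \<longleftrightarrow> (\<forall>C\<in>set \<phi>. \<exists>(b, v)\<in>set C. b = (v \<in> S))"

definition enc_cnf :: "cnf \<Rightarrow> data" where
  "enc_cnf \<phi> = enc_list (map (\<lambda>C. enc_list (map (\<lambda>(b, v). Br (enc_bool b) (enc_nat v)) C)) \<phi>)"

text \<open>The weighted satisfiability problem \<open>p-WSAT(\<Gamma>\<^bsub>1,d\<^esub>)\<close>: is there a satisfying assignment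
  of weight exactly \<open>k\<close>?\<close>

definition weighted_sat :: "nat \<Rightarrow> param_problem" where
  "weighted_sat d =
    {(enc_cnf \<phi>, k) | \<phi> k. \<phi> \<in> Gamma1 d \<and>
       (\<exists>S. S \<subseteq> cnf_vars \<phi> \<and> card S = k \<and> cnf_sat S \<phi>)}"

text \<open>\<open>W[1]\<close> is the first level of the W-hierarchy
  \<open>W[t] = [{p-WSAT(\<Gamma>\<^bsub>t,d\<^esub>) | d \<ge> 1}]\<close>, the bracket denoting closure under
  fpt-reductions (Flum and Grohe).\<close>

definition W1 :: "param_problem set" where
  "W1 = {A. \<exists>d\<ge>1. fpt_reducible A (weighted_sat d)}"

definition W1_hard :: "param_problem \<Rightarrow> bool" where
  "W1_hard B \<longleftrightarrow> (\<forall>A\<in>W1. fpt_reducible A B)"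


section \<open>Self-join-free Boolean conjunctive queries\<close>

text \<open>Relation symbols, variables and domain elements are natural numbers.  An atom \<open>R(X)\<close> is the
  pair \<open>(R, X)\<close>, and a query is its set of atoms.\<close>

type_synonym query_atom = "nat \<times> nat set"
type_synonym query = "query_atom set"

definition sjf_bcq :: "query \<Rightarrow> bool" where
  "sjf_bcq Q \<longleftrightarrow> finite Q \<and> Q \<noteq> {} \<and> (\<forall>(R, X)\<in>Q. finite X) \<and> inj_on fst Q"

definition query_vars :: "query \<Rightarrow> nat set" where
  "query_vars Q = (\<Union>(R, X)\<in>Q. X)"

definition atoms_of_var :: "query \<Rightarrow> nat \<Rightarrow> query_atom set" where
  "atoms_of_var Q Y = {(R, X)\<in>Q. Y \<in> X}"

definition hierarchical :: "query \<Rightarrow> bool" where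
  "hierarchical Q \<longleftrightarrow>
    (\<forall>X\<in>query_vars Q. \<forall>Y\<in>query_vars Q.
       atoms_of_var Q X \<subseteq> atoms_of_var Q Y \<or>
       atoms_of_var Q Y \<subseteq> atoms_of_var Q X \<or>
       atoms_of_var Q X \<inter> atoms_of_var Q Y = {})"

text \<open>A function \<open>X \<rightarrow> Dom\<close> is a map with domain \<open>X\<close>.\<close>

type_synonym fact = "nat \<times> (nat \<rightharpoonup> nat)"

definition facts_over :: "query \<Rightarrow> fact set" where
  "facts_over Q = {(R, x). (R, dom x) \<in> Q}"

definition db_instance :: "query \<Rightarrow> fact set \<Rightarrow> bool" where
  "db_instance Q D \<longleftrightarrow> finite D \<and> D \<subseteq> facts_over Q"

definition sat_assignments :: "query \<Rightarrow> fact set \<Rightarrow> (nat \<rightharpoonup> nat) set" where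
  "sat_assignments Q D = {w. dom w = query_vars Q \<and> (\<forall>(R, X)\<in>Q. (R, w |` X) \<in> D)}"

definition bag_set_value :: "query \<Rightarrow> fact set \<Rightarrow> nat" where
  "bag_set_value Q D = card (sat_assignments Q D)"


section \<open>Bag-Set Maximization\<close>

definition valid_repair :: "fact set \<Rightarrow> fact set \<Rightarrow> nat \<Rightarrow> fact set \<Rightarrow> bool" where
  "valid_repair D Dr \<theta> D' \<longleftrightarrow> D \<subseteq> D' \<and> D' \<subseteq> D \<union> Dr \<and> card (D' - D) \<le> \<theta>"

definition bag_set_max :: "query \<Rightarrow> fact set \<Rightarrow> fact set \<Rightarrow> nat \<Rightarrow> nat" where
  "bag_set_max Q D Dr \<theta> = Max {bag_set_value Q D' | D'. valid_repair D Dr \<theta> D'}"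

text \<open>A fact is written as its relation symbol followed by its values in increasing order of the
  variables.  A database is written as a list of its facts without repetition, in any order,
  hence the relation \<open>db_code\<close> instead of a function.\<close>

definition enc_fact :: "fact \<Rightarrow> data" where
  "enc_fact = (\<lambda>(R, x).
     Br (enc_nat R) (enc_list (map (\<lambda>v. enc_nat (the (x v))) (sorted_list_of_set (dom x)))))"

definition db_code :: "fact set \<Rightarrow> data \<Rightarrow> bool" where
  "db_code D c \<longleftrightarrow> (\<exists>fs. distinct fs \<and> set fs = D \<and> c = enc_list (map enc_fact fs))"

text \<open>The argument \<open>\<kappa>\<close> gives the parameter as a function of \<open>\<theta>\<close> and \<open>\<tau>\<close>; having
  both as parameters means, as usual, the parameter \<open>\<theta> + \<tau>\<close>.\<close>

definition bag_set_max_decision :: "query \<Rightarrow> (nat \<Rightarrow> nat \<Rightarrow> nat) \<Rightarrow> param_problem" where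
  "bag_set_max_decision Q \<kappa> =
    {(enc_list [c, cr, enc_nat \<theta>, enc_nat \<tau>], \<kappa> \<theta> \<tau>) | c cr \<theta> \<tau>.
       \<exists>D Dr. db_instance Q D \<and> db_code D c \<and> db_instance Q Dr \<and> db_code Dr cr \<and>
         \<tau> \<le> bag_set_max Q D Dr \<theta>}"

end

theory Submission
  imports Defs "HOL-Library.Sublist"
begin

text \<open>
  We reduce \<open>p-WSAT(\<Gamma>\<^bsub>1,d\<^esub>)\<close> directly, in time polynomial in the input and the parameter.  A set of
  \<open>k\<close> variables is represented by the gaps between its consecutive elements.  Knowing two neighbours
  \<open>a < b\<close> of the set tells that \<open>b\<close> is true and that everything in between is false, so a violated
  clause of at most \<open>d\<close> literals is already violated by at most \<open>d\<close> gaps.  Hence \<open>k\<close>-element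
  models are the cliques of a \<open>(d + 1)\<close>-uniform hypergraph on the possible gaps, and positive
  literals need no special treatment.

  A non-hierarchical query contains a pattern \<open>R(X) \<and> S(X, Y) \<and> T(Y)\<close> and thereby counts the edges
  between the bought \<open>R\<close>- and \<open>T\<close>-facts in an arbitrary fixed bipartite graph \<open>S\<close>.  We take the
  incidence graph between gaps and hyperedges, with \<open>d\<close> additional free \<open>T\<close>-facts adjacent to all
  gaps as a counterweight that makes buying exactly a clique and all its hyperedges optimal.
  Budget and target depend on \<open>k\<close> and \<open>d\<close> only, hence both parameterizations are covered.
\<close>

section \<open>Polynomial-time functions on trees\<close>

text \<open>Hardness is derived straight from the definition of \<open>W1\<close>, so the source is
  \<open>weighted_sat d\<close> for each \<open>d \<ge> 1\<close>, with positive and negative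
  literals mixed. A partial choice of true variables never shows that another variable is false; a
  gap does, which is why gaps and not variables are the vertices. Hyperedges have
  \<open>D = d + 1\<close> elements: enough for one gap per literal of a clause, and at least 2, so
  that they also check whether two gaps fit together. A set of \<open>k\<close> variables leaves
  \<open>k + 1\<close> gaps; \<open>D\<close> padding layers raise this to
  \<open>K = k + D + 1\<close>, so every set of at most \<open>D\<close> gaps lies in a
  \<open>D\<close>-subset of the clique. With \<open>D - 1\<close> free neighbours a gap is worth as
  much as a hyperedge that misses one gap. The other obstacle is the machine: the reduction and the
  bounds on time and parameter have to be programs. One loop (\<open>ptime_foldl\<close>) is
  verified by hand, the other constructions are closure properties. The given reduction brings
  arbitrary computable bounds, so their programs must be moved to other registers before they can be
  combined.\<close>

fun dec_list :: "data \<Rightarrow> data list" where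
  "dec_list Tip = []"
| "dec_list (Br a b) = a # dec_list b"

fun dleft :: "data \<Rightarrow> data" where
  "dleft Tip = Tip"
| "dleft (Br a b) = a"

fun dright :: "data \<Rightarrow> data" where
  "dright Tip = Tip"
| "dright (Br a b) = b"

lemma dec_enc_list [simp]: "dec_list (enc_list xs) = xs"
  by (induction xs) auto

lemma enc_dec_list [simp]: "enc_list (dec_list d) = d"
  by (induction d) auto

lemma enc_list_inject [simp]: "enc_list xs = enc_list ys \<longleftrightarrow> xs = ys"
  by (metis dec_enc_list)

lemma enc_list_eq_Tip [simp]: "enc_list xs = Tip \<longleftrightarrow> xs = []"
  by (cases xs) auto

lemma dec_list_eq_Nil [simp]: "dec_list d = [] \<longleftrightarrow> d = Tip"
  by (cases d) auto

lemma eval_LeftE [simp]: "eval_expr (LeftE e) s = dleft (eval_expr e s)"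
  by (simp split: data.splits)

lemma eval_RightE [simp]: "eval_expr (RightE e) s = dright (eval_expr e s)"
  by (simp split: data.splits)

declare eval_expr.simps(4,5) [simp del]

lemma nodes_enc_list: "nodes (enc_list xs) = 1 + (\<Sum>a\<leftarrow>xs. 1 + nodes a)"
  by (induction xs) auto

lemma length_dec_list: "length (dec_list d) < nodes d"
  by (induction d) auto

lemma nodes_mem: "a \<in> set (dec_list d) \<Longrightarrow> nodes a \<le> nodes d"
  by (induction d) auto

section \<open>Polynomial bounds in the size of a tree\<close>

definition pbounded :: "(data \<Rightarrow> nat) \<Rightarrow> bool" where
  "pbounded T \<longleftrightarrow> (\<exists>c. \<forall>x. T x \<le> c * nodes x ^ c)"

lemma pow_nodes_mono: "a \<le> b \<Longrightarrow> m \<le> n \<Longrightarrow> a * nodes x ^ m \<le> b * nodes x ^ n"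
  by (intro mult_le_mono power_increasing) (use nodes_pos[of x] in auto)

text \<open>As \<open>nodes x\<close> is positive, raising a coefficient or an exponent never lowers
  a bound, so one constant can play both parts in \<open>pbounded\<close>.\<close>

lemma pboundedI: "(\<And>x. T x \<le> a * nodes x ^ b) \<Longrightarrow> pbounded T"
  unfolding pbounded_def
  by (rule exI[of _ "a + b"]) (meson order_trans pow_nodes_mono le_add1 le_add2)

lemma pbounded_mono: "pbounded T \<Longrightarrow> (\<And>x. U x \<le> T x) \<Longrightarrow> pbounded U"
  unfolding pbounded_def by (meson order_trans)

lemma pbounded_const: "pbounded (\<lambda>_. n)"
  by (rule pboundedI[of _ n 0]) simp

lemma pbounded_id: "pbounded nodes"
  by (rule pboundedI[of _ 1 1]) simp

lemma pbounded_add: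
  assumes "pbounded T" "pbounded U"
  shows "pbounded (\<lambda>x. T x + U x)"
proof -
  obtain c e where *: "\<And>x. T x \<le> c * nodes x ^ c" "\<And>x. U x \<le> e * nodes x ^ e"
    using assms unfolding pbounded_def by blast
  show ?thesis
  proof (rule pboundedI)
    fix x
    have "T x \<le> c * nodes x ^ (c + e)" "U x \<le> e * nodes x ^ (c + e)"
      using * by (meson order_trans pow_nodes_mono le_add1 le_add2 order_refl)+
    then show "T x + U x \<le> (c + e) * nodes x ^ (c + e)"
      by (simp add: algebra_simps)
  qed
qed

lemma pbounded_mult:
  assumes "pbounded T" "pbounded U"
  shows "pbounded (\<lambda>x. T x * U x)"
proof -
  obtain c e where *: "\<And>x. T x \<le> c * nodes x ^ c" "\<And>x. U x \<le> e * nodes x ^ e"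
    using assms unfolding pbounded_def by blast
  show ?thesis
  proof (rule pboundedI)
    fix x
    show "T x * U x \<le> (c * e) * nodes x ^ (c + e)"
      using mult_le_mono[OF *(1)[of x] *(2)[of x]] by (simp add: power_add algebra_simps)
  qed
qed

lemma pbounded_power: "pbounded T \<Longrightarrow> pbounded (\<lambda>x. T x ^ n)"
  by (induction n) (auto intro: pbounded_mult pbounded_const)

text \<open>\<open>T\<close> may fluctuate, so what is composed is its bound
  \<open>c * nodes y ^ c\<close>, taken at the value \<open>y = F x\<close> of polynomial
  size.\<close>

lemma pbounded_comp:
  assumes "pbounded T" "pbounded (\<lambda>x. nodes (F x))"
  shows "pbounded (\<lambda>x. T (F x))"
proof -
  obtain c where "\<And>x. T x \<le> c * nodes x ^ c"
    using assms(1) unfolding pbounded_def by blast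
  then show ?thesis
    by (intro pbounded_mono[OF pbounded_mult[OF pbounded_const pbounded_power[OF assms(2)]]])
qed

lemmas pbounded_intros =
  pbounded_const pbounded_id pbounded_add pbounded_mult pbounded_power

section \<open>Execution within time bounds and relocatable programs\<close>

definition runs :: "prog \<Rightarrow> store \<Rightarrow> nat \<Rightarrow> store \<Rightarrow> bool" where
  "runs p s t s' \<longleftrightarrow> (\<exists>u\<le>t. exec p s u s')"

text \<open>\<open>exec\<close> fixes the exact time; \<open>runs\<close> relaxes it to an upper
  bound so that times can be rounded up and both branches of a test can share one.\<close>

lemma runs_mono: "runs p s t s' \<Longrightarrow> t \<le> u \<Longrightarrow> runs p s u s'"
  unfolding runs_def by (meson order_trans)

lemma runs_Assign: "s' = s(i := eval_expr e s) \<Longrightarrow> runs (Assign i e) s (1 + cost_expr e s) s'"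
  unfolding runs_def using exec_Assign by blast

lemma runs_Seq: "runs p s t s' \<Longrightarrow> runs q s' u s'' \<Longrightarrow> runs (Seq p q) s (1 + t + u) s''"
  unfolding runs_def by (meson exec_Seq add_le_mono order_refl)

lemma runs_Cond:
  "runs (if eval_expr e s \<noteq> Tip then p else q) s t s' \<Longrightarrow>
   runs (Cond e p q) s (1 + cost_expr e s + t) s'"
  unfolding runs_def
  by (cases "eval_expr e s = Tip") (metis exec_Cond_true exec_Cond_false add_left_mono)+

lemma runs_While_false:
  "eval_expr e s = Tip \<Longrightarrow> runs (While e p) s (1 + cost_expr e s) s"
  unfolding runs_def using exec_While_false by blast

lemma runs_While_true:
  "eval_expr e s \<noteq> Tip \<Longrightarrow> runs p s t s' \<Longrightarrow> runs (While e p) s' u s'' \<Longrightarrow>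
   runs (While e p) s (1 + cost_expr e s + t + u) s''"
  unfolding runs_def by (meson exec_While_true add_le_mono order_refl)

text \<open>Expressions are charged by the size of their values, so no register grows by more than
  the elapsed time. Time bounds thereby become size bounds, as in \<open>realizes_nodes\<close> and
  \<open>ptime_nodes\<close>.\<close>

lemma exec_nodes: "exec p s t s' \<Longrightarrow> nodes (s' i) \<le> nodes (s i) + t"
proof (induction rule: exec.induct)
  case (exec_Assign j e s)
  then show ?case using nodes_eval_expr_le_cost[of e s] by auto
qed auto

text \<open>Programs are relocatable: they work on registers \<open>\<ge> r\<close> only, expect nothing about the
  contents of the registers above \<open>r\<close>, and so can be nested without interference.\<close>

definition realizes ::
    "prog \<Rightarrow> nat \<Rightarrow> ('a \<Rightarrow> data) \<Rightarrow> ('a \<Rightarrow> data) \<Rightarrow> ('a \<Rightarrow> nat) \<Rightarrow> bool" where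
  "realizes p r e F T \<longleftrightarrow>
    (\<forall>a s. s r = e a \<longrightarrow>
      (\<exists>s'. runs p s (T a) s' \<and> s' r = F a \<and> (\<forall>i<r. s' i = s i)))"

lemma realizesE:
  assumes "realizes p r e F T" "s r = e a"
  obtains s' where "runs p s (T a) s'" "s' r = F a" "\<And>i. i < r \<Longrightarrow> s' i = s i"
  using assms unfolding realizes_def by blast

lemma realizes_subst: "realizes p r id F T \<Longrightarrow> realizes p r e (\<lambda>a. F (e a)) (\<lambda>a. T (e a))"
  unfolding realizes_def by (metis id_apply)

lemma realizes_nodes:
  assumes "realizes p r e F T"
  shows "nodes (F a) \<le> nodes (e a) + T a"
proof -
  obtain s' where s': "runs p (\<lambda>_. e a) (T a) s'" "s' r = F a"
    using assms by (elim realizesE) auto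
  then obtain u where u: "u \<le> T a" "exec p (\<lambda>_. e a) u s'"
    unfolding runs_def by blast
  show ?thesis using exec_nodes[OF u(2), of r] u(1) s'(2) by simp
qed

lemma realizes_comp:
  assumes "realizes p r e F T" "realizes q r F G U"
  shows "realizes (Seq p q) r e G (\<lambda>a. 1 + T a + U a)"
  unfolding realizes_def
proof (intro allI impI)
  fix a s assume "s r = e a"
  then obtain s1 where 1: "runs p s (T a) s1" "s1 r = F a" "\<And>i. i < r \<Longrightarrow> s1 i = s i"
    by (rule realizesE[OF assms(1)]) blast
  obtain s2 where 2: "runs q s1 (U a) s2" "s2 r = G a" "\<And>i. i < r \<Longrightarrow> s2 i = s1 i"
    using realizesE[OF assms(2), of s1 a] 1(2) by blast
  show "\<exists>s'. runs (Seq p q) s (1 + T a + U a) s' \<and> s' r = G a \<and> (\<forall>i<r. s' i = s i)"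
    using runs_Seq[OF 1(1) 2(1)] 1 2 by auto
qed

text \<open>The input stays in \<open>r\<close>; \<open>p\<close> runs on a copy in
  \<open>r + 1\<close>, then \<open>q\<close> on a copy in \<open>r + 2\<close>, which leaves the
  result of \<open>p\<close> intact. The final assignment costs the size of both results, bounded
  again by input size plus time.\<close>

lemma realizes_bin:
  assumes "realizes p (r + 1) e F T" "realizes q (r + 2) e G U"
    and val: "\<And>s. eval_expr E s = H (s (r + 1)) (s (r + 2))"
    and cost: "\<And>s. cost_expr E s \<le> 1 + nodes (s (r + 1)) + nodes (s (r + 2))"
  shows "realizes
    (Seq (Assign (r + 1) (Var r)) (Seq p (Seq (Assign (r + 2) (Var r)) (Seq q (Assign r E)))))
    r e (\<lambda>a. H (F a) (G a)) (\<lambda>a. 10 + 5 * nodes (e a) + 3 * T a + 3 * U a)"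
  unfolding realizes_def
proof (intro allI impI)
  fix a s assume s: "s r = e a"
  let ?s0 = "s(r + 1 := e a)"
  have 0: "runs (Assign (r + 1) (Var r)) s (1 + nodes (e a)) ?s0"
    using runs_Assign[of ?s0 s "r + 1" "Var r"] s by simp
  obtain s1 where 1: "runs p ?s0 (T a) s1" "s1 (r + 1) = F a" "\<And>i. i < r + 1 \<Longrightarrow> s1 i = ?s0 i"
    by (rule realizesE[OF assms(1), of ?s0 a]) auto
  let ?s2 = "s1(r + 2 := e a)"
  have 2: "runs (Assign (r + 2) (Var r)) s1 (1 + nodes (e a)) ?s2"
    using runs_Assign[of ?s2 s1 "r + 2" "Var r"] s 1(3)[of r] by simp
  obtain s3 where 3: "runs q ?s2 (U a) s3" "s3 (r + 2) = G a" "\<And>i. i < r + 2 \<Longrightarrow> s3 i = ?s2 i"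
    by (rule realizesE[OF assms(2), of ?s2 a]) auto
  let ?s4 = "s3(r := H (F a) (G a))"
  have 4: "runs (Assign r E) s3 (1 + cost_expr E s3) ?s4"
    by (rule runs_Assign) (use val[of s3] 1(2) 3 in simp)
  have F: "nodes (F a) \<le> nodes (e a) + T a" "nodes (G a) \<le> nodes (e a) + U a"
    using realizes_nodes[OF assms(1)] realizes_nodes[OF assms(2)] by blast+
  have c: "cost_expr E s3 \<le> 1 + nodes (F a) + nodes (G a)"
    using cost[of s3] 1(2) 3 by simp
  have "runs (Seq (Assign (r + 1) (Var r)) (Seq p (Seq (Assign (r + 2) (Var r)) (Seq q (Assign r
      E)))))
     s (10 + 5 * nodes (e a) + 3 * T a + 3 * U a) ?s4"
    by (rule runs_mono[OF runs_Seq[OF 0 runs_Seq[OF 1(1) runs_Seq[OF 2 runs_Seq[OF 3(1) 4]]]]])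
      (use F c in linarith)
  moreover have "\<forall>i<r. ?s4 i = s i"
    using 1(3) 3(3) by auto
  ultimately show "\<exists>s'. runs (Seq (Assign (r + 1) (Var r)) (Seq p (Seq (Assign (r + 2) (Var r))
      (Seq q (Assign r E))))) s (10 + 5 * nodes (e a) + 3 * T a + 3 * U a) s' \<and>
      s' r = H (F a) (G a) \<and> (\<forall>i<r. s' i = s i)"
    by (intro exI[of _ ?s4]) simp
qed

section \<open>Closure properties of polynomial-time functions\<close>

definition ptime :: "(data \<Rightarrow> data) \<Rightarrow> bool" where
  "ptime F \<longleftrightarrow> (\<exists>T. pbounded T \<and> (\<forall>r. \<exists>p. realizes p r id F T))"

text \<open>One \<open>T\<close> serves the programs for all base registers, so nesting, which moves
  programs upwards, does not disturb the bounds.\<close>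

lemma ptimeE:
  assumes "ptime F"
  obtains T P where "pbounded T" "\<And>r. realizes (P r) r id F T"
  using assms unfolding ptime_def by metis

lemma ptime_nodes: 
  assumes "ptime F"
  shows "pbounded (\<lambda>x. nodes (F x))"
proof -
  obtain T P where *: "pbounded T" "\<And>r. realizes (P r) r id F T"
    using ptimeE[OF assms] by blast
  show ?thesis
    by (rule pbounded_mono[OF pbounded_add[OF pbounded_id *(1)]])
      (use realizes_nodes[OF *(2)] in simp)
qed

lemma ptime_comp:
  assumes "ptime G" "ptime F"
  shows "ptime (\<lambda>x. G (F x))"
proof -
  obtain T P where 1: "pbounded T" "\<And>r. realizes (P r) r id F T"
    using ptimeE[OF assms(2)] by blast
  obtain U Q where 2: "pbounded U" "\<And>r. realizes (Q r) r id G U"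
    using ptimeE[OF assms(1)] by blast
  show ?thesis unfolding ptime_def
  proof (intro exI conjI allI)
    show "pbounded (\<lambda>x. 1 + T x + U (F x))"
      by (intro pbounded_intros 1 pbounded_comp[OF 2(1)] ptime_nodes assms)
    show "realizes (Seq (P r) (Q r)) r id (\<lambda>x. G (F x)) (\<lambda>x. 1 + T x + U (F x))" for r
      by (rule realizes_comp[OF 1(2) realizes_subst[OF 2(2)]])
  qed
qed

lemma ptime_expr:
  assumes "\<And>r s. eval_expr (E r) s = F (s r)" "\<And>r s. cost_expr (E r) s \<le> 1 + nodes (s r)"
  shows "ptime F"
  unfolding ptime_def
proof (intro exI conjI allI)
  show "pbounded (\<lambda>x. 2 + nodes x)"
    by (intro pbounded_intros)
  show "realizes (Assign r (E r)) r id F (\<lambda>x. 2 + nodes x)" for r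
    unfolding realizes_def
  proof (intro allI impI)
    fix a and s :: store assume s: "s r = id a"
    show "\<exists>s'. runs (Assign r (E r)) s (2 + nodes a) s' \<and> s' r = F a \<and> (\<forall>i<r. s' i = s i)"
      by (rule exI[of _ "s(r := F a)"], intro conjI runs_mono[OF runs_Assign])
        (use assms[of r s] s in auto)
  qed
qed

lemma ptime_id: "ptime (\<lambda>x. x)"
  by (rule ptime_expr[of Var]) auto

lemma ptime_dleft_id: "ptime dleft"
  by (rule ptime_expr[of "\<lambda>r. LeftE (Var r)"]) auto

lemma ptime_dright_id: "ptime dright"
  by (rule ptime_expr[of "\<lambda>r. RightE (Var r)"]) auto

lemmas ptime_dleft = ptime_comp[OF ptime_dleft_id]
lemmas ptime_dright = ptime_comp[OF ptime_dright_id]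

lemma ptime_bin:
  assumes "ptime F" "ptime G"
    and "\<And>i j s. eval_expr (E i j) s = H (s i) (s j)"
    and "\<And>i j s. cost_expr (E i j) s \<le> 1 + nodes (s i) + nodes (s j)"
  shows "ptime (\<lambda>x. H (F x) (G x))"
proof -
  obtain T P where 1: "pbounded T" "\<And>r. realizes (P r) r id F T"
    using ptimeE[OF assms(1)] by blast
  obtain U Q where 2: "pbounded U" "\<And>r. realizes (Q r) r id G U"
    using ptimeE[OF assms(2)] by blast
  show ?thesis unfolding ptime_def
    using realizes_bin[OF 1(2) 2(2) assms(3,4)]
    by (intro exI[of _ "\<lambda>x. 10 + 5 * nodes (id x) + 3 * T x + 3 * U x"] conjI allI)
      (auto intro!: pbounded_intros 1 2)
qed

lemma ptime_Br: "ptime F \<Longrightarrow> ptime G \<Longrightarrow> ptime (\<lambda>x. Br (F x) (G x))"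
  by (rule ptime_bin[where E = "\<lambda>i j. BrE (Var i) (Var j)"]) auto

lemma ptime_const: "ptime (\<lambda>_. d)"
proof (induction d)
  case Tip
  then show ?case by (rule ptime_expr[of "\<lambda>_. TipE"]) auto
qed (rule ptime_Br)

definition ptime_pred :: "(data \<Rightarrow> bool) \<Rightarrow> bool" where
  "ptime_pred P \<longleftrightarrow> ptime (\<lambda>x. enc_bool (P x))"

lemma ptime_pred_eq: "ptime F \<Longrightarrow> ptime G \<Longrightarrow> ptime_pred (\<lambda>x. F x = G x)"
  unfolding ptime_pred_def
  by (rule ptime_bin[where E = "\<lambda>i j. EqE (Var i) (Var j)"]) (auto simp: enc_bool_def)

lemma ptime_if:
  assumes "ptime_pred P" "ptime F" "ptime G"
  shows "ptime (\<lambda>x. if P x then F x else G x)"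
proof -
  obtain V R where 0: "pbounded V" "\<And>r. realizes (R r) r id (\<lambda>x. enc_bool (P x)) V"
    using ptimeE[OF assms(1)[unfolded ptime_pred_def]] by blast
  obtain T Pr where 1: "pbounded T" "\<And>r. realizes (Pr r) r id F T"
    using ptimeE[OF assms(2)] by blast
  obtain U Q where 2: "pbounded U" "\<And>r. realizes (Q r) r id G U"
    using ptimeE[OF assms(3)] by blast
  let ?W = "\<lambda>x. 10 + nodes x + V x + T x + U x"
  let ?p = "\<lambda>r. Seq (Assign (r + 1) (Var r)) (Seq (R (r + 1)) (Cond (Var (r + 1)) (Pr r) (Q r)))"
  show ?thesis unfolding ptime_def
  proof (intro exI conjI allI)
    show "pbounded ?W"
      by (intro pbounded_intros 0 1 2)
    show "realizes (?p r) r id (\<lambda>x. if P x then F x else G x) ?W" for r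
      unfolding realizes_def
    proof (intro allI impI)
      fix a and s :: store assume s: "s r = id a"
      let ?s0 = "s(r + 1 := a)"
      have a: "runs (Assign (r + 1) (Var r)) s (1 + nodes a) ?s0"
        using runs_Assign[of ?s0 s "r + 1" "Var r"] s by simp
      obtain s1 where b: "runs (R (r + 1)) ?s0 (V a) s1" "s1 (r + 1) = enc_bool (P a)"
          "\<And>i. i < r + 1 \<Longrightarrow> s1 i = ?s0 i"
        by (rule realizesE[OF 0(2)[of "r + 1"], of ?s0 a]) auto
      have s1: "s1 r = id a" using b(3)[of r] s by simp
      obtain s2 where c: "runs (if P a then Pr r else Q r) s1 (T a + U a) s2"
          "s2 r = (if P a then F a else G a)" "\<And>i. i < r \<Longrightarrow> s2 i = s1 i"
      proof (cases "P a")
        case True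
        show ?thesis using realizesE[OF 1(2)[of r], of s1 a] s1 that True
          by (metis (full_types) runs_mono le_add1)
      next
        case False
        show ?thesis using realizesE[OF 2(2)[of r], of s1 a] s1 that False
          by (metis (full_types) runs_mono le_add2)
      qed
      have d: "runs (Cond (Var (r + 1)) (Pr r) (Q r)) s1
          (1 + cost_expr (Var (r + 1)) s1 + (T a + U a)) s2"
        by (rule runs_Cond) (use b(2) c(1) in \<open>auto simp: enc_bool_def\<close>)
      have "cost_expr (Var (r + 1)) s1 \<le> 3" using b(2) by (simp add: enc_bool_def)
      then have "runs (?p r) s (?W a) s2"
        by (intro runs_mono[OF runs_Seq[OF a runs_Seq[OF b(1) d]]]) linarith
      then show "\<exists>s'. runs (?p r) s (?W a) s' \<and> s' r = (if P a then F a else G a) \<and> (\<forall>i<r. s' i = s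
          i)"
        using b(3) c by auto
    qed
  qed
qed

text \<open>The only loop that is programmed explicitly. A polynomial-time step is not enough for a
  polynomial-time fold, since the accumulator might double in each round; hence the bound
  \<open>B\<close> on all intermediate values. The step also sees the whole input \<open>x\<close>,
  packed as \<open>Br x (Br acc a)\<close>.\<close>

lemma ptime_foldl:
  assumes H: "ptime (\<lambda>z. H (dleft z) (dleft (dright z)) (dright (dright z)))"
    and F: "ptime F" and G: "ptime (\<lambda>x. enc_list (G x))"
    and B: "pbounded B" "\<And>x j. nodes (foldl (H x) (F x) (take j (G x))) \<le> B x"
  shows "ptime (\<lambda>x. foldl (H x) (F x) (G x))"
proof -
  obtain V R where 0: "pbounded V"
      "\<And>r. realizes (R r) r id (\<lambda>z. H (dleft z) (dleft (dright z)) (dright (dright z))) V"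
    using ptimeE[OF H] by blast
  obtain T P where 1: "pbounded T" "\<And>r. realizes (P r) r id F T"
    using ptimeE[OF F] by blast
  obtain U Q where 2: "pbounded U" "\<And>r. realizes (Q r) r id (\<lambda>x. enc_list (G x)) U"
    using ptimeE[OF G] by blast
  obtain c where c: "\<And>z. V z \<le> c * nodes z ^ c"
    using 0(1) unfolding pbounded_def by blast
  define N where "N x = nodes (enc_list (G x))" for x
  \<comment> \<open>\<open>V\<close> may fluctuate, so the cost of a step is estimated through its
    polynomial bound, evaluated at a bound for the size of the packed triple.\<close>
  define C where "C x = c * (2 + nodes x + B x + N x) ^ c" for x
  \<comment> \<open>Register \<open>r\<close> keeps the input, \<open>r + 1\<close> the accumulator
    and \<open>r + 2\<close> the rest of the list; the step works in \<open>r + 3\<close> and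
    above.\<close>
  define body where "body r = Seq (Assign (r + 3) (BrE (Var r) (BrE (Var (r + 1)) (LeftE (Var (r +
      2))))))
      (Seq (R (r + 3)) (Seq (Assign (r + 1) (Var (r + 3))) (Assign (r + 2) (RightE (Var (r +
          2))))))" for r
  define K where "K x = 20 + nodes x + 5 * B x + 5 * N x + C x" for x
  have loop: "\<exists>s'. runs (While (Var (r + 2)) (body r)) s ((length xs + 1) * K x) s' \<and>
      s' (r + 1) = foldl (H x) acc xs \<and> (\<forall>i\<le>r. s' i = s i)"
    if "s r = x" "s (r + 1) = acc" "s (r + 2) = enc_list xs"
      "\<And>j. nodes (foldl (H x) acc (take j xs)) \<le> B x" "nodes (enc_list xs) \<le> N x" for r s acc xs x
    using that
  proof (induction xs arbitrary: acc s)
    case Nil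
    have "runs (While (Var (r + 2)) (body r)) s (1 + cost_expr (Var (r + 2)) s) s"
      by (rule runs_While_false) (use Nil in simp)
    then have "runs (While (Var (r + 2)) (body r)) s (K x) s"
      by (rule runs_mono) (use Nil in \<open>simp add: K_def\<close>)
    with Nil show ?case by auto
  next
    case (Cons y ys)
    let ?z = "Br x (Br acc y)"
    let ?s0 = "s(r + 3 := ?z)"
    have acc: "nodes acc \<le> B x" using Cons.prems(4)[of 0] by simp
    have acc': "nodes (H x acc y) \<le> B x" using Cons.prems(4)[of 1] by simp
    have y: "nodes y + nodes (enc_list ys) < N x" using Cons.prems(5) by simp
    have a: "runs (Assign (r + 3) (BrE (Var r) (BrE (Var (r + 1)) (LeftE (Var (r + 2)))))) s
        (5 + nodes x + nodes acc + nodes (enc_list (y # ys))) ?s0"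
      by (rule runs_mono[OF runs_Assign]) (use Cons.prems in auto)
    obtain s1 where b: "runs (R (r + 3)) ?s0 (V ?z) s1" "s1 (r + 3) = H x acc y"
        "\<And>i. i < r + 3 \<Longrightarrow> s1 i = ?s0 i"
      by (rule realizesE[OF 0(2)[of "r + 3"], of ?s0 ?z]) auto
    have V: "V ?z \<le> C x"
    proof -
      have "nodes ?z \<le> 2 + nodes x + B x + N x" using acc y by simp
      then have "nodes ?z ^ c \<le> (2 + nodes x + B x + N x) ^ c" by (rule power_mono) simp
      then have "c * nodes ?z ^ c \<le> C x" unfolding C_def by (rule mult_le_mono2)
      with c[of ?z] show ?thesis by linarith
    qed
    let ?s2 = "s1(r + 1 := H x acc y)"
    have d: "runs (Assign (r + 1) (Var (r + 3))) s1 (1 + nodes (H x acc y)) ?s2"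
      by (rule runs_mono[OF runs_Assign]) (use b in auto)
    let ?s3 = "?s2(r + 2 := enc_list ys)"
    have e: "runs (Assign (r + 2) (RightE (Var (r + 2)))) ?s2 (2 + nodes (enc_list (y # ys))) ?s3"
      by (rule runs_mono[OF runs_Assign]) (use b Cons.prems in auto)
    have body: "runs (body r) s (15 + nodes x + 2 * B x + 2 * N x + C x) ?s3"
      unfolding body_def
      by (rule runs_mono[OF runs_Seq[OF a runs_Seq[OF b(1) runs_Seq[OF d e]]]])
        (use acc acc' y V Cons.prems(5) in linarith)
    obtain s' where s': "runs (While (Var (r + 2)) (body r)) ?s3 ((length ys + 1) * K x) s'"
        "s' (r + 1) = foldl (H x) (H x acc y) ys" "\<forall>i\<le>r. s' i = ?s3 i"
    proof -
      have "?s3 r = x" using b(3)[of r] Cons.prems by simp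
      moreover have "nodes (foldl (H x) (H x acc y) (take j ys)) \<le> B x" for j
        using Cons.prems(4)[of "Suc j"] by simp
      ultimately have "\<exists>s'. runs (While (Var (r + 2)) (body r)) ?s3 ((length ys + 1) * K x) s' \<and>
          s' (r + 1) = foldl (H x) (H x acc y) ys \<and> (\<forall>i\<le>r. s' i = ?s3 i)"
        using Cons.prems(5) by (intro Cons.IH) auto
      then show ?thesis
        using that by blast
    qed
    have "runs (While (Var (r + 2)) (body r)) s
      (1 + cost_expr (Var (r + 2)) s + (15 + nodes x + 2 * B x + 2 * N x + C x) +
       (length ys + 1) * K x) s'"
      by (rule runs_While_true[OF _ body s'(1)]) (use Cons.prems in simp)
    then have "runs (While (Var (r + 2)) (body r)) s ((length (y # ys) + 1) * K x) s'"
      by (rule runs_mono) (use Cons.prems in \<open>simp add: K_def\<close>)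
    moreover have "\<forall>i\<le>r. s' i = s i"
      using s'(3) b(3) by auto
    ultimately show ?case using s'(2) by auto
  qed
  define prog where "prog r = Seq (Assign (r + 1) (Var r)) (Seq (P (r + 1)) (Seq (Assign (r + 2)
      (Var r))
      (Seq (Q (r + 2)) (Seq (While (Var (r + 2)) (body r)) (Assign r (Var (r + 1)))))))" for r
  define W where "W x = 10 + 2 * nodes x + T x + U x + (N x + 1) * K x + B x" for x
  have N: "pbounded N" unfolding N_def by (rule ptime_nodes[OF G])
  show ?thesis unfolding ptime_def
  proof (intro exI conjI allI)
    show "pbounded W"
      unfolding W_def K_def C_def by (intro pbounded_intros 1 2 N B(1))
    show "realizes (prog r) r id (\<lambda>x. foldl (H x) (F x) (G x)) W" for r
      unfolding realizes_def
    proof (intro allI impI)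
      fix x and s :: store assume s: "s r = id x"
      let ?s0 = "s(r + 1 := x)"
      have a: "runs (Assign (r + 1) (Var r)) s (1 + nodes x) ?s0"
        using runs_Assign[of ?s0 s "r + 1" "Var r"] s by simp
      obtain s1 where b: "runs (P (r + 1)) ?s0 (T x) s1" "s1 (r + 1) = F x"
          "\<And>i. i < r + 1 \<Longrightarrow> s1 i = ?s0 i"
        by (rule realizesE[OF 1(2)[of "r + 1"], of ?s0 x]) auto
      let ?s2 = "s1(r + 2 := x)"
      have c: "runs (Assign (r + 2) (Var r)) s1 (1 + nodes x) ?s2"
        using runs_Assign[of ?s2 s1 "r + 2" "Var r"] s b(3)[of r] by simp
      obtain s3 where d: "runs (Q (r + 2)) ?s2 (U x) s3" "s3 (r + 2) = enc_list (G x)"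
          "\<And>i. i < r + 2 \<Longrightarrow> s3 i = ?s2 i"
        by (rule realizesE[OF 2(2)[of "r + 2"], of ?s2 x]) auto
      obtain s4 where e: "runs (While (Var (r + 2)) (body r)) s3 ((length (G x) + 1) * K x) s4"
          "s4 (r + 1) = foldl (H x) (F x) (G x)" "\<forall>i\<le>r. s4 i = s3 i"
        using loop[of s3 r x "F x" "G x"] B(2)[of x] s b d by (auto simp: N_def)
      let ?s5 = "s4(r := foldl (H x) (F x) (G x))"
      have f: "runs (Assign r (Var (r + 1))) s4 (1 + nodes (foldl (H x) (F x) (G x))) ?s5"
        using runs_Assign[of ?s5 s4 r "Var (r + 1)"] e by simp
      have len: "(length (G x) + 1) * K x \<le> (N x + 1) * K x"
        using length_dec_list[of "enc_list (G x)"] by (intro mult_le_mono) (auto simp: N_def)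
      have "nodes (foldl (H x) (F x) (G x)) \<le> B x"
        using B(2)[of x "length (G x)"] by simp
      then have "runs (prog r) s (W x) ?s5"
        unfolding prog_def W_def
        by (intro runs_mono[OF runs_Seq[OF a runs_Seq[OF b(1) runs_Seq[OF c runs_Seq[OF d(1)
            runs_Seq[OF e(1) f]]]]]]) (use len in linarith)
      then show "\<exists>s'. runs (prog r) s (W x) s' \<and> s' r = foldl (H x) (F x) (G x) \<and> (\<forall>i<r. s' i = s
          i)"
        using b(3) d(3) e(3) by (intro exI[of _ ?s5]) auto
    qed
  qed
qed

lemma nodes_append: "nodes (enc_list (xs @ ys)) + 1 = nodes (enc_list xs) + nodes (enc_list ys)"
  by (induction xs) auto

lemma nodes_rev: "nodes (enc_list (rev xs)) = nodes (enc_list xs)"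
  by (simp add: nodes_enc_list flip: rev_map)

lemma nodes_take: "nodes (enc_list (take j xs)) \<le> nodes (enc_list xs)"
proof -
  have "nodes (enc_list (take j xs)) + nodes (enc_list (drop j xs)) = nodes (enc_list xs) + 1"
    using nodes_append[of "take j xs" "drop j xs"] by simp
  then show ?thesis using nodes_pos[of "enc_list (drop j xs)"] by linarith
qed

section \<open>Lists, predicates and bounded quantifiers in polynomial time\<close>

definition ptime_list :: "(data \<Rightarrow> data list) \<Rightarrow> bool" where
  "ptime_list F \<longleftrightarrow> ptime (\<lambda>x. enc_list (F x))"

lemma ptime_list_comp: "ptime_list G \<Longrightarrow> ptime F \<Longrightarrow> ptime_list (\<lambda>x. G (F x))"
  unfolding ptime_list_def by (rule ptime_comp)

lemma ptime_pred_comp: "ptime_pred P \<Longrightarrow> ptime F \<Longrightarrow> ptime_pred (\<lambda>x. P (F x))"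
  unfolding ptime_pred_def by (rule ptime_comp)

lemma ptime_enc_list: "ptime_list F \<Longrightarrow> ptime (\<lambda>x. enc_list (F x))"
  by (simp add: ptime_list_def)

lemma ptime_list_dec_list: "ptime F \<Longrightarrow> ptime_list (\<lambda>x. dec_list (F x))"
  by (simp add: ptime_list_def)

lemma ptime_list_const: "ptime_list (\<lambda>_. xs)"
  unfolding ptime_list_def by (rule ptime_const)

lemma ptime_list_Cons: "ptime F \<Longrightarrow> ptime_list G \<Longrightarrow> ptime_list (\<lambda>x. F x # G x)"
  unfolding ptime_list_def by (simp add: ptime_Br)

lemma ptime_list_if: "ptime_pred P \<Longrightarrow> ptime_list F \<Longrightarrow> ptime_list G \<Longrightarrow> ptime_list (\<lambda>x. if P x then F x
    else G x)"
  unfolding ptime_list_def if_distrib[of enc_list] by (rule ptime_if)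

lemma foldl_Br: "foldl (\<lambda>acc a. Br a acc) d xs = enc_list (rev xs @ dec_list d)"
  by (induction xs arbitrary: d) auto

lemma ptime_list_rev:
  assumes "ptime_list F"
  shows "ptime_list (\<lambda>x. rev (F x))"
proof -
  have "ptime (\<lambda>x. foldl (\<lambda>acc a. Br a acc) Tip (F x))"
    by (rule ptime_foldl[OF _ ptime_const assms[unfolded ptime_list_def]
          ptime_nodes[OF assms[unfolded ptime_list_def]]])
      (auto intro!: ptime_Br ptime_dleft ptime_dright ptime_id simp: foldl_Br nodes_rev nodes_take)
  then show ?thesis by (simp add: foldl_Br ptime_list_def)
qed

lemma ptime_list_append:
  assumes "ptime_list F" "ptime_list G"
  shows "ptime_list (\<lambda>x. F x @ G x)"
proof -
  have "ptime (\<lambda>x. foldl (\<lambda>acc a. Br a acc) (enc_list (G x)) (rev (F x)))"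
  proof (rule ptime_foldl[OF _ assms(2)[unfolded ptime_list_def] ptime_list_rev[OF assms(1),
      unfolded ptime_list_def]
        pbounded_add[OF ptime_nodes ptime_nodes]])
    show "ptime (\<lambda>x. enc_list (F x))" "ptime (\<lambda>x. enc_list (G x))"
      using assms by (simp_all add: ptime_list_def)
    show "nodes (foldl (\<lambda>acc a. Br a acc) (enc_list (G x)) (take j (rev (F x))))
        \<le> nodes (enc_list (F x)) + nodes (enc_list (G x))" for x j
      using nodes_append[of "rev (take j (rev (F x)))" "G x"] nodes_take[of j "rev (F x)"]
      by (simp add: foldl_Br nodes_rev)
  qed (intro ptime_Br ptime_dleft ptime_dright ptime_id)
  then show ?thesis by (simp add: foldl_Br ptime_list_def)
qed

lemma foldl_append_eq_concat:
  "foldl (\<lambda>acc a. enc_list (dec_list acc @ h a)) d xs = enc_list (dec_list d @ concat (map h xs))"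
  by (induction xs arbitrary: d) auto

lemma nodes_concat_le:
  assumes "\<And>a. a \<in> set xs \<Longrightarrow> nodes (enc_list (h a)) \<le> n"
  shows "nodes (enc_list (concat (map h xs))) \<le> 1 + length xs * n"
  using assms
proof (induction xs)
  case (Cons a xs)
  then have "nodes (enc_list (h a)) \<le> n" "nodes (enc_list (concat (map h xs))) \<le> 1 + length xs * n"
    by auto
  then show ?case using nodes_append[of "h a" "concat (map h xs)"] by simp
qed auto

text \<open>The body receives the pair of the whole input and the current element. Nested
  comprehensions and quantifiers therefore find all outer variables by projection, and polynomial
  time follows from the shape of a definition alone.\<close>

lemma ptime_list_concat_map:
  assumes F: "ptime_list F" and h: "ptime_list (\<lambda>z. h (dleft z) (dright z))"
  shows "ptime_list (\<lambda>x. concat (map (h x) (F x)))"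
proof -
  obtain c where c: "\<And>z. nodes (enc_list (h (dleft z) (dright z))) \<le> c * nodes z ^ c"
    using ptime_nodes[OF h[unfolded ptime_list_def]] unfolding pbounded_def by blast
  define N where "N x = nodes (enc_list (F x))" for x
  have N: "pbounded N"
    unfolding N_def by (rule ptime_nodes[OF F[unfolded ptime_list_def]])
  define B where "B x = 1 + N x * (c * (1 + nodes x + N x) ^ c)" for x
  have "ptime (\<lambda>x. foldl (\<lambda>acc a. enc_list (dec_list acc @ h x a)) Tip (F x))"
  proof (rule ptime_foldl[OF _ ptime_const F[unfolded ptime_list_def]])
    show "pbounded B" unfolding B_def by (intro pbounded_intros N)
    have "ptime_list (\<lambda>z. dec_list (dleft (dright z)) @ h (dleft (Br (dleft z) (dright (dright z))))
        (dright (Br (dleft z) (dright (dright z)))))"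
      by (intro ptime_list_append ptime_list_dec_list ptime_list_comp[OF h] ptime_dleft ptime_dright
          ptime_id ptime_Br)
    then show "ptime (\<lambda>z. enc_list (dec_list (dleft (dright z)) @ h (dleft z) (dright (dright z))))"
      by (simp add: ptime_list_def)
    show "nodes (foldl (\<lambda>acc a. enc_list (dec_list acc @ h x a)) Tip (take j (F x))) \<le> B x" for x j
    proof -
      have "nodes (enc_list (h x a)) \<le> c * (1 + nodes x + N x) ^ c" if "a \<in> set (F x)" for a
      proof -
        have "nodes a \<le> N x" using nodes_mem[of a "enc_list (F x)"] that by (simp add: N_def)
        then have "nodes (Br x a) \<le> 1 + nodes x + N x" by simp
        then have "c * nodes (Br x a) ^ c \<le> c * (1 + nodes x + N x) ^ c"
          by (intro mult_le_mono2 power_mono) auto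
        with c[of "Br x a"] show ?thesis by (metis dleft.simps(2) dright.simps(2) order_trans)
      qed
      then have "nodes (enc_list (concat (map (h x) (take j (F x)))))
          \<le> 1 + length (take j (F x)) * (c * (1 + nodes x + N x) ^ c)"
        by (intro nodes_concat_le) (meson in_set_takeD)
      moreover have "length (take j (F x)) \<le> N x"
        using length_dec_list[of "enc_list (F x)"] by (simp add: N_def)
      ultimately show ?thesis
        unfolding B_def foldl_append_eq_concat
        by (simp del: length_take) (meson add_left_mono le_trans mult_le_mono1 Suc_le_mono)
    qed
  qed
  then show ?thesis by (simp add: foldl_append_eq_concat ptime_list_def)
qed

lemma ptime_list_map:
  assumes "ptime_list F" "ptime (\<lambda>z. f (dleft z) (dright z))"
  shows "ptime_list (\<lambda>x. map (f x) (F x))"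
proof -
  have "ptime_list (\<lambda>x. concat (map (\<lambda>a. [f x a]) (F x)))"
    by (intro ptime_list_concat_map ptime_list_Cons ptime_list_const assms)
  then show ?thesis by simp
qed

lemma ptime_pred_eq_list: "ptime_list F \<Longrightarrow> ptime_list G \<Longrightarrow> ptime_pred (\<lambda>x. F x = G x)"
  using ptime_pred_eq[of "\<lambda>x. enc_list (F x)" "\<lambda>x. enc_list (G x)"] by (simp add: ptime_list_def)

lemma ptime_pred_const: "ptime_pred (\<lambda>_. b)"
  unfolding ptime_pred_def by (rule ptime_const)

lemma ptime_pred_if: "ptime_pred P \<Longrightarrow> ptime_pred Q \<Longrightarrow> ptime_pred R \<Longrightarrow> ptime_pred (\<lambda>x. if P x then Q x
    else R x)"
  unfolding ptime_pred_def[of "\<lambda>x. if P x then Q x else R x"] if_distrib[of enc_bool]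
  by (rule ptime_if) (simp_all add: ptime_pred_def)

lemma ptime_pred_not: "ptime_pred P \<Longrightarrow> ptime_pred (\<lambda>x. \<not> P x)"
proof -
  assume "ptime_pred P"
  then have "ptime_pred (\<lambda>x. if P x then False else True)" by (intro ptime_pred_if ptime_pred_const)
  moreover have "(\<lambda>x. if P x then False else True) = (\<lambda>x. \<not> P x)" by auto
  ultimately show ?thesis by simp
qed

lemma ptime_pred_conj: "ptime_pred P \<Longrightarrow> ptime_pred Q \<Longrightarrow> ptime_pred (\<lambda>x. P x \<and> Q x)"
proof -
  assume "ptime_pred P" "ptime_pred Q"
  then have "ptime_pred (\<lambda>x. if P x then Q x else False)" by (intro ptime_pred_if ptime_pred_const)
  moreover have "(\<lambda>x. if P x then Q x else False) = (\<lambda>x. P x \<and> Q x)" by auto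
  ultimately show ?thesis by simp
qed

lemma ptime_pred_disj: "ptime_pred P \<Longrightarrow> ptime_pred Q \<Longrightarrow> ptime_pred (\<lambda>x. P x \<or> Q x)"
  using ptime_pred_not[OF ptime_pred_conj[OF ptime_pred_not[of P] ptime_pred_not[of Q]]] by simp

lemma ptime_pred_imp: "ptime_pred P \<Longrightarrow> ptime_pred Q \<Longrightarrow> ptime_pred (\<lambda>x. P x \<longrightarrow> Q x)"
  using ptime_pred_disj[OF ptime_pred_not[of P], of Q] unfolding imp_conv_disj .

lemma ptime_pred_iff: "ptime_pred P \<Longrightarrow> ptime_pred Q \<Longrightarrow> ptime_pred (\<lambda>x. P x \<longleftrightarrow> Q x)"
proof -
  assume *: "ptime_pred P" "ptime_pred Q"
  then have "ptime_pred (\<lambda>x. if P x then Q x else \<not> Q x)" by (intro ptime_pred_if ptime_pred_not)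
  moreover have "(\<lambda>x. if P x then Q x else \<not> Q x) = (\<lambda>x. P x = Q x)" by auto
  ultimately show ?thesis by simp
qed

text \<open>A bounded universal quantifier is the emptiness test for the list of
  counterexamples.\<close>

lemma ptime_pred_Ball:
  assumes "ptime_list F" "ptime_pred (\<lambda>z. P (dleft z) (dright z))"
  shows "ptime_pred (\<lambda>x. \<forall>a\<in>set (F x). P x a)"
proof -
  have "ptime_pred (\<lambda>x. concat (map (\<lambda>a. if P x a then [] else [Tip]) (F x)) = [])"
    by (intro ptime_pred_eq_list ptime_list_concat_map ptime_list_if ptime_list_const assms)
  moreover have "concat (map (\<lambda>a. if P x a then [] else [Tip]) (F x)) = [] \<longleftrightarrow> (\<forall>a\<in>set (F x). P x a)"
      for x
    by (simp add: concat_eq_Nil_conv split: if_splits) blast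
  ultimately show ?thesis by simp
qed

lemma ptime_pred_Bex:
  assumes "ptime_list F" "ptime_pred (\<lambda>z. P (dleft z) (dright z))"
  shows "ptime_pred (\<lambda>x. \<exists>a\<in>set (F x). P x a)"
  using ptime_pred_not[OF ptime_pred_Ball[OF assms(1) ptime_pred_not[OF assms(2)]]] by simp

lemma ptime_pred_mem:
  assumes "ptime F" "ptime_list G"
  shows "ptime_pred (\<lambda>x. F x \<in> set (G x))"
proof -
  have "ptime_pred (\<lambda>x. \<exists>a\<in>set (G x). F x = a)"
    by (intro ptime_pred_Bex ptime_pred_eq assms ptime_comp[OF assms(1)] ptime_dleft ptime_dright
        ptime_id)
  then show ?thesis by simp
qed

text \<open>The accumulator lists the suffixes longest first, so the next one extends
  \<open>dleft acc\<close>. Suffixes show an element together with all that follows it, which a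
  plain traversal does not; \<open>remdups\<close>, \<open>combs\<close>, gaps and comparisons are
  built on them.\<close>

lemma foldl_suffixes:
  "foldl (\<lambda>acc a. Br (Br a (dleft acc)) acc) (Br Tip Tip) (rev xs) =
    enc_list (rev (map enc_list (suffixes xs)))"
proof (induction xs)
  case (Cons x xs)
  have "dleft (enc_list (rev (map enc_list (suffixes xs)))) = enc_list xs"
    by (cases xs) auto
  with Cons show ?case by simp
qed simp

lemma nodes_suffixes:
  "nodes (enc_list (map enc_list (suffixes xs))) \<le> (length xs + 2) * (1 + nodes (enc_list xs))"
proof (induction xs)
  case (Cons x xs)
  let ?n = "1 + nodes (enc_list (x # xs))"
  have "nodes (enc_list (map enc_list (suffixes (x # xs)))) + 1
      = nodes (enc_list (map enc_list (suffixes xs))) + (2 + nodes (enc_list (x # xs)))"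
    using nodes_append[of "map enc_list (suffixes xs)" "[enc_list (x # xs)]"] by simp
  moreover have "(length xs + 2) * (1 + nodes (enc_list xs)) \<le> (length xs + 2) * ?n"
    by (intro mult_le_mono2) simp
  moreover have "(length (x # xs) + 2) * ?n = (length xs + 2) * ?n + ?n" by simp
  ultimately show ?case using Cons by linarith
qed simp

lemma ptime_list_suffixes:
  assumes "ptime_list F"
  shows "ptime_list (\<lambda>x. map enc_list (suffixes (F x)))"
proof -
  define N where "N x = nodes (enc_list (F x))" for x
  have N: "pbounded N"
    unfolding N_def by (rule ptime_nodes[OF assms[unfolded ptime_list_def]])
  have "ptime (\<lambda>x. foldl (\<lambda>acc a. Br (Br a (dleft acc)) acc) (Br Tip Tip) (rev (F x)))"
  proof (rule ptime_foldl[OF _ ptime_const ptime_list_rev[OF assms, unfolded ptime_list_def]])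
    show "pbounded (\<lambda>x. (N x + 2) * (1 + N x))" by (intro pbounded_intros N)
    show "nodes (foldl (\<lambda>acc a. Br (Br a (dleft acc)) acc) (Br Tip Tip) (take j (rev (F x))))
        \<le> (N x + 2) * (1 + N x)" for x j
    proof -
      let ?ys = "rev (take j (rev (F x)))"
      have "nodes (foldl (\<lambda>acc a. Br (Br a (dleft acc)) acc) (Br Tip Tip) (take j (rev (F x))))
          \<le> (length ?ys + 2) * (1 + nodes (enc_list ?ys))"
        using foldl_suffixes[of ?ys] nodes_suffixes[of ?ys] by (simp add: nodes_rev)
      moreover have "nodes (enc_list ?ys) \<le> N x"
        using nodes_take[of j "rev (F x)"] by (simp add: nodes_rev N_def)
      moreover have "length ?ys \<le> N x"
        using length_dec_list[of "enc_list (F x)"] by (simp add: N_def)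
      ultimately show ?thesis by (meson add_le_mono mult_le_mono order_refl order_trans)
    qed
  qed (intro ptime_Br ptime_dleft ptime_dright ptime_id)
  then have "ptime_list (\<lambda>x. rev (map enc_list (suffixes (F x))))"
    by (simp add: foldl_suffixes ptime_list_def)
  from ptime_list_rev[OF this] show ?thesis by simp
qed

text \<open>\<open>remdups\<close> keeps an element iff it does not recur later, a property of the
  suffix that starts there. The test for \<open>Tip\<close> discards the empty suffix.\<close>

lemma remdups_suffixes:
  "remdups xs = concat (map (\<lambda>t. if t = Tip \<or> dleft t \<in> set (dec_list (dright t)) then [] else
      [dleft t])
    (rev (map enc_list (suffixes xs))))"
  by (induction xs) auto

lemma ptime_list_remdups: "ptime_list F \<Longrightarrow> ptime_list (\<lambda>x. remdups (F x))"
  unfolding remdups_suffixes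
  by (intro ptime_list_concat_map ptime_list_rev ptime_list_suffixes ptime_list_if ptime_list_const
      ptime_list_Cons ptime_pred_disj ptime_pred_mem ptime_pred_eq
      ptime_list_dec_list ptime_dleft ptime_dright ptime_id ptime_const)

text \<open>The list \<open>as\<close> is fixed outside the machine, so the loop is unrolled. This
  handles the atoms and variables of the fixed query.\<close>

lemma ptime_list_map_list:
  "(\<And>a. a \<in> set as \<Longrightarrow> ptime (F a)) \<Longrightarrow> ptime_list (\<lambda>x. map (\<lambda>a. F a x) as)"
  by (induction as) (auto intro: ptime_list_const ptime_list_Cons)

fun combs :: "nat \<Rightarrow> 'a list \<Rightarrow> 'a list list" where
  "combs 0 xs = [[]]"
| "combs (Suc j) [] = []"
| "combs (Suc j) (x # xs) = combs (Suc j) xs @ map ((#) x) (combs j xs)"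

text \<open>The suffix starting at the first chosen element determines what may still be chosen. The
  order of \<open>combs\<close> is made to agree with \<open>suffixes\<close>, which begins with the
  shortest one.\<close>

lemma combs_Suc_suffixes:
  "map enc_list (combs (Suc j) xs) = concat (map (\<lambda>t. if t = Tip then [] else
    map (\<lambda>c. Br (dleft t) c) (map enc_list (combs j (dec_list (dright t))))) (map enc_list (suffixes
        xs)))"
  by (induction xs) auto

text \<open>The induction is on the constant \<open>j\<close>, and the degree of the polynomial
  grows with it. It is applied with \<open>j\<close> depending on \<open>d\<close> only, never on
  the parameter.\<close>

lemma ptime_list_combs: "ptime_list F \<Longrightarrow> ptime_list (\<lambda>x. map enc_list (combs j (F x)))"
proof (induction j arbitrary: F)
  case 0
  then show ?case by (simp add: ptime_list_const)
next
  case (Suc j)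
  show ?case unfolding combs_Suc_suffixes
    by (intro ptime_list_concat_map ptime_list_suffixes Suc ptime_list_if ptime_list_const
        ptime_pred_eq ptime_list_map ptime_Br ptime_list_dec_list
        ptime_dleft ptime_dright ptime_id ptime_const)
qed

section \<open>Unary arithmetic\<close>

definition ptime_nat :: "(data \<Rightarrow> nat) \<Rightarrow> bool" where
  "ptime_nat N \<longleftrightarrow> ptime (\<lambda>x. enc_unary (N x))"

lemma ptime_nat_length: "ptime_list F \<Longrightarrow> ptime_nat (\<lambda>x. length (F x))"
  using ptime_list_map[OF _ ptime_const[of Tip], of F]
  by (simp add: ptime_nat_def ptime_list_def enc_unary_def map_replicate_const)

lemma ptime_list_replicate: "ptime_nat N \<Longrightarrow> ptime_list (\<lambda>x. replicate (N x) Tip)"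
  by (simp add: ptime_nat_def ptime_list_def enc_unary_def)

lemma ptime_nat_const: "ptime_nat (\<lambda>_. n)"
  unfolding ptime_nat_def by (rule ptime_const)

lemma ptime_nat_add: "ptime_nat N \<Longrightarrow> ptime_nat M \<Longrightarrow> ptime_nat (\<lambda>x. N x + M x)"
  using ptime_nat_length[OF ptime_list_append[OF ptime_list_replicate ptime_list_replicate], of N M]
      by simp

lemma ptime_nat_comp: "ptime_nat N \<Longrightarrow> ptime F \<Longrightarrow> ptime_nat (\<lambda>x. N (F x))"
  unfolding ptime_nat_def by (rule ptime_comp)

lemma ptime_nat_mult:
  assumes "ptime_nat N" "ptime_nat M"
  shows "ptime_nat (\<lambda>x. N x * M x)"
proof -
  have "ptime_nat (\<lambda>x. length (concat (map (\<lambda>_. replicate (M x) Tip) (replicate (N x) Tip))))"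
    by (intro ptime_nat_length ptime_list_concat_map ptime_list_replicate assms ptime_nat_comp[OF
        assms(2)] ptime_dleft_id)
  then show ?thesis by (simp add: length_concat sum_list_replicate)
qed

lemma ptime_nat_power: "ptime_nat N \<Longrightarrow> ptime_nat (\<lambda>x. N x ^ n)"
  by (induction n) (auto intro: ptime_nat_const ptime_nat_mult)

lemma length_combs: "length (combs j xs) = length xs choose j"
  by (induction j xs rule: combs.induct) auto

text \<open>The lower index is a constant, so counting the members of \<open>combs\<close> is
  polynomial in the upper one.\<close>

lemma ptime_nat_binomial: "ptime_nat N \<Longrightarrow> ptime_nat (\<lambda>x. N x choose n)"
  using ptime_nat_length[OF ptime_list_combs[OF ptime_list_replicate], of N n] by (simp add:
      length_combs)

section \<open>Binary numbers\<close>

text \<open>One step of ripple-carry increment. The state \<open>Br carry done\<close> holds the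
  finished bits most significant first, as the input is read from the least significant bit;
  \<open>incr\<close> turns a carry left at the end into a new top bit.\<close>

definition incr_step :: "data \<Rightarrow> data \<Rightarrow> data" where
  "incr_step st b = (if dleft st = Tip then Br Tip (Br b (dright st))
     else if b = Tip then Br Tip (Br (enc_bool True) (dright st)) else Br (enc_bool True) (Br Tip
         (dright st)))"

definition incr :: "data \<Rightarrow> data" where
  "incr d = (let st = foldl incr_step (Br (enc_bool True) Tip) (dec_list d) in
     enc_list (rev (if dleft st = Tip then dec_list (dright st) else enc_bool True # dec_list
         (dright st))))"

lemma enc_nat_0 [simp]: "enc_nat 0 = Tip"
  by (simp add: enc_nat.simps)

lemma enc_nat_pos: "n > 0 \<Longrightarrow> enc_nat n = Br (enc_bool (odd n)) (enc_nat (n div 2))"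
  by (subst enc_nat.simps) simp

lemma enc_bool_simps [simp]: "enc_bool False = Tip" "enc_bool True = Br Tip Tip"
  by (simp_all add: enc_bool_def)

lemma enc_bool_inject [simp]: "enc_bool a = enc_bool b \<longleftrightarrow> a = b"
  by (simp add: enc_bool_def)

lemma foldl_incr_step_idle:
  "foldl incr_step (Br Tip acc) bs = Br Tip (enc_list (rev bs @ dec_list acc))"
  by (induction bs arbitrary: acc) (auto simp: incr_step_def)

lemma incr_enc_nat: "incr (enc_nat n) = enc_nat (Suc n)"
proof -
  have step: "incr_step (Br (Br Tip Tip) acc) Tip = Br Tip (Br (Br Tip Tip) acc)"
    "incr_step (Br (Br Tip Tip) acc) (Br Tip Tip) = Br (Br Tip Tip) (Br Tip acc)" for acc
    by (simp_all add: incr_step_def)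
  \<comment> \<open>Generalised to any finished bits \<open>acc\<close>: an odd number hands the
    carry on to \<open>n div 2\<close>, an even one absorbs it and the remaining bits are
    copied.\<close>
  have "(let st = foldl incr_step (Br (Br Tip Tip) acc) (dec_list (enc_nat n)) in
      rev (if dleft st = Tip then dec_list (dright st) else Br Tip Tip # dec_list (dright st))) =
      rev (dec_list acc) @ dec_list (enc_nat (Suc n))" for acc
  proof (induction n arbitrary: acc rule: less_induct)
    case (less n)
    show ?case
    proof (cases "n = 0")
      case True
      then show ?thesis by (simp add: enc_nat_pos)
    next
      case False
      show ?thesis
      proof (cases "odd n")
        case True
        have "n div 2 < n" using False by simp
        with less[of "n div 2" "Br Tip acc"] True False show ?thesis
          by (simp add: enc_nat_pos step Let_def)
      next
        case even: False
        then show ?thesis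
          using False by (simp add: enc_nat_pos step foldl_incr_step_idle Let_def)
      qed
    qed
  qed
  from this[of Tip] have "dec_list (incr (enc_nat n)) = dec_list (enc_nat (Suc n))"
    by (simp only: incr_def Let_def dec_enc_list enc_bool_simps dec_list.simps rev.simps append_Nil)
  then show ?thesis by (metis enc_dec_list)
qed

lemma nodes_foldl_incr_step:
  "nodes (foldl incr_step st bs) \<le> nodes st + 3 + 4 * (\<Sum>b\<leftarrow>bs. 1 + nodes b)"
proof (induction bs arbitrary: st)
  case (Cons b bs)
  have "nodes (incr_step st b) \<le> nodes st + 4 * (1 + nodes b)"
    using nodes_pos[of b] by (cases st) (auto simp: incr_step_def)
  with Cons[of "incr_step st b"] show ?case by simp
qed simp

lemma ptime_incr: "ptime incr"
proof -
  have "ptime (\<lambda>x. foldl incr_step (Br (enc_bool True) Tip) (dec_list x))"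
  proof (rule ptime_foldl)
    show "ptime (\<lambda>z. incr_step (dleft (dright z)) (dright (dright z)))"
      unfolding incr_step_def
      by (intro ptime_if ptime_pred_eq ptime_Br ptime_dleft ptime_dright ptime_id ptime_const)
    show "pbounded (\<lambda>x. 8 + 4 * nodes x)"
      by (intro pbounded_intros)
    show "nodes (foldl incr_step (Br (enc_bool True) Tip) (take j (dec_list x))) \<le> 8 + 4 * nodes x"
        for j x
      using nodes_foldl_incr_step[of "Br (enc_bool True) Tip" "take j (dec_list x)"]
        nodes_enc_list[of "take j (dec_list x)"] nodes_take[of j "dec_list x"] by simp
  qed (intro ptime_const ptime_id ptime_enc_list ptime_list_dec_list)+
  then have "ptime_list (\<lambda>x. (\<lambda>st. rev (if dleft st = Tip then dec_list (dright st)
      else enc_bool True # dec_list (dright st))) (foldl incr_step (Br (enc_bool True) Tip)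
          (dec_list x)))"
    by (rule ptime_list_comp[rotated])
      (intro ptime_list_rev ptime_list_if ptime_pred_eq ptime_list_Cons ptime_list_dec_list
          ptime_dleft ptime_dright ptime_id ptime_const)
  then show ?thesis by (simp add: incr_def[abs_def] ptime_list_def Let_def del: enc_bool_simps)
qed

lemma nodes_enc_nat: "nodes (enc_nat n) \<le> 1 + 4 * n"
proof (induction n rule: less_induct)
  case (less n)
  show ?case
  proof (cases "n = 0")
    case False
    have "nodes (enc_bool (odd n)) \<le> 3" by (simp add: enc_bool_def)
    moreover have "nodes (enc_nat (n div 2)) \<le> 1 + 4 * (n div 2)" using less False by simp
    moreover have "n div 2 + 1 \<le> n" using False by simp
    ultimately have "1 + nodes (enc_bool (odd n)) + nodes (enc_nat (n div 2)) \<le> 1 + 4 * n" by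
        linarith
    then show ?thesis using False by (simp add: enc_nat_pos)
  qed simp
qed

text \<open>Conversion from unary to binary by counting up. The crude linear bound
  \<open>nodes_enc_nat\<close> is enough, because the count is the length of a list at hand.\<close>

lemma ptime_enc_nat:
  assumes "ptime_nat N"
  shows "ptime (\<lambda>x. enc_nat (N x))"
proof -
  have "foldl (\<lambda>acc _. incr acc) (enc_nat m) (replicate n a) = enc_nat (m + n)" for m n and a ::
      data
    by (induction n arbitrary: m) (auto simp: incr_enc_nat)
  from this[of 0] have fold: "foldl (\<lambda>acc _. incr acc) Tip (replicate n a) = enc_nat n"
    for n and a :: data by simp
  have rep: "ptime_list (\<lambda>x. replicate (N x) Tip)"
    by (rule ptime_list_replicate[OF assms])
  have "ptime (\<lambda>x. foldl (\<lambda>acc _. incr acc) Tip (replicate (N x) Tip))"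
  proof (rule ptime_foldl[OF _ ptime_const rep[unfolded ptime_list_def]])
    show "ptime (\<lambda>z. incr (dleft (dright z)))"
      by (intro ptime_comp[OF ptime_incr] ptime_dleft ptime_dright ptime_id)
    show "pbounded (\<lambda>x. 1 + 4 * nodes (enc_list (replicate (N x) Tip)))"
      by (intro pbounded_intros ptime_nodes ptime_enc_list rep)
    show "nodes (foldl (\<lambda>acc _. incr acc) Tip (take j (replicate (N x) Tip)))
      \<le> 1 + 4 * nodes (enc_list (replicate (N x) Tip))" for x j
      using nodes_enc_nat[of "min j (N x)"] length_dec_list[of "enc_list (replicate (N x) Tip)"]
      by (simp add: fold)
  qed
  then show ?thesis by (simp add: fold)
qed

lemmas ptime_intros = ptime_id ptime_const ptime_dleft ptime_dright ptime_Br ptime_if ptime_enc_list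
  ptime_enc_nat ptime_list_const ptime_list_dec_list ptime_list_Cons ptime_list_append ptime_list_if
      ptime_list_rev ptime_list_concat_map ptime_list_map
  ptime_list_remdups ptime_list_replicate ptime_pred_const ptime_pred_eq ptime_pred_if
      ptime_pred_not ptime_pred_conj ptime_pred_disj ptime_pred_imp ptime_pred_iff
  ptime_pred_Ball ptime_pred_Bex ptime_pred_mem ptime_nat_const ptime_nat_add ptime_nat_mult
      ptime_nat_power ptime_nat_binomial

section \<open>Relocation of programs and computability\<close>

fun shift_expr :: "nat \<Rightarrow> expr \<Rightarrow> expr" where
  "shift_expr r (Var i) = Var (i + r)"
| "shift_expr r TipE = TipE"
| "shift_expr r (BrE e1 e2) = BrE (shift_expr r e1) (shift_expr r e2)"
| "shift_expr r (LeftE e) = LeftE (shift_expr r e)"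
| "shift_expr r (RightE e) = RightE (shift_expr r e)"
| "shift_expr r (EqE e1 e2) = EqE (shift_expr r e1) (shift_expr r e2)"

text \<open>A program provided by \<open>computable_nat\<close> works from register 0 upwards and
  relies on empty registers. Shifting it, after clearing the registers it uses, makes it
  relocatable.\<close>

fun shift :: "nat \<Rightarrow> prog \<Rightarrow> prog" where
  "shift r (Assign i e) = Assign (i + r) (shift_expr r e)"
| "shift r (Seq p q) = Seq (shift r p) (shift r q)"
| "shift r (Cond e p q) = Cond (shift_expr r e) (shift r p) (shift r q)"
| "shift r (While e p) = While (shift_expr r e) (shift r p)"

fun regs_expr :: "expr \<Rightarrow> nat set" where
  "regs_expr (Var i) = {i}"
| "regs_expr TipE = {}"
| "regs_expr (BrE e1 e2) = regs_expr e1 \<union> regs_expr e2"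
| "regs_expr (LeftE e) = regs_expr e"
| "regs_expr (RightE e) = regs_expr e"
| "regs_expr (EqE e1 e2) = regs_expr e1 \<union> regs_expr e2"

fun regs :: "prog \<Rightarrow> nat set" where
  "regs (Assign i e) = insert i (regs_expr e)"
| "regs (Seq p q) = regs p \<union> regs q"
| "regs (Cond e p q) = regs_expr e \<union> regs p \<union> regs q"
| "regs (While e p) = regs_expr e \<union> regs p"

lemma finite_regs_expr: "finite (regs_expr e)"
  by (induction e) auto

lemma finite_regs: "finite (regs p)"
  by (induction p) (auto simp: finite_regs_expr)

lemma shift_expr:
  assumes "\<forall>i\<in>regs_expr e. S (i + r) = s i"
  shows "eval_expr (shift_expr r e) S = eval_expr e s" "cost_expr (shift_expr r e) S = cost_expr e
      s"
  using assms by (induction e) auto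

text \<open>The set \<open>M\<close> stays fixed during the induction, so agreement of the stores on
  it passes to all subprograms and to the further rounds of a loop.\<close>

lemma exec_shift:
  assumes "exec p s t s'" "regs p \<subseteq> M" "\<forall>i\<in>M. S (i + r) = s i"
  shows "\<exists>S'. exec (shift r p) S t S' \<and> (\<forall>i\<in>M. S' (i + r) = s' i) \<and> (\<forall>i<r. S' i = S i)"
  using assms
proof (induction arbitrary: S rule: exec.induct)
  case (exec_Assign i e s)
  then have "\<forall>i\<in>regs_expr e. S (i + r) = s i" by auto
  note e = shift_expr[OF this]
  have 1: "exec (shift r (Assign i e)) S (1 + cost_expr e s) (S(i + r := eval_expr e s))"
    using exec.exec_Assign[of "i + r" "shift_expr r e" S] unfolding e by simp
  have 2: "\<forall>j\<in>M. (S(i + r := eval_expr e s)) (j + r) = (s(i := eval_expr e s)) j"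
    using exec_Assign(2) by simp
  have 3: "\<forall>j<r. (S(i + r := eval_expr e s)) j = S j" by simp
  show ?case
    by (rule exI, intro conjI, rule 1, rule 2, rule 3)
next
  case (exec_Seq p s t s' q u s'')
  have sub: "regs p \<subseteq> M" "regs q \<subseteq> M" using exec_Seq.prems(1) by auto
  obtain S' where S': "exec (shift r p) S t S'" "\<forall>i\<in>M. S' (i + r) = s' i" "\<forall>i<r. S' i = S i"
    using exec_Seq.IH(1)[OF sub(1) exec_Seq.prems(2)] by blast
  obtain S'' where S'': "exec (shift r q) S' u S''" "\<forall>i\<in>M. S'' (i + r) = s'' i"
      "\<forall>i<r. S'' i = S' i"
    using exec_Seq.IH(2)[OF sub(2) S'(2)] by blast
  show ?case
    using exec.exec_Seq[OF S'(1) S''(1)] S'(3) S''(2,3) by (intro exI[of _ S'']) simp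
next
  case (exec_Cond_true e s p t s' q)
  have sub: "regs p \<subseteq> M" "regs_expr e \<subseteq> M" using exec_Cond_true.prems(1) by auto
  then have "\<forall>i\<in>regs_expr e. S (i + r) = s i" using exec_Cond_true.prems(2) by blast
  note e = shift_expr[OF this]
  obtain S' where S': "exec (shift r p) S t S'" "\<forall>i\<in>M. S' (i + r) = s' i" "\<forall>i<r. S' i = S i"
    using exec_Cond_true.IH[OF sub(1) exec_Cond_true.prems(2)] by blast
  have "eval_expr (shift_expr r e) S \<noteq> Tip" using exec_Cond_true.hyps e by simp
  from exec.exec_Cond_true[OF this S'(1), of "shift r q"] show ?case
    using S'(2,3) e by (intro exI[of _ S']) simp
next
  case (exec_Cond_false e s q t s' p)
  have sub: "regs q \<subseteq> M" "regs_expr e \<subseteq> M" using exec_Cond_false.prems(1) by auto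
  then have "\<forall>i\<in>regs_expr e. S (i + r) = s i" using exec_Cond_false.prems(2) by blast
  note e = shift_expr[OF this]
  obtain S' where S': "exec (shift r q) S t S'" "\<forall>i\<in>M. S' (i + r) = s' i" "\<forall>i<r. S' i = S i"
    using exec_Cond_false.IH[OF sub(1) exec_Cond_false.prems(2)] by blast
  have "eval_expr (shift_expr r e) S = Tip" using exec_Cond_false.hyps e by simp
  from exec.exec_Cond_false[OF this S'(1), of "shift r p"] show ?case
    using S'(2,3) e by (intro exI[of _ S']) simp
next
  case (exec_While_true e s p t s' u s'')
  have sub: "regs p \<subseteq> M" "regs_expr e \<subseteq> M" using exec_While_true.prems(1) by auto
  then have "\<forall>i\<in>regs_expr e. S (i + r) = s i" using exec_While_true.prems(2) by blast
  note e = shift_expr[OF this]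
  obtain S' where S': "exec (shift r p) S t S'" "\<forall>i\<in>M. S' (i + r) = s' i" "\<forall>i<r. S' i = S i"
    using exec_While_true.IH(1)[OF sub(1) exec_While_true.prems(2)] by blast
  obtain S'' where S'': "exec (shift r (While e p)) S' u S''" "\<forall>i\<in>M. S'' (i + r) = s'' i"
      "\<forall>i<r. S'' i = S' i"
    using exec_While_true.IH(2)[OF exec_While_true.prems(1) S'(2)] by blast
  have "eval_expr (shift_expr r e) S \<noteq> Tip" using exec_While_true.hyps e by simp
  from exec.exec_While_true[OF this S'(1) S''(1)[unfolded shift.simps]] show ?case
    using S'(3) S''(2,3) e by (intro exI[of _ S'']) simp
next
  case (exec_While_false e s p)
  then have "\<forall>i\<in>regs_expr e. S (i + r) = s i" by auto
  note e = shift_expr[OF this]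
  show ?case
    using exec.exec_While_false[of "shift_expr r e" S "shift r p"] exec_While_false e by auto
qed

text \<open>The language has no skip; the self-assignment of \<open>r\<close> takes its place and
  accounts for \<open>nodes (s r)\<close> in the running time.\<close>

fun clear :: "nat \<Rightarrow> nat \<Rightarrow> prog" where
  "clear r 0 = Assign r (Var r)"
| "clear r (Suc m) = Seq (clear r m) (Assign (r + Suc m) TipE)"

lemma runs_clear:
  "runs (clear r m) s (1 + nodes (s r) + 3 * m) (\<lambda>i. if r < i \<and> i \<le> r + m then Tip else s i)"
proof (induction m)
  case 0
  have "(\<lambda>i. if r < i \<and> i \<le> r then Tip else s i) = s"
    by (rule ext, rule if_not_P) linarith
  then show ?case unfolding clear.simps by (rule_tac runs_mono[OF runs_Assign]) simp_all
next
  case (Suc m)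
  show ?case unfolding clear.simps
    by (rule runs_mono[OF runs_Seq[OF Suc runs_Assign]]) auto
qed

text \<open>Computability only promises halting, so \<open>T\<close> is merely some function of
  \<open>n\<close>. That is all that is asked of the bounds in an fpt-reduction.\<close>

lemma realizes_computable:
  assumes "computable_nat f"
  shows "\<exists>p T. realizes p r enc_unary (\<lambda>n. enc_unary (f n)) T"
proof -
  obtain p where "\<And>n. \<exists>t. computes_in p (enc_unary n) (enc_unary (f n)) t"
    using assms unfolding computable_nat_def by blast
  then obtain T where T: "\<And>n. computes_in p (enc_unary n) (enc_unary (f n)) (T n)"
    by metis
  obtain m where m: "regs p \<subseteq> {..m}"
    using finite_regs[of p] unfolding finite_nat_set_iff_bounded_le by auto
  have "realizes (Seq (clear r m) (shift r p)) r enc_unary (\<lambda>n. enc_unary (f n))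
      (\<lambda>n. 1 + (1 + nodes (enc_unary n) + 3 * m) + T n)"
    unfolding realizes_def
  proof (intro allI impI)
    fix n and s :: store
    assume s: "s r = enc_unary n"
    let ?S = "\<lambda>i. if r < i \<and> i \<le> r + m then Tip else s i"
    obtain s' where s': "exec p ((\<lambda>_. Tip)(0 := enc_unary n)) (T n) s'" "s' 0 = enc_unary (f n)"
      using T[of n] unfolding computes_in_def by blast
    have "\<forall>i\<in>{..m}. ?S (i + r) = ((\<lambda>_. Tip)(0 := enc_unary n)) i"
      using s by auto
    from exec_shift[OF s'(1) m this] obtain S' where
      S': "exec (shift r p) ?S (T n) S'" "\<forall>i\<in>{..m}. S' (i + r) = s' i" "\<forall>i<r. S' i = ?S i"
      by blast
    have "runs (shift r p) ?S (T n) S'"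
      using S'(1) unfolding runs_def by blast
    from runs_Seq[OF runs_clear this]
    have "runs (Seq (clear r m) (shift r p)) s (1 + (1 + nodes (enc_unary n) + 3 * m) + T n) S'"
      by (simp add: s)
    moreover have "S' r = enc_unary (f n)" using S'(2) s'(2) by force
    ultimately show "\<exists>s'. runs (Seq (clear r m) (shift r p)) s
        (1 + (1 + nodes (enc_unary n) + 3 * m) + T n) s' \<and> s' r = enc_unary (f n) \<and> (\<forall>i<r. s' i = s
            i)"
      using S'(3) by auto
  qed
  then show ?thesis by blast
qed

lemma computable_natI:
  assumes "realizes p 0 enc_unary (\<lambda>n. enc_unary (f n)) T"
  shows "computable_nat f"
  unfolding computable_nat_def computes_in_def
proof (intro exI[of _ p] allI)
  fix n
  obtain s' where "runs p ((\<lambda>_. Tip)(0 := enc_unary n)) (T n) s'" "s' 0 = enc_unary (f n)"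
    by (rule realizesE[OF assms, of "(\<lambda>_. Tip)(0 := enc_unary n)" n]) auto
  then show "\<exists>t s'. exec p ((\<lambda>_. Tip)(0 := enc_unary n)) t s' \<and> s' 0 = enc_unary (f n)"
    unfolding runs_def by blast
qed

text \<open>The time bound of a composed reduction is a polynomial expression in \<open>n\<close>
  and \<open>f n\<close>. A program forms the pair of the two and passes it to
  \<open>N\<close>.\<close>

lemma computable_nat_ptime_nat:
  assumes "computable_nat f" "ptime_nat N"
  shows "computable_nat (\<lambda>n. N (Br (enc_unary n) (enc_unary (f n))))"
proof -
  \<comment> \<open>The sum \<open>0 + 2\<close> matches register \<open>r + 2\<close> of
    \<open>realizes_bin\<close> at \<open>r = 0\<close>.\<close>
  obtain p T where p: "realizes p (0 + 2) enc_unary (\<lambda>n. enc_unary (f n)) T"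
    using realizes_computable[OF assms(1)] by blast
  obtain U Q where Q: "\<And>r. realizes (Q r) r id (\<lambda>x. enc_unary (N x)) U"
    using ptimeE[OF assms(2)[unfolded ptime_nat_def]] by blast
  obtain V R where R: "\<And>r. realizes (R r) r id (\<lambda>x. x) V"
    using ptimeE[OF ptime_id] by blast
  from realizes_comp[OF realizes_bin[OF realizes_subst[OF R, of "0 + 1" enc_unary] p,
        of "BrE (Var (0 + 1)) (Var (0 + 2))" Br] realizes_subst[OF Q]]
  show ?thesis by (intro computable_natI) simp
qed

section \<open>Extending an fpt-reduction by a polynomial-time map\<close>

lemma nodes_enc_unary: "nodes (enc_unary n) = 1 + 2 * n"
  by (induction n) (auto simp: enc_unary_def)

text \<open>The output of the given reduction is at most as large as its input plus its running
  time, so a polynomial-time map applied to it still takes time \<open>f' k * n ^ C\<close>.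
  Monotonicity of \<open>\<kappa>\<close> turns the parameter bound \<open>g\<close> into
  \<open>\<kappa> (g k)\<close>.\<close>

lemma fpt_reducible_ptime:
  assumes red: "fpt_reducible A W" and \<Phi>: "ptime \<Phi>" and \<kappa>: "ptime_nat (\<lambda>x. \<kappa> (length (dec_list x)))"
      "mono \<kappa>"
    and correct: "\<And>x k. \<exists>x'. \<Phi> (Br x (enc_unary k)) = Br x' (enc_unary (\<kappa> k)) \<and>
      ((x, k) \<in> W \<longleftrightarrow> (x', \<kappa> k) \<in> B)"
  shows "fpt_reducible A B"
proof -
  obtain p f g c where fg: "computable_nat f" "computable_nat g"
    and p: "\<And>x k. \<exists>x' k' t. computes_in p (Br x (enc_unary k)) (Br x' (enc_unary k')) t \<and>
         t \<le> f k * nodes x ^ c \<and> ((x, k) \<in> A \<longleftrightarrow> (x', k') \<in> W) \<and> k' \<le> g k"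
    using red unfolding fpt_reducible_def by blast
  obtain T P where T: "pbounded T" and P: "\<And>r. realizes (P r) r id \<Phi> T"
    using ptimeE[OF \<Phi>] by blast
  obtain e where e: "\<And>x. T x \<le> e * nodes x ^ e"
    using T unfolding pbounded_def by blast
  define N where "N z = 1 + (2 * length (dec_list (dleft z)) + 3 + length (dec_list (dright z)))
      + e * (2 * length (dec_list (dleft z)) + 3 + length (dec_list (dright z))) ^ e" for z
  have N: "ptime_nat N"
    unfolding N_def by (intro ptime_intros ptime_nat_length)
  define f' where "f' k = N (Br (enc_unary k) (enc_unary (f k)))" for k
  define g' where "g' k = \<kappa> (g k)" for k
  \<comment> \<open>The size after the first run is at most \<open>w k * n ^ (c + 1)\<close>: the
    summand 1 is for \<open>x\<close>, \<open>2 * k + 2\<close> for the unary parameter and the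
    pairing node, \<open>f k\<close> for the growth during the run.\<close>
  define w where "w k = 2 * k + 3 + f k" for k
  have f'_eq: "f' k = 1 + w k + e * w k ^ e" for k
    by (simp add: f'_def N_def w_def enc_unary_def)
  have f': "computable_nat f'"
    unfolding f'_def by (rule computable_nat_ptime_nat[OF fg(1) N])
  have "computable_nat (\<lambda>k. (\<lambda>z. \<kappa> (length (dec_list (dright z)))) (Br (enc_unary k) (enc_unary (g
      k))))"
    by (rule computable_nat_ptime_nat[OF fg(2)]) (rule ptime_nat_comp[OF \<kappa>(1) ptime_dright_id])
  then have g': "computable_nat g'"
    by (simp add: g'_def[abs_def] enc_unary_def)
  \<comment> \<open>Dominates both exponents that occur, \<open>c\<close> and
    \<open>(c + 1) * e\<close>.\<close>
  define C where "C = (c + 1) * (e + 1)"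
  show ?thesis unfolding fpt_reducible_def
  proof (rule exI[of _ "Seq p (P 0)"], rule exI[of _ f'], rule exI[of _ g'], rule exI[of _ C],
      intro conjI f' g' allI)
    fix x k
    obtain x1 k1 t1 where 1: "computes_in p (Br x (enc_unary k)) (Br x1 (enc_unary k1)) t1"
      "t1 \<le> f k * nodes x ^ c" "(x, k) \<in> A \<longleftrightarrow> (x1, k1) \<in> W" "k1 \<le> g k"
      using p by blast
    obtain x2 where 2: "\<Phi> (Br x1 (enc_unary k1)) = Br x2 (enc_unary (\<kappa> k1))"
      "(x1, k1) \<in> W \<longleftrightarrow> (x2, \<kappa> k1) \<in> B"
      using correct by blast
    let ?s = "(\<lambda>_. Tip)(0 := Br x (enc_unary k))" and ?y = "Br x1 (enc_unary k1)"
    obtain s1 where s1: "exec p ?s t1 s1" "s1 0 = ?y"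
      using 1(1) unfolding computes_in_def by blast
    obtain s2 where s2: "runs (P 0) s1 (T ?y) s2" "s2 0 = \<Phi> ?y"
      by (rule realizesE[OF P[of 0], of s1 ?y]) (use s1(2) in auto)
    obtain t2 where t2: "t2 \<le> T ?y" "exec (P 0) s1 t2 s2"
      using s2(1) unfolding runs_def by blast
    have exec: "computes_in (Seq p (P 0)) (Br x (enc_unary k)) (Br x2 (enc_unary (\<kappa> k1))) (1 + t1 +
        t2)"
      unfolding computes_in_def using exec_Seq[OF s1(1) t2(2)] s2(2) 2(1) by auto
    define n where "n = nodes x"
    have n: "1 \<le> n" unfolding n_def by (rule nodes_pos)
    have "nodes ?y \<le> nodes (Br x (enc_unary k)) + t1"
      using exec_nodes[OF s1(1), of 0] s1(2) by simp
    also have "\<dots> \<le> n + (2 * k + 2) + f k * n ^ c"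
      using 1(2) by (simp add: n_def nodes_enc_unary)
    also have "\<dots> \<le> n ^ (c + 1) + (2 * k + 2) * n ^ (c + 1) + f k * n ^ (c + 1)"
    proof (intro add_le_mono)
      show "n \<le> n ^ (c + 1)" using self_le_power[OF n, of "c + 1"] by simp
      show "2 * k + 2 \<le> (2 * k + 2) * n ^ (c + 1)"
        using one_le_power[OF n, of "c + 1"] by (metis mult_le_mono2 mult.right_neutral)
      show "f k * n ^ c \<le> f k * n ^ (c + 1)"
        using power_increasing[OF _ n, of c "c + 1"] by simp
    qed
    also have "\<dots> = w k * n ^ (c + 1)"
      by (simp add: w_def algebra_simps)
    finally have y: "nodes ?y \<le> w k * n ^ (c + 1)" .
    have "t2 \<le> e * (w k * n ^ (c + 1)) ^ e"
      using t2(1) e[of ?y] power_mono[OF y, of e] by (meson le0 mult_le_mono2 order_trans)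
    also have "\<dots> = e * w k ^ e * n ^ ((c + 1) * e)"
      by (simp only: power_mult_distrib power_mult mult.assoc)
    also have "\<dots> \<le> e * w k ^ e * n ^ C"
      by (intro mult_le_mono2 power_increasing n) (simp add: C_def)
    finally have t2': "t2 \<le> e * w k ^ e * n ^ C" .
    have "t1 \<le> w k * n ^ C"
      using 1(2) mult_le_mono[OF _ power_increasing[OF _ n, of c C], of "f k" "w k"]
      by (simp add: w_def n_def C_def)
    then have "1 + t1 + t2 \<le> n ^ C + w k * n ^ C + e * w k ^ e * n ^ C"
      using t2' one_le_power[OF n, of C] by linarith
    also have "\<dots> = f' k * n ^ C"
      by (simp add: f'_eq algebra_simps)
    finally have "1 + t1 + t2 \<le> f' k * nodes x ^ C"
      unfolding n_def .
    moreover have "\<kappa> k1 \<le> g' k"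
      unfolding g'_def using \<kappa>(2) 1(4) by (rule monoD)
    ultimately show "\<exists>x' k' t. computes_in (Seq p (P 0)) (Br x (enc_unary k)) (Br x' (enc_unary k'))
        t \<and>
         t \<le> f' k * nodes x ^ C \<and> ((x, k) \<in> A \<longleftrightarrow> (x', k') \<in> B) \<and> k' \<le> g' k"
      using exec 1(3) 2(2) by blast
  qed
qed

section \<open>Weighted satisfiability as a clique problem for hypergraphs\<close>

text \<open>The counterpart of \<open>cnf_sat\<close> for variables of any type, as the reduction
  keeps variables in the form of their tree codes.\<close>

definition lit_sat :: "'v set \<Rightarrow> (bool \<times> 'v) list set \<Rightarrow> bool" where
  "lit_sat S Cs \<longleftrightarrow> (\<forall>C\<in>Cs. \<exists>l\<in>set C. fst l = (snd l \<in> S))"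

text \<open>A set \<open>S\<close> of \<open>k\<close> variables cuts the list \<open>vs\<close> of all variables into gaps.  The gap in layer
  \<open>i\<close> consists of the suffix \<open>A\<close> of \<open>vs\<close> after element number \<open>i - 1\<close> of \<open>S\<close> and the suffix \<open>B\<close>
  starting with element number \<open>i\<close>.  The layers from \<open>k\<close> on only make the number of gaps
  exceed \<open>D\<close>.\<close>

definition gap_ok :: "nat \<Rightarrow> nat \<Rightarrow> 'v list \<Rightarrow> nat \<Rightarrow> 'v list \<Rightarrow> 'v list \<Rightarrow> bool" where
  "gap_ok k D vs i A B \<longleftrightarrow> i \<le> k + D \<and> suffix A vs \<and> suffix B A \<and> (i = 0 \<longrightarrow> A = vs) \<and> (i < k \<longleftrightarrow> B \<noteq> [])"

text \<open>Every literal that is false under \<open>S\<close> is falsified by a single gap of \<open>S\<close>.\<close>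

definition falsifies :: "'v list \<Rightarrow> 'v list \<Rightarrow> bool \<times> 'v \<Rightarrow> bool" where
  "falsifies A B l \<longleftrightarrow>
    (if fst l then snd l \<in> set A \<and> snd l \<notin> set B else B \<noteq> [] \<and> hd B = snd l)"

text \<open>The hyperedge condition. A failure is always visible on few gaps: two of them for the
  first conjunct, one per literal of a clause for the second. Hence checking all
  \<open>D\<close>-subsets amounts to checking the whole set.\<close>

definition allowed ::
    "('g \<Rightarrow> nat) \<Rightarrow> ('g \<Rightarrow> 'v list) \<Rightarrow> ('g \<Rightarrow> 'v list) \<Rightarrow> (bool \<times> 'v) list set \<Rightarrow> 'g set \<Rightarrow> bool" where
  "allowed lay hi lo Cs c \<longleftrightarrow>
    (\<forall>g\<in>c. \<forall>g'\<in>c. g \<noteq> g' \<longrightarrow> lay g \<noteq> lay g' \<and> (lay g' = Suc (lay g) \<longrightarrow> hi g' = tl (lo g))) \<and>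
    (\<forall>C\<in>Cs. \<exists>l\<in>set C. \<forall>g\<in>c. \<not> falsifies (hi g) (lo g) l)"

definition all_allowed ::
    "('g \<Rightarrow> nat) \<Rightarrow> ('g \<Rightarrow> 'v list) \<Rightarrow> ('g \<Rightarrow> 'v list) \<Rightarrow> (bool \<times> 'v) list set \<Rightarrow> nat \<Rightarrow> 'g set \<Rightarrow> bool"
        where
  "all_allowed lay hi lo Cs D G \<longleftrightarrow> (\<forall>c\<subseteq>G. card c = D \<longrightarrow> allowed lay hi lo Cs c)"

text \<open>The gaps of a model, one for each layer, form the clique. Constructor \<open>mk\<close>
  and selectors \<open>lay\<close>, \<open>hi\<close>, \<open>lo\<close> are abstract here, which
  separates the combinatorics from tree codes.\<close>

lemma allowed_gaps_if_sat:
  fixes U :: "'g set" and vs :: "'v list"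
  assumes vs: "distinct vs"
    and U: "\<And>i A B. gap_ok k D vs i A B \<Longrightarrow>
      mk i A B \<in> U \<and> lay (mk i A B) = i \<and> hi (mk i A B) = A \<and> lo (mk i A B) = B"
    and S: "S \<subseteq> set vs" "card S = k" "lit_sat S Cs"
  shows "\<exists>G\<subseteq>U. card G = k + D + 1 \<and> all_allowed lay hi lo Cs D G"
proof -
  \<comment> \<open>\<open>dropWhile\<close> moves to the next member of \<open>S\<close> and
    \<open>tl\<close> steps over it. Once \<open>S\<close> is used up, \<open>B i\<close> is empty
    and so are all later \<open>A\<close>, which fills the padding layers.\<close>
  define A where "A = rec_nat vs (\<lambda>_ X. tl (dropWhile (\<lambda>v. v \<notin> S) X))"
  define B where "B i = dropWhile (\<lambda>v. v \<notin> S) (A i)" for i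
  have A0: "A 0 = vs" and AS: "A (Suc i) = tl (B i)" for i
    by (simp_all add: A_def B_def)
  have sB: "suffix (B i) (A i)" for i
    unfolding B_def by (rule suffix_dropWhile)
  have sA: "suffix (A i) vs" for i
  proof (induction i)
    case (Suc i)
    then show ?case
      unfolding AS using sB[of i] suffix_tl[of "B i"] by (meson suffix_order.order_trans)
  qed (simp add: A0)
  have keep: "v \<in> set (B i)" if "v \<in> set (A i)" "v \<in> S" for v i
  proof -
    have "set (takeWhile (\<lambda>v. v \<notin> S) (A i)) \<inter> S = {}" using set_takeWhileD by fastforce
    then show ?thesis using that
      by (metis B_def Int_iff UnE empty_iff set_append takeWhile_dropWhile_id)
  qed
  have hdB: "hd (B i) \<in> S" if "B i \<noteq> []" for i
    using that hd_dropWhile[of "\<lambda>v. v \<notin> S" "A i"] by (simp add: B_def)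
  have inter: "set (B i) \<inter> S = set (A i) \<inter> S" for i
    using keep set_mono_suffix[OF sB[of i]] by blast
  have card: "card (set (A i) \<inter> S) = k - i" for i
  proof (induction i)
    case 0
    then show ?case using S(1,2) by (simp add: A0 Int_absorb1)
  next
    case (Suc i)
    show ?case
    proof (cases "B i")
      case Nil
      then show ?thesis using Suc inter[of i] by (simp add: AS)
    next
      case (Cons a r)
      then have "distinct (a # r)"
        using vs sA[of i] sB[of i] by (metis distinct_append suffix_def)
      then have "set (B i) \<inter> S = insert a (set r \<inter> S)" "a \<notin> set r \<inter> S"
        using hdB[of i] Cons by auto
      then have "card (set (A i) \<inter> S) = Suc (card (set r \<inter> S))"
        using inter[of i] by simp
      then show ?thesis using Suc Cons by (simp add: AS)
    qed
  qed
  have B_Nil: "B i = [] \<longleftrightarrow> k \<le> i" for i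
  proof -
    have "B i = [] \<longleftrightarrow> set (A i) \<inter> S = {}"
      using inter[of i] hdB[of i] by (metis Int_iff empty_iff hd_in_set inf_bot_left list.set(1))
    also have "\<dots> \<longleftrightarrow> card (set (A i) \<inter> S) = 0" by simp
    finally show ?thesis unfolding card by auto
  qed
  have ok: "gap_ok k D vs i (A i) (B i)" if "i \<le> k + D" for i
    using that sA sB B_Nil[of i] by (auto simp: gap_ok_def A0)
  define g where "g i = mk i (A i) (B i)" for i
  have g: "g i \<in> U" "lay (g i) = i" "hi (g i) = A i" "lo (g i) = B i" if "i \<le> k + D" for i
    using U[OF ok[OF that]] by (simp_all add: g_def)
  have inj: "inj_on g {..k + D}"
    by (rule inj_on_inverseI[of _ lay]) (simp add: g)
  have "allowed lay hi lo Cs c" if c: "c \<subseteq> g ` {..k + D}" for c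
    unfolding allowed_def
  proof (intro conjI ballI impI)
    fix x y assume xy: "x \<in> c" "y \<in> c" "x \<noteq> y"
    then obtain i j where ij: "x = g i" "y = g j" "i \<le> k + D" "j \<le> k + D" using c by blast
    show "lay x \<noteq> lay y" using xy(3) ij g by auto
    show "hi y = tl (lo x)" if "lay y = Suc (lay x)"
      using that ij g AS by simp
  next
    fix C assume "C \<in> Cs"
    then obtain l where l: "l \<in> set C" "fst l = (snd l \<in> S)"
      using S(3) unfolding lit_sat_def by blast
    \<comment> \<open>For a positive literal, a gap never skips a member of \<open>S\<close>
      (\<open>keep\<close>); for a negative one, a gap ends only at a member of \<open>S\<close>
      (\<open>hdB\<close>).\<close>
    have "\<not> falsifies (hi x) (lo x) l" if x: "x \<in> c" for x
    proof -
      obtain i where i: "x = g i" "i \<le> k + D" using c x by blast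
      show ?thesis using l(2) keep[of "snd l" i] hdB[of i] by (auto simp: falsifies_def i g)
    qed
    then show "\<exists>l\<in>set C. \<forall>x\<in>c. \<not> falsifies (hi x) (lo x) l" using l(1) by blast
  qed
  then show ?thesis
    using g(1) card_image[OF inj] by (intro exI[of _ "g ` {..k + D}"]) (auto simp: all_allowed_def)
qed

text \<open>Pairs in a common hyperedge force one gap per layer and make neighbouring gaps fit end
  to end. The variables at which the first \<open>k\<close> gaps end form the model.\<close>

lemma sat_if_allowed_gaps:
  fixes U :: "'g set" and vs :: "'v list"
  assumes vs: "distinct vs" and Cs: "\<And>C. C \<in> Cs \<Longrightarrow> snd ` set C \<subseteq> set vs \<and> length C \<le> D"
    and D: "2 \<le> D"
    and U: "\<And>g. g \<in> U \<Longrightarrow> gap_ok k D vs (lay g) (hi g) (lo g)"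
    and G: "G \<subseteq> U" "card G = k + D + 1" "all_allowed lay hi lo Cs D G"
  shows "\<exists>S. S \<subseteq> set vs \<and> card S = k \<and> lit_sat S Cs"
proof -
  have fin: "finite G" using G(2) by (simp add: card_ge_0_finite)
  \<comment> \<open>Transfers the condition on exactly \<open>D\<close> gaps to any smaller set; the
    padding layers guarantee \<open>D \<le> card G\<close>.\<close>
  have extend: "\<exists>c. X \<subseteq> c \<and> allowed lay hi lo Cs c" if "X \<subseteq> G" "card X \<le> D" for X
  proof -
    have "D \<le> card G" using G(2) by simp
    from exists_subset_between[OF that(2) this that(1) fin]
    obtain c where c: "X \<subseteq> c" "c \<subseteq> G" "card c = D" by metis
    have "allowed lay hi lo Cs c" using G(3) c(2,3) unfolding all_allowed_def by metis
    with c(1) show ?thesis by metis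
  qed
  have pair: "lay g \<noteq> lay g' \<and> (lay g' = Suc (lay g) \<longrightarrow> hi g' = tl (lo g))"
    if "g \<in> G" "g' \<in> G" "g \<noteq> g'" for g g'
  proof -
    have "card {g, g'} \<le> D" using D card_insert_le_m1[of 2 "{g'}" g] by simp
    moreover have "{g, g'} \<subseteq> G" using that by blast
    ultimately obtain c where "{g, g'} \<subseteq> c" "allowed lay hi lo Cs c"
      using extend[of "{g, g'}"] by metis
    then show ?thesis using that(3) unfolding allowed_def by simp
  qed
  have inj: "inj_on lay G" by (rule inj_onI) (use pair in blast)
  \<comment> \<open>Pigeonhole: \<open>k + D + 1\<close> gaps with distinct layers among
    \<open>0, ..., k + D\<close> occupy every layer.\<close>
  have "lay ` G \<subseteq> {..k + D}" using U G(1) unfolding gap_ok_def by blast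
  moreover have "card (lay ` G) = card {..k + D}" using card_image[OF inj] G(2) by simp
  ultimately have lay: "lay ` G = {..k + D}" by (intro card_subset_eq) auto
  define \<gamma> where "\<gamma> = inv_into G lay"
  have \<gamma>: "\<gamma> i \<in> G" "lay (\<gamma> i) = i" if "i \<le> k + D" for i
    using that lay inv_into_into[of i lay G] f_inv_into_f[of i lay G] by (simp_all add: \<gamma>_def)
  define A where "A i = hi (\<gamma> i)" for i
  define B where "B i = lo (\<gamma> i)" for i
  have ok: "gap_ok k D vs i (A i) (B i)" if "i \<le> k + D" for i
    using U[of "\<gamma> i"] \<gamma>[OF that] G(1) by (auto simp: A_def B_def)
  have AS: "A (Suc i) = tl (B i)" if "Suc i \<le> k + D" for i
  proof -
    have "\<gamma> i \<in> G" "\<gamma> (Suc i) \<in> G" "lay (\<gamma> i) = i" "lay (\<gamma> (Suc i)) = Suc i"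
      using \<gamma>[of i] \<gamma>[of "Suc i"] that by simp_all
    then show ?thesis using pair[of "\<gamma> i" "\<gamma> (Suc i)"] by (metis A_def B_def n_not_Suc_n)
  qed
  have A0: "A 0 = vs" using ok[of 0] by (simp add: gap_ok_def)
  have B_Nil: "B i = [] \<longleftrightarrow> k \<le> i" if "i \<le> k + D" for i
    using ok[OF that] by (auto simp: gap_ok_def)
  have sB: "suffix (B i) (A i)" "suffix (A i) vs" if "i \<le> k + D" for i
    using ok[OF that] by (auto simp: gap_ok_def)
  have later: "suffix (A j) (tl (B i))" if "i < j" "j \<le> k + D" for i j
    using that
  proof (induction j)
    case (Suc j)
    show ?case
    proof (cases "i = j")
      case True
      then show ?thesis using AS Suc.prems by simp
    next
      case False
      then have "suffix (A j) (tl (B i))" using Suc by simp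
      moreover have "suffix (A (Suc j)) (A j)"
        using AS[of j] sB(1)[of j] Suc.prems suffix_tl[of "B j"]
        by (metis Suc_leD suffix_order.order_trans)
      ultimately show ?thesis by (meson suffix_order.order_trans)
    qed
  qed simp
  define S where "S = (\<lambda>i. hd (B i)) ` {..<k}"
  have distinct: "distinct (B i)" if "i \<le> k + D" for i
    using vs sB[OF that] by (auto simp: suffix_def)
  have hd_ne: "hd (B i) \<noteq> hd (B j)" if "i < j" "j < k" for i j
  proof -
    have "B i \<noteq> []" "B j \<noteq> []" using B_Nil[of i] B_Nil[of j] that by auto
    moreover have "hd (B j) \<in> set (tl (B i))"
    proof -
      have "hd (B j) \<in> set (B j)" using \<open>B j \<noteq> []\<close> by simp
      also have "set (B j) \<subseteq> set (A j)" using sB(1)[of j] that by (simp add: set_mono_suffix)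
      also have "set (A j) \<subseteq> set (tl (B i))" using later[of i j] that by (simp add: set_mono_suffix)
      finally show ?thesis .
    qed
    moreover have "distinct (B i)" using distinct[of i] that by simp
    ultimately show ?thesis
      by (cases "B i") auto
  qed
  have "inj_on (\<lambda>i. hd (B i)) {..<k}"
    by (rule inj_onI) (metis hd_ne lessThan_iff linorder_neqE_nat)
  then have card: "card S = k" by (simp add: S_def card_image)
  have sub: "S \<subseteq> set vs"
  proof
    fix v assume "v \<in> S"
    then obtain i where i: "i < k" "v = hd (B i)" by (auto simp: S_def)
    then have "v \<in> set (B i)" using B_Nil[of i] by simp
    also have "set (B i) \<subseteq> set (A i)" using sB(1)[of i] i by (simp add: set_mono_suffix)
    also have "set (A i) \<subseteq> set vs" using sB(2)[of i] i by (simp add: set_mono_suffix)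
    finally show "v \<in> set vs" .
  qed
  \<comment> \<open>A false variable that no gap skips would pass from \<open>A i\<close> to
    \<open>B i\<close> and, not being its head, on to \<open>A (Suc i)\<close>, until it reaches
    \<open>B k = []\<close>. The gap in layer \<open>k\<close> covers what lies behind the last true
    variable.\<close>
  have cover: "\<exists>i\<le>k + D. v \<in> set (A i) \<and> v \<notin> set (B i)" if v: "v \<in> set vs" "v \<notin> S" for v
  proof (rule ccontr)
    assume "\<not> ?thesis"
    then have *: "v \<in> set (B i)" if "i \<le> k + D" "v \<in> set (A i)" for i using that by blast
    have "v \<in> set (A i)" if "i \<le> k" for i
      using that
    proof (induction i)
      case (Suc i)
      then have "v \<in> set (B i)" "i < k" using *[of i] by simp_all
      moreover have "v \<noteq> hd (B i)" using v(2) \<open>i < k\<close> by (auto simp: S_def)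
      ultimately have "v \<in> set (tl (B i))" by (cases "B i") auto
      then show ?case using AS[of i] \<open>i < k\<close> by simp
    qed (use v A0 in simp)
    then have "v \<in> set (B k)" using *[of k] by simp
    then show False using B_Nil[of k] by simp
  qed
  have "lit_sat S Cs"
  proof (rule ccontr)
    assume "\<not> lit_sat S Cs"
    then obtain C where C: "C \<in> Cs" "\<And>l. l \<in> set C \<Longrightarrow> fst l \<noteq> (snd l \<in> S)"
      unfolding lit_sat_def by blast
    \<comment> \<open>A false positive literal is falsified by the gap that skips its variable, a
      false negative one by the gap that ends at its variable.\<close>
    have "\<exists>g\<in>G. falsifies (hi g) (lo g) l" if l: "l \<in> set C" for l
    proof (cases "fst l")
      case True
      then have "snd l \<notin> S" using C(2)[of l] l by simp
      moreover have "snd l \<in> set vs" using Cs[OF C(1)] l by blast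
      ultimately obtain i where "i \<le> k + D" "snd l \<in> set (A i)" "snd l \<notin> set (B i)"
        using cover by blast
      then show ?thesis
        using \<gamma>[of i] True by (intro bexI[of _ "\<gamma> i"]) (auto simp: falsifies_def A_def B_def)
    next
      case False
      then have "snd l \<in> S" using C(2)[of l] l by simp
      then obtain i where "i < k" "snd l = hd (B i)" by (auto simp: S_def)
      then show ?thesis
        using \<gamma>[of i] B_Nil[of i] False
        by (intro bexI[of _ "\<gamma> i"]) (auto simp: falsifies_def A_def B_def)
    qed
    then obtain f where f: "\<And>l. l \<in> set C \<Longrightarrow> f l \<in> G \<and> falsifies (hi (f l)) (lo (f l)) l"
      by metis
    \<comment> \<open>One falsifying gap per literal gives at most \<open>D\<close> gaps. Some
      allowed hyperedge contains them all, yet it has to spare a literal of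
      \<open>C\<close>.\<close>
    have "card (f ` set C) \<le> D"
      using card_image_le[of "set C" f] card_length[of C] Cs[OF C(1)] by simp
    moreover have "f ` set C \<subseteq> G" using f by blast
    ultimately obtain c where c: "f ` set C \<subseteq> c" "allowed lay hi lo Cs c"
      using extend[of "f ` set C"] by metis
    from conjunct2[OF c(2)[unfolded allowed_def]] C(1)
    have "\<exists>l\<in>set C. \<forall>g\<in>c. \<not> falsifies (hi g) (lo g) l" by (rule bspec)
    then show False using c(1) f by (meson image_subset_iff)
  qed
  with card sub show ?thesis by blast
qed

section \<open>Cliques of hypergraphs as dense bipartite subgraphs\<close>

lemma set_combs_subset: "c \<in> set (combs j xs) \<Longrightarrow> set c \<subseteq> set xs"
proof (induction j xs arbitrary: c rule: combs.induct)
  case (3 j x xs)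
  then consider "c \<in> set (combs (Suc j) xs)" | c' where "c = x # c'" "c' \<in> set (combs j xs)"
    by auto
  then show ?case
  proof cases
    case 1
    then show ?thesis using "3.IH"(1)[of c] by auto
  next
    case 2
    then show ?thesis using "3.IH"(2)[of c'] by auto
  qed
qed auto

lemma length_mem_combs: "c \<in> set (combs j xs) \<Longrightarrow> length c = j"
  by (induction j xs arbitrary: c rule: combs.induct) auto

lemma distinct_mem_combs: "c \<in> set (combs j xs) \<Longrightarrow> distinct xs \<Longrightarrow> distinct c"
proof (induction j xs arbitrary: c rule: combs.induct)
  case (3 j x xs)
  then consider "c \<in> set (combs (Suc j) xs)" | c' where "c = x # c'" "c' \<in> set (combs j xs)"
    by auto
  then show ?case
  proof cases
    case 1
    then show ?thesis using "3.IH"(1)[of c] "3.prems"(2) by simp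
  next
    case 2
    then show ?thesis using "3.IH"(2)[of c'] "3.prems"(2) set_combs_subset[OF 2(2)] by auto
  qed
qed auto

lemma combs_surj:
  "c \<subseteq> set xs \<Longrightarrow> distinct xs \<Longrightarrow> card c = j \<Longrightarrow> \<exists>l\<in>set (combs j xs). set l = c"
proof (induction j xs arbitrary: c rule: combs.induct)
  case (1 xs)
  then show ?case using finite_subset[OF 1(1)] by simp
next
  case (3 j x xs)
  show ?case
  proof (cases "x \<in> c")
    case True
    have "card (c - {x}) = j" using 3(5) True finite_subset[OF 3(3)] by simp
    moreover have "c - {x} \<subseteq> set xs" using 3(3) by auto
    ultimately obtain l where "l \<in> set (combs j xs)" "set l = c - {x}"
      using 3(2)[of "c - {x}"] 3(4) by auto
    then show ?thesis using True by (intro bexI[of _ "x # l"]) auto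
  next
    case False
    then have "c \<subseteq> set xs" using 3(3) by auto
    then show ?thesis using 3(1)[of c] 3(4,5) by auto
  qed
qed auto

text \<open>A subset is listed by only one sublist, so a hyperedge, although a set, has a
  well-defined list and thus a well-defined code.\<close>

lemma inj_on_set_combs: "distinct xs \<Longrightarrow> inj_on set (set (combs j xs))"
proof (induction j xs rule: combs.induct)
  case (3 j x xs)
  have x: "x \<notin> set c" if "c \<in> set (combs i xs)" for c i
    using set_combs_subset[OF that] 3(3) by auto
  have inj: "inj_on set (set (combs (Suc j) xs))" "inj_on set (set (combs j xs))"
    using 3 by simp_all
  show ?case
  proof (rule inj_onI)
    fix a b
    assume a: "a \<in> set (combs (Suc j) (x # xs))" and b: "b \<in> set (combs (Suc j) (x # xs))"
      and ab: "set a = set b"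
    have a': "a \<in> set (combs (Suc j) xs) \<or> a \<in> (#) x ` set (combs j xs)"
      and b': "b \<in> set (combs (Suc j) xs) \<or> b \<in> (#) x ` set (combs j xs)"
      using a b by simp_all
    show "a = b"
    proof (cases "x \<in> set a")
      case True
      then obtain a' where a': "a = x # a'" "a' \<in> set (combs j xs)"
        using a' x[of a "Suc j"] by blast
      obtain b' where b': "b = x # b'" "b' \<in> set (combs j xs)"
        using True b' x[of b "Suc j"] unfolding ab by blast
      have "set a' = set b'"
        using ab x[OF a'(2)] x[OF b'(2)] unfolding a'(1) b'(1) by (simp add: insert_ident)
      from inj_onD[OF inj(2) this a'(2) b'(2)] show ?thesis unfolding a'(1) b'(1) by simp
    next
      case False
      then have "x \<notin> set b" unfolding ab .
      with False have "a \<in> set (combs (Suc j) xs)" "b \<in> set (combs (Suc j) xs)"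
        using a' b' by force+
      from inj_onD[OF inj(1) ab this] show ?thesis .
    qed
  qed
qed auto

text \<open>By Pascal's rule the step from \<open>K - 1\<close> to \<open>K\<close> adds
  \<open>(K - 1) choose (D - 1)\<close>, which is positive. Strictness is what later forces
  \<open>K\<close> chosen vertices.\<close>

lemma binomial_less_mono:
  assumes "1 \<le> D" "D \<le> K" "a < K"
  shows "a choose D < K choose D"
proof -
  have "a choose D \<le> (K - 1) choose D" using assms(3) by (intro binomial_right_mono) simp
  moreover have "K choose D = ((K - 1) choose D) + ((K - 1) choose (D - 1))"
    using assms by (cases K; cases D) auto
  moreover have "0 < ((K - 1) choose (D - 1))" using assms by (intro zero_less_binomial) simp
  ultimately show ?thesis by linarith
qed

text \<open>Choosing a vertex of \<open>U\<close> gains \<open>D - 1\<close>, and choosing a hyperedge gains the number of its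
  vertices that are chosen.  So every choice gains at most \<open>D - 1\<close>, except that a hyperedge all of
  whose vertices are chosen gains \<open>D\<close>.  Hence \<open>\<tau>\<close> can only be reached with exactly \<open>K\<close> vertices and
  all their \<open>D\<close>-subsets.\<close>

lemma hyperclique_iff_dense:
  fixes V :: "'g set set"
  assumes U: "finite U" and V: "\<And>c. c \<in> V \<Longrightarrow> c \<subseteq> U \<and> card c = D" and D: "2 \<le> D" "D \<le> K"
    and \<theta>: "\<theta> = K + (K choose D)" and \<tau>: "\<tau> = (D - 1) * K + D * (K choose D)"
  shows "(\<exists>G\<subseteq>U. card G = K \<and> (\<forall>c\<subseteq>G. card c = D \<longrightarrow> c \<in> V)) \<longleftrightarrow>
    (\<exists>X\<subseteq>U. \<exists>F\<subseteq>V. card X + card F \<le> \<theta> \<and> \<tau> \<le> (D - 1) * card X + (\<Sum>c\<in>F. card (c \<inter> X)))"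
proof
  assume "\<exists>G\<subseteq>U. card G = K \<and> (\<forall>c\<subseteq>G. card c = D \<longrightarrow> c \<in> V)"
  then obtain G where G: "G \<subseteq> U" "card G = K" "\<And>c. c \<subseteq> G \<Longrightarrow> card c = D \<Longrightarrow> c \<in> V" by blast
  define F where "F = {c. c \<subseteq> G \<and> card c = D}"
  have "card F = K choose D"
    unfolding F_def using n_subsets[of G D] finite_subset[OF G(1) U] G(2) by simp
  moreover have "(\<Sum>c\<in>F. card (c \<inter> G)) = (\<Sum>c\<in>F. D)"
    by (intro sum.cong) (auto simp: F_def Int_absorb2)
  ultimately show "\<exists>X\<subseteq>U. \<exists>F\<subseteq>V. card X + card F \<le> \<theta> \<and>
      \<tau> \<le> (D - 1) * card X + (\<Sum>c\<in>F. card (c \<inter> X))"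
    using G by (intro exI[of _ G] conjI exI[of _ F]) (auto simp: F_def \<theta> \<tau>)
next
  assume "\<exists>X\<subseteq>U. \<exists>F\<subseteq>V. card X + card F \<le> \<theta> \<and>
    \<tau> \<le> (D - 1) * card X + (\<Sum>c\<in>F. card (c \<inter> X))"
  then obtain X F where X: "X \<subseteq> U" and F: "F \<subseteq> V" and card: "card X + card F \<le> \<theta>"
    and ge: "\<tau> \<le> (D - 1) * card X + (\<Sum>c\<in>F. card (c \<inter> X))" by blast
  have finX: "finite X" using X U finite_subset by blast
  have "V \<subseteq> Pow U" using V by blast
  then have finF: "finite F" using F U finite_subset[of F "Pow U"] by auto
  define F' where "F' = {c \<in> F. c \<subseteq> X}"
  have F': "F' \<subseteq> F" "finite F'" using finF by (auto simp: F'_def)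
  have "F' \<subseteq> {c. c \<subseteq> X \<and> card c = D}" using F V by (auto simp: F'_def)
  moreover have finP: "finite {c. c \<subseteq> X \<and> card c = D}" using finX by simp
  ultimately have "card F' \<le> card {c. c \<subseteq> X \<and> card c = D}" by (rule card_mono[rotated])
  then have F'_le: "card F' \<le> card X choose D" using n_subsets[OF finX] by simp
  have fin: "finite c" if "c \<in> V" for c using V[OF that] U finite_subset by blast
  have "card (c \<inter> X) \<le> (D - 1) + (if c \<in> F' then 1 else 0)" if c: "c \<in> F" for c
  proof (cases "c \<subseteq> X")
    case True
    then show ?thesis using c F V[of c] D by (auto simp: F'_def Int_absorb2)
  next
    case False
    then have "card (c \<inter> X) < card c" using c F fin[of c] by (intro psubset_card_mono) auto
    then show ?thesis using c F V[of c] by (auto simp: F'_def)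
  qed
  then have "(\<Sum>c\<in>F. card (c \<inter> X)) \<le> (\<Sum>c\<in>F. (D - 1) + (if c \<in> F' then 1 else 0))"
    by (rule sum_mono)
  also have "\<dots> = (D - 1) * card F + card F'"
    using F' finF by (simp add: sum.distrib sum.If_cases Int_absorb1 algebra_simps
        Collect_conj_eq[symmetric])
  finally have 1: "\<tau> \<le> (D - 1) * (card X + card F) + card F'"
    using ge by (simp add: algebra_simps)
  have "card F' \<le> card F" using F' finF by (simp add: card_mono)
  let ?M = "K choose D"
  have "(D - 1) * (card X + card F) \<le> (D - 1) * \<theta>" using card by (rule mult_le_mono2)
  \<comment> \<open>The target exceeds what the budget yields at rate \<open>D - 1\<close> by
    exactly \<open>?M\<close>, so at least that many chosen hyperedges must lie inside
    \<open>X\<close>.\<close>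
  moreover have "\<tau> = (D - 1) * \<theta> + ?M"
    using D unfolding \<theta> \<tau> by (cases D) (auto simp: algebra_simps)
  ultimately have M: "?M \<le> card F'" using 1 by linarith
  then have "K \<le> card X"
    using F'_le binomial_less_mono[of D K "card X"] D by linarith
  moreover have "card X \<le> K"
    using card M \<open>card F' \<le> card F\<close> unfolding \<theta> by linarith
  ultimately have cX: "card X = K" by simp
  \<comment> \<open>Now \<open>X\<close> has only \<open>?M\<close> subsets of size
    \<open>D\<close>, so \<open>F'\<close> contains all of them and \<open>X\<close> is a
    clique.\<close>
  have "F' = {c. c \<subseteq> X \<and> card c = D}"
    using \<open>F' \<subseteq> {c. c \<subseteq> X \<and> card c = D}\<close> finP M n_subsets[OF finX, of D] cX
    by (intro card_seteq) auto
  then show "\<exists>G\<subseteq>U. card G = K \<and> (\<forall>c\<subseteq>G. card c = D \<longrightarrow> c \<in> V)"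
    using X cX F F' by (intro exI[of _ X]) blast
qed

text \<open>\<open>uid\<close> and \<open>vid\<close> name vertices and hyperedges by domain
  elements; \<open>Z\<close> holds the names of the free dummies, each adjacent to every
  vertex.\<close>

definition incidence :: "('g \<Rightarrow> 'n) \<Rightarrow> ('g set \<Rightarrow> 'n) \<Rightarrow> 'g set \<Rightarrow> 'g set set \<Rightarrow> 'n set \<Rightarrow> ('n \<times> 'n) set"
    where
  "incidence uid vid U V Z = (\<Union>c\<in>V. (\<lambda>g. (uid g, vid c)) ` c) \<union> uid ` U \<times> Z"

text \<open>Injective and disjoint names keep the edges at different hyperedges and at dummies
  apart, so their numbers add up.\<close>

lemma card_incidence:
  assumes U: "finite U" and V: "\<And>c. c \<in> V \<Longrightarrow> c \<subseteq> U" and uid: "inj_on uid U"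
    and vid: "inj_on vid V" "vid ` V \<inter> Z = {}" and Z: "finite Z"
    and X: "X \<subseteq> U" and F: "F \<subseteq> V"
  shows "card {(u, v) \<in> incidence uid vid U V Z. u \<in> uid ` X \<and> (v \<in> vid ` F \<or> v \<in> Z)} =
    card Z * card X + (\<Sum>c\<in>F. card (c \<inter> X))"
proof -
  have "{(u, v) \<in> incidence uid vid U V Z. u \<in> uid ` X \<and> (v \<in> vid ` F \<or> v \<in> Z)} =
    (\<Union>c\<in>F. (\<lambda>g. (uid g, vid c)) ` (c \<inter> X)) \<union> uid ` X \<times> Z" (is "?L = ?R")
  proof
    show "?L \<subseteq> ?R"
    proof
      fix e assume "e \<in> ?L"
      then obtain u v where e: "e = (u, v)" "(u, v) \<in> incidence uid vid U V Z" "u \<in> uid ` X"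
        "v \<in> vid ` F \<or> v \<in> Z" by auto
      from e(2) consider c g where "c \<in> V" "g \<in> c" "u = uid g" "v = vid c" | "v \<in> Z"
        unfolding incidence_def by blast
      then show "e \<in> ?R"
      proof cases
        case 1
        then have "v \<notin> Z" using vid(2) by blast
        then obtain c' where "c' \<in> F" "v = vid c'" using e(4) by blast
        then have "c \<in> F" using inj_onD[OF vid(1), of c c'] 1 F by auto
        moreover have "g \<in> X"
        proof -
          obtain x where "x \<in> X" "u = uid x" using e(3) by blast
          then show ?thesis using inj_onD[OF uid, of g x] 1 V[of c] X by auto
        qed
        ultimately show ?thesis using 1 e(1) by blast
      next
        case 2
        then show ?thesis using e by blast
      qed
    qed
    show "?R \<subseteq> ?L" using X F by (auto simp: incidence_def)
  qed
  moreover have "card ?R = card (\<Union>c\<in>F. (\<lambda>g. (uid g, vid c)) ` (c \<inter> X)) + card (uid ` X \<times> Z)"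
  proof (rule card_Un_disjoint)
    have "F \<subseteq> Pow U" using F V by blast
    then have "finite F" using U finite_subset by blast
    then show "finite (\<Union>c\<in>F. (\<lambda>g. (uid g, vid c)) ` (c \<inter> X))"
      using X U finite_subset[of X U] by auto
    show "finite (uid ` X \<times> Z)" using X U Z finite_subset[of X U] by auto
    show "(\<Union>c\<in>F. (\<lambda>g. (uid g, vid c)) ` (c \<inter> X)) \<inter> (uid ` X \<times> Z) = {}"
      using vid(2) F by auto
  qed
  moreover have "card (\<Union>c\<in>F. (\<lambda>g. (uid g, vid c)) ` (c \<inter> X)) =
      (\<Sum>c\<in>F. card ((\<lambda>g. (uid g, vid c)) ` (c \<inter> X)))"
  proof (rule card_UN_disjoint)
    have "F \<subseteq> Pow U" using F V by blast
    then show "finite F" using U finite_subset by blast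
    show "\<forall>c\<in>F. finite ((\<lambda>g. (uid g, vid c)) ` (c \<inter> X))"
      using X U finite_subset[of X U] by auto
    show "\<forall>c\<in>F. \<forall>c'\<in>F. c \<noteq> c' \<longrightarrow>
        (\<lambda>g. (uid g, vid c)) ` (c \<inter> X) \<inter> (\<lambda>g. (uid g, vid c')) ` (c' \<inter> X) = {}"
    proof (intro ballI impI)
      fix c c' assume "c \<in> F" "c' \<in> F" "c \<noteq> c'"
      then have "vid c \<noteq> vid c'" using inj_onD[OF vid(1), of c c'] F by blast
      then show "(\<lambda>g. (uid g, vid c)) ` (c \<inter> X) \<inter> (\<lambda>g. (uid g, vid c')) ` (c' \<inter> X) = {}"
        by auto
    qed
  qed
  moreover have "card ((\<lambda>g. (uid g, vid c)) ` (c \<inter> X)) = card (c \<inter> X)" for c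
    by (rule card_image) (use uid X in \<open>auto simp: inj_on_def\<close>)
  moreover have "card (uid ` X \<times> Z) = card Z * card X"
    using inj_on_subset[OF uid X] by (simp add: card_cartesian_product card_image)
  ultimately show ?thesis by simp
qed

text \<open>The names are read off the edges alone: a nonempty \<open>Z\<close> gives every vertex
  an edge, and nonempty hyperedges occur as right ends.\<close>

lemma dense_incidence_iff:
  assumes U: "finite U" and V: "\<And>c. c \<in> V \<Longrightarrow> c \<subseteq> U \<and> c \<noteq> {}" and uid: "inj_on uid U"
    and vid: "inj_on vid V" "vid ` V \<inter> Z = {}" and Z: "finite Z" "Z \<noteq> {}"
  defines "E \<equiv> incidence uid vid U V Z"
  shows "(\<exists>A\<subseteq>fst ` E. \<exists>B\<subseteq>snd ` E - Z. card A + card B \<le> \<theta> \<and>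
      \<tau> \<le> card {(u, v) \<in> E. u \<in> A \<and> (v \<in> B \<or> v \<in> Z)}) \<longleftrightarrow>
    (\<exists>X\<subseteq>U. \<exists>F\<subseteq>V. card X + card F \<le> \<theta> \<and> \<tau> \<le> card Z * card X + (\<Sum>c\<in>F. card (c \<inter> X)))"
proof -
  have fst: "fst ` E = uid ` U"
  proof
    show "fst ` E \<subseteq> uid ` U" using V unfolding E_def incidence_def by fastforce
    show "uid ` U \<subseteq> fst ` E"
      using Z(2) unfolding E_def incidence_def by (auto simp: image_Un)
  qed
  have snd: "snd ` E - Z = vid ` V"
  proof
    show "snd ` E - Z \<subseteq> vid ` V" unfolding E_def incidence_def by fastforce
    show "vid ` V \<subseteq> snd ` E - Z"
    proof
      fix v assume v: "v \<in> vid ` V"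
      then obtain c where c: "c \<in> V" "v = vid c" by blast
      then obtain g where "g \<in> c" using V[of c] by blast
      then have "(uid g, v) \<in> E" using c unfolding E_def incidence_def by blast
      then have "v \<in> snd ` E" by force
      then show "v \<in> snd ` E - Z" using v vid(2) by blast
    qed
  qed
  have card: "card {(u, v) \<in> E. u \<in> uid ` X \<and> (v \<in> vid ` F \<or> v \<in> Z)} =
      card Z * card X + (\<Sum>c\<in>F. card (c \<inter> X))" if "X \<subseteq> U" "F \<subseteq> V" for X F
    unfolding E_def by (rule card_incidence[OF U _ uid vid Z(1) that]) (use V in blast)
  have cards: "card (uid ` X) = card X" "card (vid ` F) = card F" if "X \<subseteq> U" "F \<subseteq> V" for X F
    using that uid vid(1) by (auto intro!: card_image elim: inj_on_subset)
  show ?thesis unfolding fst snd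
  proof
    assume "\<exists>A\<subseteq>uid ` U. \<exists>B\<subseteq>vid ` V. card A + card B \<le> \<theta> \<and>
      \<tau> \<le> card {(u, v) \<in> E. u \<in> A \<and> (v \<in> B \<or> v \<in> Z)}"
    then obtain A B where AB: "A \<subseteq> uid ` U" "B \<subseteq> vid ` V" "card A + card B \<le> \<theta>"
      "\<tau> \<le> card {(u, v) \<in> E. u \<in> A \<and> (v \<in> B \<or> v \<in> Z)}" by blast
    obtain X F where XF: "X \<subseteq> U" "A = uid ` X" "F \<subseteq> V" "B = vid ` F"
      using AB(1,2) by (meson subset_image_iff)
    show "\<exists>X\<subseteq>U. \<exists>F\<subseteq>V. card X + card F \<le> \<theta> \<and> \<tau> \<le> card Z * card X + (\<Sum>c\<in>F. card (c \<inter> X))"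
      using AB(3,4) XF card[OF XF(1,3)] cards[OF XF(1,3)] by (intro exI[of _ X] conjI exI[of _ F])
          simp_all
  next
    assume "\<exists>X\<subseteq>U. \<exists>F\<subseteq>V. card X + card F \<le> \<theta> \<and> \<tau> \<le> card Z * card X + (\<Sum>c\<in>F. card (c \<inter> X))"
    then obtain X F where XF: "X \<subseteq> U" "F \<subseteq> V" "card X + card F \<le> \<theta>"
      "\<tau> \<le> card Z * card X + (\<Sum>c\<in>F. card (c \<inter> X))" by blast
    show "\<exists>A\<subseteq>uid ` U. \<exists>B\<subseteq>vid ` V. card A + card B \<le> \<theta> \<and>
      \<tau> \<le> card {(u, v) \<in> E. u \<in> A \<and> (v \<in> B \<or> v \<in> Z)}"
      using XF(3,4) card[OF XF(1,2)] cards[OF XF(1,2)] XF(1,2)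
      by (intro exI[of _ "uid ` X"] conjI exI[of _ "vid ` F"]) auto
  qed
qed

section \<open>Bag-set maximization for non-hierarchical queries\<close>

locale non_hierarchical_query =
  fixes Q :: query and X Y :: nat and aX aXY aY :: query_atom
  assumes sjf: "sjf_bcq Q"
    and aX: "aX \<in> Q" "X \<in> snd aX" "Y \<notin> snd aX"
    and aXY: "aXY \<in> Q" "X \<in> snd aXY" "Y \<in> snd aXY"
    and aY: "aY \<in> Q" "X \<notin> snd aY" "Y \<in> snd aY"
begin

text \<open>All variables other than \<open>X\<close> and \<open>Y\<close> get the constant value 0,
  so an assignment amounts to the pair \<open>(u, v)\<close>.\<close>

definition assignment :: "nat \<Rightarrow> nat \<Rightarrow> (nat \<rightharpoonup> nat)" where
  "assignment u v = (\<lambda>z. if z \<in> query_vars Q then Some (if z = X then u else if z = Y then v else 0)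
      else None)"

definition fact_of :: "query_atom \<Rightarrow> nat \<Rightarrow> nat \<Rightarrow> fact" where
  "fact_of a u v = (fst a, assignment u v |` snd a)"

lemma query_vars_eq: "query_vars Q = (\<Union>a\<in>Q. snd a)"
  by (simp add: query_vars_def case_prod_beta')

lemma atom_vars: "a \<in> Q \<Longrightarrow> snd a \<subseteq> query_vars Q"
  unfolding query_vars_eq by (rule UN_upper)

lemma vars: "X \<in> query_vars Q" "Y \<in> query_vars Q" "X \<noteq> Y"
proof -
  show "X \<in> query_vars Q" "Y \<in> query_vars Q"
    by (rule subsetD[OF atom_vars[OF aXY(1)]], rule aXY)+
  show "X \<noteq> Y" using aX(2,3) by metis
qed

lemma dom_fact_of: "a \<in> Q \<Longrightarrow> dom (snd (fact_of a u v)) = snd a"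
  using atom_vars[of a] by (auto simp: fact_of_def assignment_def restrict_map_def dom_def)

lemma fact_of_mem: "a \<in> Q \<Longrightarrow> fact_of a u v \<in> facts_over Q"
  using dom_fact_of[of a u v] unfolding facts_over_def fact_of_def by simp

lemma atom_eqI: "fst a = fst b \<Longrightarrow> a \<in> Q \<Longrightarrow> b \<in> Q \<Longrightarrow> a = b"
  using sjf unfolding sjf_bcq_def by (elim conjE) (rule inj_onD)

lemma fact_of_eq_atom: "fact_of a u v = fact_of b u' v' \<Longrightarrow> a \<in> Q \<Longrightarrow> b \<in> Q \<Longrightarrow> a = b"
  by (rule atom_eqI) (simp_all add: fact_of_def)

lemma fact_of_eq_iff:
  assumes "a \<in> Q"
  shows "fact_of a u v = fact_of a u' v' \<longleftrightarrow> (X \<in> snd a \<longrightarrow> u = u') \<and> (Y \<in> snd a \<longrightarrow> v = v')"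
proof
  assume "fact_of a u v = fact_of a u' v'"
  then have *: "(assignment u v |` snd a) z = (assignment u' v' |` snd a) z" for z
    by (simp add: fact_of_def)
  show "(X \<in> snd a \<longrightarrow> u = u') \<and> (Y \<in> snd a \<longrightarrow> v = v')"
    using *[of X] *[of Y] vars by (auto simp: assignment_def)
qed (auto simp: fact_of_def assignment_def restrict_map_def)

lemma drop_Y: "fact_of aX u v = fact_of aX u 0"
  using fact_of_eq_iff[OF aX(1)] aX(3) by simp

lemma drop_X: "fact_of aY u v = fact_of aY 0 v"
  using fact_of_eq_iff[OF aY(1)] aY(2) by simp

text \<open>The pairs in \<open>E\<close> are the values of \<open>(X, Y)\<close> in potential assignments.  Only facts of the atoms
  \<open>aX\<close> and \<open>aY\<close> have to be bought, those of \<open>aY\<close> with a value in \<open>Z\<close> are free.\<close>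

definition base_db :: "(nat \<times> nat) set \<Rightarrow> nat set \<Rightarrow> fact set" where
  "base_db E Z = {fact_of a u v | a u v. a \<in> Q - {aX, aY} \<and> (u, v) \<in> E} \<union>
     {fact_of aY u v | u v. (u, v) \<in> E \<and> v \<in> Z}"

text \<open>The free facts of \<open>aY\<close> are listed again; they stay free, since
  \<open>valid_repair\<close> counts only \<open>D' - D\<close>.\<close>

definition repair_db :: "(nat \<times> nat) set \<Rightarrow> fact set" where
  "repair_db E = {fact_of a u v | a u v. a \<in> {aX, aY} \<and> (u, v) \<in> E}"

lemma sat_assignments_repair:
  assumes D': "base_db E Z \<subseteq> D'" "D' \<subseteq> base_db E Z \<union> repair_db E"
  shows "sat_assignments Q D' =
    (\<lambda>(u, v). assignment u v) ` {(u, v) \<in> E. fact_of aX u v \<in> D' \<and> fact_of aY u v \<in> D'}"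
    (is "_ = _ ` ?E")
proof
  show "sat_assignments Q D' \<subseteq> (\<lambda>(u, v). assignment u v) ` ?E"
  proof
    fix w assume "w \<in> sat_assignments Q D'"
    then have w: "dom w = query_vars Q" "\<And>a. a \<in> Q \<Longrightarrow> (fst a, w |` snd a) \<in> D'"
      unfolding sat_assignments_def by fastforce+
    have edge: "\<exists>u v. (u, v) \<in> E \<and> w |` snd a = assignment u v |` snd a" if a: "a \<in> Q" for a
    proof -
      have "(fst a, w |` snd a) \<in> base_db E Z \<union> repair_db E" using w(2)[OF a] D'(2) by blast
      then obtain b u v where b: "b \<in> Q" "(u, v) \<in> E" "(fst a, w |` snd a) = fact_of b u v"
        using aX(1) aY(1) unfolding base_db_def repair_db_def by blast
      then have "fst a = fst b" by (simp add: fact_of_def)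
      \<comment> \<open>Self-join-freeness: the relation symbol of a fact determines its
        atom.\<close>
      then have "a = b" using a b(1) by (rule atom_eqI)
      then show ?thesis using b(2,3) unfolding fact_of_def by blast
    qed
    \<comment> \<open>\<open>aXY\<close> contains both variables, so its fact pins down a pair in
      \<open>E\<close>. The facts of \<open>aX\<close> and \<open>aY\<close> alone could stem from
      different pairs.\<close>
    obtain u v where uv: "(u, v) \<in> E" "w |` snd aXY = assignment u v |` snd aXY"
      using edge[OF aXY(1)] by blast
    have "w = assignment u v"
    proof
      fix z
      show "w z = assignment u v z"
      proof (cases "z \<in> query_vars Q")
        case False
        then show ?thesis using w(1) by (auto simp: assignment_def)
      next
        case z: True
        show ?thesis
        proof (cases "z = X \<or> z = Y")
          case True
          then have "z \<in> snd aXY" using aXY by blast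
          then show ?thesis using fun_cong[OF uv(2), of z] by simp
        next
          case False
          \<comment> \<open>Any other variable lies in some atom, and every available fact gives it
            the value 0.\<close>
          obtain a where a: "a \<in> Q" "z \<in> snd a" using z unfolding query_vars_eq by blast
          obtain u' v' where "w |` snd a = assignment u' v' |` snd a" using edge[OF a(1)] by blast
          then have "w z = assignment u' v' z" using a(2) by (metis restrict_in)
          then show ?thesis using False by (simp add: assignment_def)
        qed
      qed
    qed
    then show "w \<in> (\<lambda>(u, v). assignment u v) ` ?E"
      using uv(1) w(2)[OF aX(1)] w(2)[OF aY(1)] by (force simp: fact_of_def)
  qed
  show "(\<lambda>(u, v). assignment u v) ` ?E \<subseteq> sat_assignments Q D'"
  proof
    fix w assume "w \<in> (\<lambda>(u, v). assignment u v) ` ?E"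
    then obtain u v where uv: "w = assignment u v" "(u, v) \<in> E" "fact_of aX u v \<in> D'"
      "fact_of aY u v \<in> D'" by auto
    have "fact_of a u v \<in> D'" if "a \<in> Q" for a
    proof (cases "a \<in> {aX, aY}")
      case False
      then have "fact_of a u v \<in> base_db E Z" using that uv(2) unfolding base_db_def by blast
      then show ?thesis using D'(1) by blast
    qed (use uv in blast)
    moreover have "dom w = query_vars Q" by (auto simp: uv(1) assignment_def split: if_splits)
    ultimately show "w \<in> sat_assignments Q D'"
      unfolding sat_assignments_def uv(1) by (auto simp: fact_of_def)
  qed
qed

lemma bag_set_value_repair:
  assumes "base_db E Z \<subseteq> D'" "D' \<subseteq> base_db E Z \<union> repair_db E"
  shows "bag_set_value Q D' = card {(u, v) \<in> E. fact_of aX u 0 \<in> D' \<and> fact_of aY 0 v \<in> D'}"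
proof -
  have "inj_on (\<lambda>(u, v). assignment u v) A" for A
  proof (rule inj_onI, clarify)
    fix u v u' v' assume "assignment u v = assignment u' v'"
    then have "assignment u v X = assignment u' v' X" "assignment u v Y = assignment u' v' Y"
      by simp_all
    then show "u = u' \<and> v = v'" using vars by (simp add: assignment_def)
  qed
  then have "bag_set_value Q D' = card {(u, v) \<in> E. fact_of aX u v \<in> D' \<and> fact_of aY u v \<in> D'}"
    unfolding bag_set_value_def sat_assignments_repair[OF assms] by (rule card_image)
  moreover have "fact_of aX u v \<in> D' \<and> fact_of aY u v \<in> D' \<longleftrightarrow>
      fact_of aX u 0 \<in> D' \<and> fact_of aY 0 v \<in> D'" for u v
    using drop_Y[of u v] drop_X[of u v] by simp
  ultimately show ?thesis by simp
qed

lemma finite_base_db: "finite E \<Longrightarrow> finite (base_db E Z)"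
proof -
  assume "finite E"
  moreover have "finite Q" using sjf by (simp add: sjf_bcq_def)
  ultimately have "finite ((\<lambda>(a, u, v). fact_of a u v) ` (Q \<times> E))" by blast
  moreover have "base_db E Z \<subseteq> (\<lambda>(a, u, v). fact_of a u v) ` (Q \<times> E)"
    using aY(1) unfolding base_db_def by force
  ultimately show ?thesis by (rule finite_subset[rotated])
qed

lemma finite_repair_db: "finite E \<Longrightarrow> finite (repair_db E)"
proof -
  assume "finite E"
  then have "finite ((\<lambda>(a, u, v). fact_of a u v) ` ({aX, aY} \<times> E))" by blast
  moreover have "repair_db E \<subseteq> (\<lambda>(a, u, v). fact_of a u v) ` ({aX, aY} \<times> E)"
    unfolding repair_db_def by force
  ultimately show ?thesis by (rule finite_subset[rotated])
qed

lemma db_instance_base: "finite E \<Longrightarrow> db_instance Q (base_db E Z)"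
  using finite_base_db fact_of_mem aY(1) unfolding db_instance_def base_db_def by blast

lemma db_instance_repair: "finite E \<Longrightarrow> db_instance Q (repair_db E)"
  using finite_repair_db fact_of_mem aX(1) aY(1) unfolding db_instance_def repair_db_def by blast

lemma bag_set_max_ge_iff:
  assumes "finite D" "finite Dr"
  shows "\<tau> \<le> bag_set_max Q D Dr \<theta> \<longleftrightarrow> (\<exists>D'. valid_repair D Dr \<theta> D' \<and> \<tau> \<le> bag_set_value Q D')"
proof -
  have "finite {D'. valid_repair D Dr \<theta> D'}"
    by (rule finite_subset[of _ "Pow (D \<union> Dr)"]) (use assms in \<open>auto simp: valid_repair_def\<close>)
  then have "finite {bag_set_value Q D' | D'. valid_repair D Dr \<theta> D'}" by simp
  moreover have "valid_repair D Dr \<theta> D" by (simp add: valid_repair_def)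
  then have "{bag_set_value Q D' | D'. valid_repair D Dr \<theta> D'} \<noteq> {}" by blast
  ultimately show ?thesis unfolding bag_set_max_def by (auto simp: Max_ge_iff)
qed

text \<open>\<open>A\<close> and \<open>B\<close> are the values whose \<open>aX\<close>- and
  \<open>aY\<close>-facts are bought. A fact of \<open>aX\<close> does not depend on
  \<open>v\<close> and one of \<open>aY\<close> not on \<open>u\<close>, so one purchase serves all
  edges at a vertex.\<close>

lemma bag_set_max_iff_dense:
  assumes E: "finite E"
  shows "\<tau> \<le> bag_set_max Q (base_db E Z) (repair_db E) \<theta> \<longleftrightarrow>
    (\<exists>A\<subseteq>fst ` E. \<exists>B\<subseteq>snd ` E - Z. card A + card B \<le> \<theta> \<and>
      \<tau> \<le> card {(u, v) \<in> E. u \<in> A \<and> (v \<in> B \<or> v \<in> Z)})"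
proof -
  let ?D = "base_db E Z" and ?R = "repair_db E"
  let ?fX = "\<lambda>u. fact_of aX u 0" and ?fY = "\<lambda>v. fact_of aY 0 v"
  have ne: "aX \<noteq> aY" using aX aY by blast
  have inj: "?fX u = ?fX u' \<longleftrightarrow> u = u'" "?fY u = ?fY u' \<longleftrightarrow> u = u'" for u u'
    using fact_of_eq_iff[OF aX(1)] fact_of_eq_iff[OF aY(1)] aX aY by simp_all
  have fX_D: "?fX u \<notin> ?D" for u
  proof
    assume "?fX u \<in> ?D"
    then consider a u' v' where "a \<in> Q - {aX, aY}" "?fX u = fact_of a u' v'"
      | u' v' where "?fX u = fact_of aY u' v'" unfolding base_db_def by blast
    then show False
    proof cases
      case 1
      then have "a \<in> Q" by simp
      from fact_of_eq_atom[OF 1(2) aX(1) this] show False using 1(1) by simp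
    next
      case 2
      from fact_of_eq_atom[OF 2 aX(1) aY(1)] show False using ne by simp
    qed
  qed
  have fY_D: "?fY v \<in> ?D \<longleftrightarrow> v \<in> Z \<and> v \<in> snd ` E" for v
  proof
    assume "?fY v \<in> ?D"
    then consider a u' v' where "a \<in> Q - {aX, aY}" "?fY v = fact_of a u' v'"
      | u' v' where "?fY v = fact_of aY u' v'" "(u', v') \<in> E" "v' \<in> Z" unfolding base_db_def by
          blast
    then show "v \<in> Z \<and> v \<in> snd ` E"
    proof cases
      case 1
      then have "a \<in> Q" by simp
      from fact_of_eq_atom[OF 1(2) aY(1) this] show ?thesis using 1(1) by simp
    next
      case 2
      then show ?thesis using drop_X[of u' v'] inj(2)[of v v'] by force
    qed
  next
    assume "v \<in> Z \<and> v \<in> snd ` E"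
    then obtain u where "(u, v) \<in> E" "v \<in> Z" by auto
    then have "fact_of aY u v \<in> ?D" unfolding base_db_def by blast
    then show "?fY v \<in> ?D" using drop_X[of u v] by simp
  qed
  have R: "?R = ?fX ` fst ` E \<union> ?fY ` snd ` E"
  proof
    show "?R \<subseteq> ?fX ` fst ` E \<union> ?fY ` snd ` E"
    proof
      fix f assume "f \<in> ?R"
      then obtain u v where "(u, v) \<in> E" "f = fact_of aX u v \<or> f = fact_of aY u v"
        unfolding repair_db_def by blast
      then show "f \<in> ?fX ` fst ` E \<union> ?fY ` snd ` E"
        using drop_Y[of u v] drop_X[of u v] by force
    qed
    show "?fX ` fst ` E \<union> ?fY ` snd ` E \<subseteq> ?R"
    proof
      fix f assume "f \<in> ?fX ` fst ` E \<union> ?fY ` snd ` E"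
      then obtain u v where "(u, v) \<in> E" "f = ?fX u \<or> f = ?fY v" by force
      then have "(u, v) \<in> E \<and> (f = fact_of aX u v \<or> f = fact_of aY u v)" using drop_Y[of u v]
          drop_X[of u v] by simp
      then show "f \<in> ?R" unfolding repair_db_def by blast
    qed
  qed
  have disj: "?fX ` A \<inter> ?fY ` B = {}" for A B
  proof -
    have "?fX u \<noteq> ?fY v" for u v
      using fact_of_eq_atom[OF _ aX(1) aY(1), of u 0 0 v] ne by (rule contrapos_nn[rotated])
    then show ?thesis unfolding disjoint_iff by (metis imageE)
  qed
  show ?thesis
    unfolding bag_set_max_ge_iff[OF finite_base_db[OF E] finite_repair_db[OF E]]
  proof
    assume "\<exists>D'. valid_repair ?D ?R \<theta> D' \<and> \<tau> \<le> bag_set_value Q D'"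
    then obtain D' where D': "?D \<subseteq> D'" "D' \<subseteq> ?D \<union> ?R" "card (D' - ?D) \<le> \<theta>" "\<tau> \<le> bag_set_value Q D'"
      unfolding valid_repair_def by blast
    define A where "A = {u \<in> fst ` E. ?fX u \<in> D'}"
    define B where "B = {v \<in> snd ` E - Z. ?fY v \<in> D'}"
    have fin: "finite A" "finite B" using E by (simp_all add: A_def B_def)
    have "card (?fX ` A \<union> ?fY ` B) = card A + card B"
    proof -
      have "card (?fX ` A) = card A" "card (?fY ` B) = card B"
        using inj by (auto intro!: card_image inj_onI)
      then show ?thesis using card_Un_disjoint[of "?fX ` A" "?fY ` B"] fin disj[of A B] by simp
    qed
    moreover have "?fX ` A \<union> ?fY ` B \<subseteq> D' - ?D" using fX_D fY_D by (auto simp: A_def B_def)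
    moreover have "finite (D' - ?D)"
      using D'(2) finite_base_db[OF E] finite_repair_db[OF E] by (meson finite_Diff finite_UnI
          finite_subset)
    ultimately have "card A + card B \<le> \<theta>" using D'(3) card_mono[of "D' - ?D" "?fX ` A \<union> ?fY ` B"] by
        simp
    moreover have "{(u, v) \<in> E. ?fX u \<in> D' \<and> ?fY v \<in> D'} = {(u, v) \<in> E. u \<in> A \<and> (v \<in> B \<or> v \<in> Z)}"
    proof -
      have "?fX u \<in> D' \<longleftrightarrow> u \<in> A" "?fY v \<in> D' \<longleftrightarrow> v \<in> B \<or> v \<in> Z" if "(u, v) \<in> E" for u v
      proof -
        have uv: "u \<in> fst ` E" "v \<in> snd ` E" using that by force+
        show "?fX u \<in> D' \<longleftrightarrow> u \<in> A" using uv by (simp add: A_def)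
        show "?fY v \<in> D' \<longleftrightarrow> v \<in> B \<or> v \<in> Z"
          using uv fY_D[of v] D'(1) by (auto simp: B_def)
      qed
      then show ?thesis by auto
    qed
    ultimately show "\<exists>A\<subseteq>fst ` E. \<exists>B\<subseteq>snd ` E - Z. card A + card B \<le> \<theta> \<and>
        \<tau> \<le> card {(u, v) \<in> E. u \<in> A \<and> (v \<in> B \<or> v \<in> Z)}"
      using D'(4) unfolding bag_set_value_repair[OF D'(1,2)]
      by (intro exI[of _ A] conjI exI[of _ B]) (auto simp: A_def B_def)
  next
    assume "\<exists>A\<subseteq>fst ` E. \<exists>B\<subseteq>snd ` E - Z. card A + card B \<le> \<theta> \<and>
        \<tau> \<le> card {(u, v) \<in> E. u \<in> A \<and> (v \<in> B \<or> v \<in> Z)}"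
    then obtain A B where AB: "A \<subseteq> fst ` E" "B \<subseteq> snd ` E - Z" "card A + card B \<le> \<theta>"
      "\<tau> \<le> card {(u, v) \<in> E. u \<in> A \<and> (v \<in> B \<or> v \<in> Z)}" by blast
    have fin: "finite A" "finite B" using AB(1,2) E by (meson finite_Diff finite_imageI
        finite_subset)+
    define D' where "D' = ?D \<union> (?fX ` A \<union> ?fY ` B)"
    have "?fX ` A \<subseteq> ?R" unfolding R by (rule le_supI1, rule image_mono, rule AB(1))
    moreover have "B \<subseteq> snd ` E" using AB(2) by (rule order_trans) (rule Diff_subset)
    then have "?fY ` B \<subseteq> ?R" unfolding R by (intro le_supI2 image_mono)
    ultimately have D': "?D \<subseteq> D'" "D' \<subseteq> ?D \<union> ?R" unfolding D'_def by (simp_all add: le_supI2)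
    have "card (D' - ?D) \<le> card (?fX ` A \<union> ?fY ` B)"
      using fin by (intro card_mono) (auto simp: D'_def)
    also have "\<dots> \<le> card A + card B"
      using card_Un_le[of "?fX ` A" "?fY ` B"] card_image_le[OF fin(1), of ?fX]
        card_image_le[OF fin(2), of ?fY] by linarith
    finally have "card (D' - ?D) \<le> \<theta>" using AB(3) by simp
    then have valid: "valid_repair ?D ?R \<theta> D'" using D' unfolding valid_repair_def by blast
    \<comment> \<open>An inclusion suffices in this direction, as only a lower bound on the value of
      the repair is wanted.\<close>
    have "{(u, v) \<in> E. u \<in> A \<and> (v \<in> B \<or> v \<in> Z)} \<subseteq> {(u, v) \<in> E. ?fX u \<in> D' \<and> ?fY v \<in> D'}"
    proof clarify
      fix u v assume uv: "(u, v) \<in> E" "u \<in> A" "v \<in> B \<or> v \<in> Z"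
      then have "v \<in> snd ` E" by force
      then have "?fY v \<in> D'" using uv(3) fY_D[of v] unfolding D'_def by auto
      then show "?fX u \<in> D' \<and> ?fY v \<in> D'" using uv(2) unfolding D'_def by simp
    qed
    moreover have "finite {(u, v) \<in> E. ?fX u \<in> D' \<and> ?fY v \<in> D'}"
      by (rule finite_subset[OF _ E]) auto
    ultimately have "\<tau> \<le> bag_set_value Q D'"
      using AB(4) card_mono unfolding bag_set_value_repair[OF D'] by (meson order_trans)
    with valid show "\<exists>D'. valid_repair ?D ?R \<theta> D' \<and> \<tau> \<le> bag_set_value Q D'" by blast
  qed
qed

end

section \<open>Decoding formulas\<close>

lemma enc_nat_inject: "enc_nat m = enc_nat n \<longleftrightarrow> m = n"
proof
  show "enc_nat m = enc_nat n \<Longrightarrow> m = n"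
  proof (induction m arbitrary: n rule: less_induct)
    case (less m)
    show ?case
    proof (cases "m = 0 \<or> n = 0")
      case True
      then show ?thesis using less.prems by (cases "m = 0"; cases "n = 0") (auto simp: enc_nat_pos)
    next
      case False
      then have "odd m = odd n" "enc_nat (m div 2) = enc_nat (n div 2)"
        using less.prems by (simp_all add: enc_nat_pos)
      moreover from this(2) have "m div 2 = n div 2" using less.IH[of "m div 2" "n div 2"] False by
          simp
      ultimately show ?thesis by (metis dvd_mult_div_cancel odd_two_times_div_two_succ)
    qed
  qed
qed simp

lemma inj_enc_nat: "inj enc_nat"
  by (rule injI) (simp add: enc_nat_inject)

text \<open>Serves the reasoning only: the programs work on codes throughout and never decode a
  number.\<close>

definition dec_nat :: "data \<Rightarrow> nat" where
  "dec_nat = inv enc_nat"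

lemma dec_enc_nat [simp]: "dec_nat (enc_nat n) = n"
  unfolding dec_nat_def by (rule inv_f_f[OF inj_enc_nat])

text \<open>The range of \<open>enc_nat\<close> as a polynomial-time test. The last nonempty suffix
  holds the most significant bit, which must be set.\<close>

definition num_code :: "data \<Rightarrow> bool" where
  "num_code x \<longleftrightarrow> (\<forall>b\<in>set (dec_list x). b = Tip \<or> b = Br Tip Tip) \<and>
    (\<forall>t\<in>set (map enc_list (suffixes (dec_list x))). t = Tip \<or> dright t \<noteq> Tip \<or> dleft t = Br Tip
        Tip)"

lemma num_code_Tip: "num_code Tip"
  by (simp add: num_code_def)

lemma num_code_Br:
  "num_code (Br b x) \<longleftrightarrow> (b = Tip \<and> x \<noteq> Tip \<or> b = Br Tip Tip) \<and> num_code x"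
  by (auto simp: num_code_def)

lemma enc_nat_double: "0 < n \<or> b \<Longrightarrow> enc_nat (2 * n + of_bool b) = Br (enc_bool b) (enc_nat n)"
  by (cases b) (auto simp: enc_nat_pos)

lemma enc_nat_eq_Tip [simp]: "enc_nat n = Tip \<longleftrightarrow> n = 0"
  using enc_nat_inject[of n 0] by simp

lemma num_code_enc_nat: "num_code (enc_nat n)"
proof (induction n rule: less_induct)
  case (less n)
  show ?case
  proof (cases "n = 0")
    case False
    then have "num_code (enc_nat (n div 2))" using less by simp
    moreover have "odd n" if "n div 2 = 0" using that False by presburger
    ultimately show ?thesis using False
      by (cases "odd n") (auto simp: enc_nat_pos num_code_Br)
  qed (simp add: num_code_Tip)
qed

lemma enc_dec_nat: "num_code x \<Longrightarrow> enc_nat (dec_nat x) = x"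
proof -
  have "\<exists>n. x = enc_nat n" if "num_code x" for x
    using that
  proof (induction x)
    case Tip
    then show ?case by (intro exI[of _ 0]) simp
  next
    case (Br b x)
    then obtain n where n: "x = enc_nat n" by (auto simp: num_code_Br)
    have b: "b = enc_bool (b \<noteq> Tip)" "0 < n \<or> b \<noteq> Tip"
      using Br.prems n by (auto simp: num_code_Br)
    show ?case using enc_nat_double[OF b(2)] b(1) n by metis
  qed
  then show "num_code x \<Longrightarrow> enc_nat (dec_nat x) = x" by fastforce
qed

lemma dec_nat_eq_iff: "num_code x \<Longrightarrow> num_code y \<Longrightarrow> dec_nat x = dec_nat y \<longleftrightarrow> x = y"
  by (metis enc_dec_nat)

text \<open>A final one turns any bit string into a canonical number; this is why the codes of gaps
  end with one.\<close>

lemma num_code_bits: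
  "(\<And>b. b \<in> set bs \<Longrightarrow> b = Tip \<or> b = Br Tip Tip) \<Longrightarrow> num_code (enc_list (bs @ [Br Tip Tip]))"
  by (induction bs) (auto simp: num_code_Br num_code_Tip)

lemma ptime_pred_num_code: "ptime F \<Longrightarrow> ptime_pred (\<lambda>y. num_code (F y))"
proof (rule ptime_pred_comp)
  show "ptime_pred num_code"
    unfolding num_code_def[abs_def] by (intro ptime_intros ptime_list_suffixes)
qed

text \<open>A reduction has to treat every tree. Those failing this test receive no gaps and so
  become no-instances.\<close>

definition valid_cnf :: "nat \<Rightarrow> data \<Rightarrow> bool" where
  "valid_cnf d x \<longleftrightarrow> (\<forall>C\<in>set (dec_list x). length (dec_list C) \<le> d \<and>
     (\<forall>l\<in>set (dec_list C). l \<noteq> Tip \<and> (dleft l = Tip \<or> dleft l = Br Tip Tip) \<and> num_code (dright l)))"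

definition clauses_of :: "data \<Rightarrow> (bool \<times> data) list set" where
  "clauses_of x = (\<lambda>C. map (\<lambda>l. (dleft l \<noteq> Tip, dright l)) (dec_list C)) ` set (dec_list x)"

definition vars_of :: "data \<Rightarrow> data list" where
  "vars_of x = remdups (map dright (concat (map dec_list (dec_list x))))"

lemma enc_bool_eq_Tip: "enc_bool b = Tip \<longleftrightarrow> \<not> b"
  by (simp add: enc_bool_def)

lemma clauses_of_enc_cnf: "clauses_of (enc_cnf \<phi>) = map (\<lambda>(b, v). (b, enc_nat v)) ` set \<phi>"
  unfolding clauses_of_def enc_cnf_def
  by (simp add: image_image comp_def case_prod_beta' enc_bool_eq_Tip)

lemma set_vars_of_enc_cnf: "set (vars_of (enc_cnf \<phi>)) = enc_nat ` cnf_vars \<phi>"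
  unfolding vars_of_def enc_cnf_def cnf_vars_def
  by (force simp: image_iff case_prod_beta)

lemma valid_cnf_iff: "valid_cnf d x \<longleftrightarrow> (\<exists>\<phi>\<in>Gamma1 d. x = enc_cnf \<phi>)"
proof
  assume valid: "valid_cnf d x"
  define \<phi> where "\<phi> = map (\<lambda>C. map (\<lambda>l. (dleft l \<noteq> Tip, dec_nat (dright l))) (dec_list C)) (dec_list
      x)"
  have lit: "Br (enc_bool (dleft l \<noteq> Tip)) (enc_nat (dec_nat (dright l))) = l"
    if "C \<in> set (dec_list x)" "l \<in> set (dec_list C)" for C l
  proof -
    have "l \<noteq> Tip" "dleft l = Tip \<or> dleft l = Br Tip Tip" "num_code (dright l)"
      using valid that unfolding valid_cnf_def by simp_all
    then show ?thesis by (cases l) (auto simp: enc_dec_nat)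
  qed
  have "enc_list (map (\<lambda>l. Br (enc_bool (dleft l \<noteq> Tip)) (enc_nat (dec_nat (dright l)))) (dec_list
      C)) = C"
    if "C \<in> set (dec_list x)" for C
  proof -
    have "map (\<lambda>l. Br (enc_bool (dleft l \<noteq> Tip)) (enc_nat (dec_nat (dright l)))) (dec_list C) =
        dec_list C"
      by (rule map_idI) (rule lit[OF that])
    then show ?thesis by simp
  qed
  then have "map (\<lambda>C. enc_list (map (\<lambda>l. Br (enc_bool (dleft l \<noteq> Tip)) (enc_nat (dec_nat (dright
      l))))
      (dec_list C))) (dec_list x) = dec_list x"
    by (rule map_idI)
  then have "x = enc_cnf \<phi>"
    unfolding enc_cnf_def \<phi>_def by (simp add: comp_def)
  moreover have "\<phi> \<in> Gamma1 d"
    using valid unfolding Gamma1_def \<phi>_def valid_cnf_def by auto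
  ultimately show "\<exists>\<phi>\<in>Gamma1 d. x = enc_cnf \<phi>" by blast
next
  assume "\<exists>\<phi>\<in>Gamma1 d. x = enc_cnf \<phi>"
  then obtain \<phi> where \<phi>: "\<phi> \<in> Gamma1 d" "x = enc_cnf \<phi>" by blast
  show "valid_cnf d x"
    using \<phi>(1) unfolding valid_cnf_def \<phi>(2) enc_cnf_def Gamma1_def
    by (auto simp: enc_bool_def num_code_enc_nat)
qed

lemma lit_sat_clauses_of:
  "lit_sat (enc_nat ` S) (clauses_of (enc_cnf \<phi>)) \<longleftrightarrow> cnf_sat S \<phi>"
  unfolding lit_sat_def cnf_sat_def clauses_of_enc_cnf
  by (simp add: case_prod_beta inj_image_mem_iff[OF inj_enc_nat])

text \<open>Injectivity of \<open>enc_nat\<close> carries weight and satisfaction over to sets of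
  variable codes, so the source problem is expressed on trees.\<close>

lemma weighted_sat_iff:
  "(x, k) \<in> weighted_sat d \<longleftrightarrow> valid_cnf d x \<and>
    (\<exists>S. S \<subseteq> set (vars_of x) \<and> card S = k \<and> lit_sat S (clauses_of x))"
proof
  assume "(x, k) \<in> weighted_sat d"
  then obtain \<phi> S where \<phi>: "x = enc_cnf \<phi>" "\<phi> \<in> Gamma1 d" "S \<subseteq> cnf_vars \<phi>" "card S = k" "cnf_sat S
      \<phi>"
    unfolding weighted_sat_def by blast
  have "card (enc_nat ` S) = k"
    using card_image[OF inj_on_subset[OF inj_enc_nat, of S]] \<phi>(4) by simp
  then show "valid_cnf d x \<and> (\<exists>S. S \<subseteq> set (vars_of x) \<and> card S = k \<and> lit_sat S (clauses_of x))"
    using \<phi> unfolding valid_cnf_iff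
    by (intro conjI bexI[of _ \<phi>] exI[of _ "enc_nat ` S"])
      (simp_all add: set_vars_of_enc_cnf lit_sat_clauses_of image_mono)
next
  assume "valid_cnf d x \<and> (\<exists>S. S \<subseteq> set (vars_of x) \<and> card S = k \<and> lit_sat S (clauses_of x))"
  then obtain \<phi> S where \<phi>: "x = enc_cnf \<phi>" "\<phi> \<in> Gamma1 d" "S \<subseteq> enc_nat ` cnf_vars \<phi>" "card S = k"
      "lit_sat S (clauses_of x)"
    unfolding valid_cnf_iff by (auto simp: set_vars_of_enc_cnf)
  obtain S' where S': "S' \<subseteq> cnf_vars \<phi>" "S = enc_nat ` S'"
    using \<phi>(3) by (meson subset_image_iff)
  have "card S' = k"
    using card_image[OF inj_on_subset[OF inj_enc_nat, of S']] \<phi>(4) S'(2) by simp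
  moreover have "cnf_sat S' \<phi>" using \<phi>(5) unfolding \<phi>(1) S'(2) lit_sat_clauses_of .
  ultimately show "(x, k) \<in> weighted_sat d"
    using \<phi>(1,2) S'(1) unfolding weighted_sat_def by blast
qed

lemma enc_unary_inject: "enc_unary m = enc_unary n \<longleftrightarrow> m = n"
  by (auto simp: enc_unary_def dest: arg_cong[of _ _ length])

lemma ptime_pred_eq_nat: "ptime_nat M \<Longrightarrow> ptime_nat N \<Longrightarrow> ptime_pred (\<lambda>y. M y = N y)"
  using ptime_pred_eq[of "\<lambda>y. enc_unary (M y)" "\<lambda>y. enc_unary (N y)"] by (simp add: enc_unary_inject
      ptime_nat_def)

text \<open>Turns the comparison of unary numbers into membership in a list of suffixes.\<close>

lemma replicate_mem_suffixes:
  "replicate m a \<in> set (suffixes (replicate n a)) \<longleftrightarrow> m \<le> n"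
proof
  assume "replicate m a \<in> set (suffixes (replicate n a))"
  then show "m \<le> n" by (auto dest: suffix_length_le)
next
  assume "m \<le> n"
  then have "replicate n a = replicate (n - m) a @ replicate m a" by (simp flip: replicate_add)
  then show "replicate m a \<in> set (suffixes (replicate n a))" by (auto simp: suffix_def)
qed

lemma ptime_pred_le_nat:
  assumes "ptime_nat M" "ptime_nat N"
  shows "ptime_pred (\<lambda>y. M y \<le> N y)"
proof -
  have "ptime_pred (\<lambda>y. enc_list (replicate (M y) Tip) \<in> set (map enc_list (suffixes (replicate (N
      y) Tip))))"
    by (intro ptime_intros ptime_list_suffixes assms)
  moreover have "enc_list (replicate m Tip) \<in> set (map enc_list (suffixes (replicate n Tip))) \<longleftrightarrow> m \<le>
      n" for m n
    using replicate_mem_suffixes[of m Tip n] by (auto simp: image_iff simp del: in_set_suffixes)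
  ultimately show ?thesis by simp
qed

lemma ptime_pred_valid_cnf: "ptime F \<Longrightarrow> ptime_pred (\<lambda>y. valid_cnf d (F y))"
proof (rule ptime_pred_comp)
  show "ptime_pred (valid_cnf d)"
    unfolding valid_cnf_def[abs_def] by (intro ptime_intros ptime_pred_le_nat ptime_nat_length
        ptime_pred_num_code)
qed

lemma ptime_list_vars_of: "ptime F \<Longrightarrow> ptime_list (\<lambda>y. vars_of (F y))"
proof (rule ptime_list_comp)
  show "ptime_list vars_of"
    unfolding vars_of_def[abs_def] by (intro ptime_intros)
qed

section \<open>The reduction on trees\<close>

definition lay :: "data \<Rightarrow> nat" where
  "lay g = length (dec_list (dleft g))"

definition hi :: "data \<Rightarrow> data list" where
  "hi g = dec_list (dleft (dright g))"

definition lo :: "data \<Rightarrow> data list" where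
  "lo g = dec_list (dright (dright g))"

definition mk_gap :: "nat \<Rightarrow> data list \<Rightarrow> data list \<Rightarrow> data" where
  "mk_gap i A B = Br (enc_unary i) (Br (enc_list A) (enc_list B))"

lemma gap_sel [simp]: "lay (mk_gap i A B) = i" "hi (mk_gap i A B) = A" "lo (mk_gap i A B) = B"
  by (simp_all add: mk_gap_def lay_def hi_def lo_def enc_unary_def)

lemma ptime_nat_lay: "ptime F \<Longrightarrow> ptime_nat (\<lambda>y. lay (F y))"
  unfolding lay_def by (intro ptime_intros ptime_nat_length)

lemma ptime_list_hi: "ptime F \<Longrightarrow> ptime_list (\<lambda>y. hi (F y))"
  unfolding hi_def by (intro ptime_intros)

lemma ptime_list_lo: "ptime F \<Longrightarrow> ptime_list (\<lambda>y. lo (F y))"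
  unfolding lo_def by (intro ptime_intros)

definition input_param :: "data \<Rightarrow> nat" where
  "input_param y = length (dec_list (dright y))"

lemma ptime_nat_input_param: "ptime F \<Longrightarrow> ptime_nat (\<lambda>y. input_param (F y))"
  unfolding input_param_def by (intro ptime_intros ptime_nat_length)

text \<open>The argument is the pair of formula and unary parameter, and \<open>D = Suc d\<close>. A
  layer is a suffix of the unary number \<open>k + D\<close>, and \<open>i < k\<close> is written
  \<open>i + 1 \<le> k\<close> to use the available comparison.\<close>

definition gaps :: "nat \<Rightarrow> data \<Rightarrow> data list" where
  "gaps d y = remdups (if valid_cnf d (dleft y) then
     concat (map (\<lambda>i. concat (map (\<lambda>A. concat (map (\<lambda>B.
       if (i = Tip \<longrightarrow> dec_list A = vars_of (dleft y)) \<and>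
          (length (dec_list i) + 1 \<le> input_param y \<longleftrightarrow> B \<noteq> Tip)
       then [Br i (Br A B)] else [])
       (map enc_list (suffixes (dec_list A)))))
       (map enc_list (suffixes (vars_of (dleft y))))))
       (map enc_list (suffixes (replicate (input_param y + Suc d) Tip))))
     else [])"

lemma ptime_list_gaps: "ptime F \<Longrightarrow> ptime_list (\<lambda>y. gaps d (F y))"
proof (rule ptime_list_comp)
  show "ptime_list (gaps d)"
    unfolding gaps_def[abs_def]
    by (intro ptime_intros ptime_list_suffixes ptime_pred_valid_cnf ptime_list_vars_of
        ptime_nat_input_param ptime_pred_eq_list ptime_pred_le_nat
        ptime_nat_length)
qed

lemma suffix_replicate: "suffix xs (replicate n a) \<longleftrightarrow> (\<exists>i\<le>n. xs = replicate i a)"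
proof
  assume *: "suffix xs (replicate n a)"
  then have "length xs \<le> n" "\<forall>x\<in>set xs. x = a"
    using suffix_length_le[OF *] set_mono_suffix[OF *] by auto
  then show "\<exists>i\<le>n. xs = replicate i a" by (intro exI[of _ "length xs"]) (simp add: replicate_eqI)
next
  assume "\<exists>i\<le>n. xs = replicate i a"
  then show "suffix xs (replicate n a)" using replicate_mem_suffixes[of _ a n] by auto
qed

lemma mem_gaps_iff:
  "g \<in> set (gaps d y) \<longleftrightarrow> valid_cnf d (dleft y) \<and>
    (\<exists>i A B. g = mk_gap i A B \<and> gap_ok (input_param y) (Suc d) (vars_of (dleft y)) i A B)"
proof -
  define n where "n = input_param y + Suc d"
  have "g \<in> set (gaps d y) \<longleftrightarrow> valid_cnf d (dleft y) \<and>
    (\<exists>i. suffix i (replicate n Tip) \<and>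
     (\<exists>A. suffix A (vars_of (dleft y)) \<and> (\<exists>B. suffix B A \<and> (i = [] \<longrightarrow> A = vars_of (dleft y)) \<and>
       (length i + 1 \<le> input_param y \<longleftrightarrow> B \<noteq> []) \<and> g = Br (enc_list i) (Br (enc_list A) (enc_list
           B)))))"
    unfolding gaps_def n_def[symmetric] by auto
  also have "\<dots> \<longleftrightarrow> valid_cnf d (dleft y) \<and>
    (\<exists>i\<le>n. \<exists>A. suffix A (vars_of (dleft y)) \<and> (\<exists>B. suffix B A \<and>
      (i = 0 \<longrightarrow> A = vars_of (dleft y)) \<and> (i < input_param y \<longleftrightarrow> B \<noteq> []) \<and> g = mk_gap i A B))"
    unfolding suffix_replicate by (fastforce simp: mk_gap_def enc_unary_def Suc_le_eq)
  also have "\<dots> \<longleftrightarrow> valid_cnf d (dleft y) \<and>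
    (\<exists>i A B. g = mk_gap i A B \<and> gap_ok (input_param y) (Suc d) (vars_of (dleft y)) i A B)"
    unfolding gap_ok_def n_def
    by (rule conj_cong[OF refl], rule iffI; elim exE conjE; intro exI conjI; assumption)
  finally show ?thesis .
qed

text \<open>\<open>allowed\<close> for \<open>D = Suc d\<close>, spelled out on codes in the form
  that the closure rules accept; \<open>set_hyperedges\<close> restores the abstract form.\<close>

definition hyperedges :: "nat \<Rightarrow> data \<Rightarrow> data list" where
  "hyperedges d y = concat (map (\<lambda>c.
     if (\<forall>g\<in>set (dec_list c). \<forall>g'\<in>set (dec_list c). g \<noteq> g' \<longrightarrow>
           \<not> lay g = lay g' \<and> (lay g' = lay g + 1 \<longrightarrow> hi g' = dec_list (dright (dright (dright g)))))
               \<and>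
        (\<forall>C\<in>set (dec_list (dleft y)). \<exists>l\<in>set (dec_list C). \<forall>g\<in>set (dec_list c).
           \<not> (if dleft l \<noteq> Tip then dright l \<in> set (hi g) \<and> \<not> dright l \<in> set (lo g)
              else dright (dright g) \<noteq> Tip \<and> dleft (dright (dright g)) = dright l))
     then [c] else []) (map enc_list (combs (Suc d) (gaps d y))))"

lemma ptime_list_hyperedges: "ptime F \<Longrightarrow> ptime_list (\<lambda>y. hyperedges d (F y))"
proof (rule ptime_list_comp)
  show "ptime_list (hyperedges d)"
    unfolding hyperedges_def[abs_def]
    by (intro ptime_intros ptime_list_combs ptime_list_gaps ptime_pred_eq_nat ptime_pred_eq_list
        ptime_nat_lay ptime_list_hi ptime_list_lo)
qed

lemma tl_dec_list: "tl (dec_list t) = dec_list (dright t)"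
  by (cases t) auto

lemma falsifies_gap:
  "falsifies (hi g) (lo g) (dleft l \<noteq> Tip, dright l) \<longleftrightarrow>
    (if dleft l \<noteq> Tip then dright l \<in> set (hi g) \<and> \<not> dright l \<in> set (lo g)
     else dright (dright g) \<noteq> Tip \<and> dleft (dright (dright g)) = dright l)"
  by (cases "dright (dright g)") (auto simp: falsifies_def lo_def)

lemma set_hyperedges: "set (hyperedges d y) =
  enc_list ` {c \<in> set (combs (Suc d) (gaps d y)). allowed lay hi lo (clauses_of (dleft y)) (set c)}"
proof -
  have *: "allowed lay hi lo (clauses_of (dleft y)) (set (dec_list c)) \<longleftrightarrow>
     (\<forall>g\<in>set (dec_list c). \<forall>g'\<in>set (dec_list c). g \<noteq> g' \<longrightarrow>
           \<not> lay g = lay g' \<and> (lay g' = lay g + 1 \<longrightarrow> hi g' = dec_list (dright (dright (dright g)))))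
               \<and>
        (\<forall>C\<in>set (dec_list (dleft y)). \<exists>l\<in>set (dec_list C). \<forall>g\<in>set (dec_list c).
           \<not> (if dleft l \<noteq> Tip then dright l \<in> set (hi g) \<and> \<not> dright l \<in> set (lo g)
              else dright (dright g) \<noteq> Tip \<and> dleft (dright (dright g)) = dright l))" for c
    unfolding allowed_def falsifies_gap[symmetric] clauses_of_def
    by (simp add: lo_def tl_dec_list)
  show ?thesis
    unfolding hyperedges_def *[symmetric] by auto
qed

section \<open>Binary names for gaps, hyperedges and dummies\<close>

text \<open>The parts of a gap are suffixes of fixed lists, so that their lengths identify it.\<close>

definition gap_bits :: "data \<Rightarrow> data list" where
  "gap_bits g = replicate (lay g) Tip @ Br Tip Tip # replicate (length (hi g)) Tip @
     Br Tip Tip # replicate (length (lo g)) Tip @ [Br Tip Tip]"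

lemma ptime_list_gap_bits: "ptime F \<Longrightarrow> ptime_list (\<lambda>y. gap_bits (F y))"
  unfolding gap_bits_def by (intro ptime_intros ptime_nat_lay ptime_nat_length ptime_list_hi
      ptime_list_lo)

text \<open>The code of a hyperedge has exactly \<open>3 * Suc d\<close> ones.\<close>

definition dummies :: "nat \<Rightarrow> data list" where
  "dummies d = map (\<lambda>j. enc_list (replicate (3 * Suc d + 1 + j) (Br Tip Tip))) [0..<d]"

text \<open>The endpoints are bit strings that are already canonical binary numbers, so they can be
  used as domain values without computing a numbering.\<close>

definition edges :: "nat \<Rightarrow> data \<Rightarrow> data list" where
  "edges d y =
     concat (map (\<lambda>c. map (\<lambda>g. Br (enc_list (gap_bits g)) (enc_list (concat (map gap_bits (dec_list
         c)))))
       (dec_list c)) (hyperedges d y)) @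
     concat (map (\<lambda>g. map (\<lambda>z. Br (enc_list (gap_bits g)) z) (dummies d)) (gaps d y))"

lemma ptime_list_edges: "ptime F \<Longrightarrow> ptime_list (\<lambda>y. edges d (F y))"
proof (rule ptime_list_comp)
  show "ptime_list (edges d)"
    unfolding edges_def[abs_def] by (intro ptime_intros ptime_list_hyperedges ptime_list_gaps
        ptime_list_gap_bits)
qed

lemma replicate_Tip_cancel:
  "replicate m Tip @ Br a b # xs = replicate n Tip @ Br a b # ys \<longleftrightarrow> m = n \<and> xs = ys"
proof (induction m arbitrary: n)
  case 0
  show ?case by (cases n) auto
next
  case (Suc m)
  then show ?case by (cases n) auto
qed

text \<open>Three lengths in unary, each closed by a one, form a prefix code. Concatenations can
  therefore be decoded, and they name hyperedges.\<close>

lemma gap_bits_append_inject: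
  "gap_bits g @ xs = gap_bits g' @ ys \<longleftrightarrow>
    lay g = lay g' \<and> length (hi g) = length (hi g') \<and> length (lo g) = length (lo g') \<and> xs = ys"
  by (auto simp: gap_bits_def replicate_Tip_cancel)

lemma suffix_eq_if_length_eq: "suffix xs zs \<Longrightarrow> suffix ys zs \<Longrightarrow> length xs = length ys \<Longrightarrow> xs = ys"
  by (auto simp: suffix_def)

lemma gaps_eqI:
  assumes "g \<in> set (gaps d y)" "g' \<in> set (gaps d y)"
    "lay g = lay g'" "length (hi g) = length (hi g')" "length (lo g) = length (lo g')"
  shows "g = g'"
proof -
  obtain i A B where g: "g = mk_gap i A B" "suffix A (vars_of (dleft y))" "suffix B A"
    using assms(1) unfolding mem_gaps_iff gap_ok_def by metis
  obtain i' A' B' where g': "g' = mk_gap i' A' B'" "suffix A' (vars_of (dleft y))" "suffix B' A'"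
    using assms(2) unfolding mem_gaps_iff gap_ok_def by metis
  have "A = A'" using suffix_eq_if_length_eq[OF g(2) g'(2)] assms(4) g(1) g'(1) by simp
  then have "B = B'" using suffix_eq_if_length_eq[OF g(3)] g'(3) assms(5) g(1) g'(1) by simp
  then show ?thesis using \<open>A = A'\<close> assms(3) g(1) g'(1) by simp
qed

lemma concat_gap_bits_inject:
  "length c = length c' \<Longrightarrow> set c \<subseteq> set (gaps d y) \<Longrightarrow> set c' \<subseteq> set (gaps d y) \<Longrightarrow>
   concat (map gap_bits c) = concat (map gap_bits c') \<Longrightarrow> c = c'"
proof (induction c c' rule: list_induct2)
  case (Cons g c g' c')
  then show ?case
    using gaps_eqI[of g d y g'] by (simp add: gap_bits_append_inject)
qed simp

lemma num_code_gap_bits: "num_code (enc_list (gap_bits g))"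
proof -
  have "gap_bits g = (replicate (lay g) Tip @ Br Tip Tip # replicate (length (hi g)) Tip @
     Br Tip Tip # replicate (length (lo g)) Tip) @ [Br Tip Tip]"
    by (simp add: gap_bits_def)
  then show ?thesis by (simp only:) (rule num_code_bits, auto)
qed

lemma num_code_append: "xs \<noteq> [] \<Longrightarrow> num_code (enc_list xs) \<Longrightarrow> num_code (enc_list ys) \<Longrightarrow>
  num_code (enc_list (xs @ ys))"
  by (induction xs rule: list_nonempty_induct) (auto simp: num_code_Br num_code_Tip)

lemma num_code_concat_gap_bits: "num_code (enc_list (concat (map gap_bits c)))"
proof (induction c)
  case (Cons g c)
  have "gap_bits g \<noteq> []" by (simp add: gap_bits_def)
  from num_code_append[OF this num_code_gap_bits Cons] show ?case by simp
qed (simp add: num_code_Tip)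

lemma num_code_dummies: "z \<in> set (dummies d) \<Longrightarrow> num_code z"
proof -
  have "num_code (enc_list (replicate n (Br Tip Tip)))" for n
    by (induction n) (auto simp: num_code_Br num_code_Tip)
  then show "z \<in> set (dummies d) \<Longrightarrow> num_code z" by (auto simp: dummies_def simp del: replicate.simps)
qed

lemma card_dummies: "card (set (dummies d)) = d"
proof -
  have "distinct (dummies d)"
    by (auto simp: dummies_def distinct_map inj_on_def dest: arg_cong[of _ _ length])
  then show ?thesis using distinct_card[of "dummies d"] by (simp add: dummies_def)
qed

lemma count_list_replicate_eq: "count_list (replicate n a) b = (if a = b then n else 0)"
  by (induction n) auto

lemma concat_gap_bits_not_dummy:
  assumes "length c = Suc d"
  shows "enc_list (concat (map gap_bits c)) \<notin> set (dummies d)"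
proof
  assume "enc_list (concat (map gap_bits c)) \<in> set (dummies d)"
  then obtain j where "concat (map gap_bits c) = replicate (3 * Suc d + 1 + j) (Br Tip Tip)"
    by (auto simp: dummies_def simp del: replicate.simps)
  then have "count_list (concat (map gap_bits c)) (Br Tip Tip) = 3 * Suc d + 1 + j"
    by (simp add: count_list_replicate_eq del: replicate.simps)
  moreover have "count_list (concat (map gap_bits c)) (Br Tip Tip) = 3 * length c"
    by (induction c) (simp_all add: gap_bits_def count_list_replicate_eq)
  ultimately show False using assms by simp
qed

section \<open>Correctness of the combinatorial part of the reduction\<close>

lemma weighted_sat_iff_hyperclique:
  fixes d y
  assumes d: "1 \<le> d"
  defines "U \<equiv> set (gaps d y)" and "k \<equiv> input_param y"
  defines "V \<equiv> {c. c \<subseteq> U \<and> card c = Suc d \<and> allowed lay hi lo (clauses_of (dleft y)) c}"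
  shows "(dleft y, k) \<in> weighted_sat d \<longleftrightarrow>
    (\<exists>G\<subseteq>U. card G = k + Suc d + 1 \<and> (\<forall>c\<subseteq>G. card c = Suc d \<longrightarrow> c \<in> V))"
proof
  assume "(dleft y, k) \<in> weighted_sat d"
  then obtain S where S: "valid_cnf d (dleft y)" "S \<subseteq> set (vars_of (dleft y))" "card S = k"
      "lit_sat S (clauses_of (dleft y))"
    unfolding weighted_sat_iff by blast
  have "\<exists>G\<subseteq>U. card G = k + Suc d + 1 \<and> all_allowed lay hi lo (clauses_of (dleft y)) (Suc d) G"
  proof (rule allowed_gaps_if_sat[where mk = mk_gap, OF _ _ S(2-4)])
    show "distinct (vars_of (dleft y))" by (simp add: vars_of_def)
    show "mk_gap i A B \<in> U \<and> lay (mk_gap i A B) = i \<and> hi (mk_gap i A B) = A \<and> lo (mk_gap i A B) = B"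
      if "gap_ok k (Suc d) (vars_of (dleft y)) i A B" for i A B
      using S(1) that unfolding U_def k_def mem_gaps_iff by auto
  qed
  then obtain G where G: "G \<subseteq> U" "card G = k + Suc d + 1"
      "all_allowed lay hi lo (clauses_of (dleft y)) (Suc d) G" by blast
  have "c \<in> V" if "c \<subseteq> G" "card c = Suc d" for c
    using that G(1,3) unfolding V_def all_allowed_def by auto
  then show "\<exists>G\<subseteq>U. card G = k + Suc d + 1 \<and> (\<forall>c\<subseteq>G. card c = Suc d \<longrightarrow> c \<in> V)"
    using G(1,2) by (intro exI[of _ G]) simp
next
  assume "\<exists>G\<subseteq>U. card G = k + Suc d + 1 \<and> (\<forall>c\<subseteq>G. card c = Suc d \<longrightarrow> c \<in> V)"
  then obtain G where G: "G \<subseteq> U" "card G = k + Suc d + 1" "\<forall>c\<subseteq>G. card c = Suc d \<longrightarrow> c \<in> V"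
    by blast
  \<comment> \<open>Malformed formulas have no gaps, so any vertex certifies that the input is a
    formula.\<close>
  have "G \<noteq> {}" using G(2) by auto
  then obtain g where "g \<in> U" using G(1) by blast
  then have valid: "valid_cnf d (dleft y)" unfolding U_def mem_gaps_iff by simp
  have "\<exists>S. S \<subseteq> set (vars_of (dleft y)) \<and> card S = k \<and> lit_sat S (clauses_of (dleft y))"
  proof (rule sat_if_allowed_gaps[OF _ _ _ _ G(1,2)])
    show "distinct (vars_of (dleft y))" by (simp add: vars_of_def)
    show "snd ` set C \<subseteq> set (vars_of (dleft y)) \<and> length C \<le> Suc d" if "C \<in> clauses_of (dleft y)"
        for C
    proof -
      from that obtain C' where C': "C' \<in> set (dec_list (dleft y))" "C = map (\<lambda>l. (dleft l \<noteq> Tip,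
          dright l)) (dec_list C')"
        unfolding clauses_of_def by auto
      have "length (dec_list C') \<le> d" using valid C'(1) unfolding valid_cnf_def by blast
      moreover have "snd ` set C = dright ` set (dec_list C')" unfolding C'(2) by (simp add:
          image_image)
      moreover have "dright ` set (dec_list C') \<subseteq> set (vars_of (dleft y))"
        using C'(1) unfolding vars_of_def by auto
      ultimately show ?thesis using C'(2) by simp
    qed
    \<comment> \<open>Hyperedges of size \<open>Suc d\<close> rather than \<open>d\<close> can
      compare two gaps even when \<open>d = 1\<close>.\<close>
    show "2 \<le> Suc d" using d by simp
    show "gap_ok k (Suc d) (vars_of (dleft y)) (lay g) (hi g) (lo g)" if "g \<in> U" for g
      using that unfolding U_def k_def mem_gaps_iff by auto
    show "all_allowed lay hi lo (clauses_of (dleft y)) (Suc d) G"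
      using G(3) unfolding all_allowed_def V_def by simp
  qed
  with valid show "(dleft y, k) \<in> weighted_sat d" unfolding weighted_sat_iff by blast
qed

definition edge_set :: "nat \<Rightarrow> data \<Rightarrow> (nat \<times> nat) set" where
  "edge_set d y = (\<lambda>e. (dec_nat (dleft e), dec_nat (dright e))) ` set (edges d y)"

definition dummy_set :: "nat \<Rightarrow> nat set" where
  "dummy_set d = dec_nat ` set (dummies d)"

lemma card_dummy_set: "card (dummy_set d) = d"
proof -
  have "inj_on dec_nat (set (dummies d))"
    by (rule inj_onI) (simp add: dec_nat_eq_iff num_code_dummies)
  then show ?thesis by (simp add: dummy_set_def card_image card_dummies)
qed

lemma num_code_edges:
  assumes "e \<in> set (edges d y)"
  shows "num_code (dleft e) \<and> num_code (dright e)"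
proof -
  from assms consider c g where "e = Br (enc_list (gap_bits g)) (enc_list (concat (map gap_bits
      c)))"
    | g z where "e = Br (enc_list (gap_bits g)) z" "z \<in> set (dummies d)"
    unfolding edges_def by auto
  then show ?thesis
    by cases (simp_all add: num_code_gap_bits num_code_concat_gap_bits num_code_dummies)
qed

lemma edge_set_eq_incidence:
  fixes d y
  defines "U \<equiv> set (gaps d y)"
  defines "V \<equiv> {c. c \<subseteq> U \<and> card c = Suc d \<and> allowed lay hi lo (clauses_of (dleft y)) c}"
  shows "\<exists>uid vid. inj_on uid U \<and> inj_on vid V \<and> vid ` V \<inter> dummy_set d = {} \<and>
    edge_set d y = incidence uid vid U V (dummy_set d)"
proof -
  define L where "L = set (combs (Suc d) (gaps d y))"
  \<comment> \<open>The code of a hyperedge depends on the order of its gaps; \<open>lst\<close>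
    fixes the one listing that \<open>combs\<close> produces.\<close>
  define lst where "lst = inv_into L set"
  define uid where "uid g = dec_nat (enc_list (gap_bits g))" for g
  define code where "code c = dec_nat (enc_list (concat (map gap_bits c)))" for c
  define vid where "vid c = code (lst c)" for c
  have dist: "distinct (gaps d y)" by (simp add: gaps_def)
  have lst_set: "lst (set c) = c" if "c \<in> L" for c
    unfolding lst_def using inj_on_set_combs[OF dist] that unfolding L_def by (rule inv_into_f_f)
  have lst: "lst c \<in> L" "set (lst c) = c" if "c \<in> V" for c
  proof -
    have "c \<subseteq> set (gaps d y)" "card c = Suc d" using that unfolding V_def U_def by simp_all
    then obtain l where l: "l \<in> L" "set l = c"
      using combs_surj[of c "gaps d y" "Suc d"] dist unfolding L_def by auto
    then show "lst c \<in> L" "set (lst c) = c" using lst_set[OF l(1)] by simp_all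
  qed
  have L: "length c = Suc d" "set c \<subseteq> U" "card (set c) = Suc d" if c: "c \<in> L" for c
  proof -
    have mem: "c \<in> set (combs (Suc d) (gaps d y))" using c by (simp only: L_def)
    show "length c = Suc d" by (rule length_mem_combs[OF mem])
    then show "card (set c) = Suc d" using distinct_card[OF distinct_mem_combs[OF mem dist]] by simp
    show "set c \<subseteq> U" unfolding U_def by (rule set_combs_subset[OF mem])
  qed
  have inj_u: "inj_on uid U"
  proof (rule inj_onI)
    fix g g' assume g: "g \<in> U" "g' \<in> U" "uid g = uid g'"
    then have "gap_bits g @ [] = gap_bits g' @ []"
      unfolding uid_def by (simp add: dec_nat_eq_iff num_code_gap_bits)
    then show "g = g'"
      using gaps_eqI[of g d y g'] g(1,2) unfolding gap_bits_append_inject U_def by simp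
  qed
  have code_inj: "c = c'" if "c \<in> L" "c' \<in> L" "code c = code c'" for c c'
  proof (rule concat_gap_bits_inject)
    show "length c = length c'" using L(1) that by simp
    show "set c \<subseteq> set (gaps d y)" "set c' \<subseteq> set (gaps d y)" using L(2) that unfolding U_def by
        simp_all
    show "concat (map gap_bits c) = concat (map gap_bits c')"
      using that(3) unfolding code_def by (simp add: dec_nat_eq_iff num_code_concat_gap_bits)
  qed
  have inj_v: "inj_on vid V"
  proof (rule inj_onI)
    fix c c' assume c: "c \<in> V" "c' \<in> V" "vid c = vid c'"
    have "lst c = lst c'"
      by (rule code_inj[OF lst(1)[OF c(1)] lst(1)[OF c(2)] c(3)[unfolded vid_def]])
    from arg_cong[OF this, of set] show "c = c'" unfolding lst(2)[OF c(1)] lst(2)[OF c(2)] .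
  qed
  have disj: "vid ` V \<inter> dummy_set d = {}"
  proof -
    have "vid c \<noteq> dec_nat z" if "c \<in> V" "z \<in> set (dummies d)" for c z
    proof -
      have "enc_list (concat (map gap_bits (lst c))) \<noteq> z"
        using concat_gap_bits_not_dummy[OF L(1)[OF lst(1)[OF that(1)]]] that(2) by metis
      then show ?thesis
        using that(2) unfolding vid_def code_def
        by (simp add: dec_nat_eq_iff num_code_concat_gap_bits num_code_dummies)
    qed
    then show ?thesis unfolding dummy_set_def by blast
  qed
  have hyper: "set (hyperedges d y) = enc_list ` lst ` V"
  proof -
    have "lst ` V = {c \<in> L. allowed lay hi lo (clauses_of (dleft y)) (set c)}"
    proof (intro equalityI subsetI)
      fix l assume "l \<in> lst ` V"
      then obtain c where "c \<in> V" "l = lst c" by blast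
      then show "l \<in> {c \<in> L. allowed lay hi lo (clauses_of (dleft y)) (set c)}"
        using lst[of c] unfolding V_def by simp
    next
      fix l assume l: "l \<in> {c \<in> L. allowed lay hi lo (clauses_of (dleft y)) (set c)}"
      then have "set l \<in> V" using L[of l] unfolding V_def by simp
      then show "l \<in> lst ` V" using lst_set[of l] l by force
    qed
    then show ?thesis unfolding set_hyperedges L_def by simp
  qed
  have "edge_set d y = (\<Union>c\<in>lst ` V. (\<lambda>g. (uid g, code c)) ` set c) \<union> uid ` U \<times> dummy_set d"
  proof -
    have "set (edges d y) =
        (\<Union>c\<in>lst ` V. (\<lambda>g. Br (enc_list (gap_bits g)) (enc_list (concat (map gap_bits c)))) ` set c)
            \<union>
        (\<Union>g\<in>U. (\<lambda>z. Br (enc_list (gap_bits g)) z) ` set (dummies d))"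
      unfolding edges_def U_def by (simp add: hyper image_image)
    moreover have "uid ` U \<times> dummy_set d = (\<Union>g\<in>U. (\<lambda>z. (uid g, dec_nat z)) ` set (dummies d))"
      unfolding dummy_set_def by auto
    ultimately show ?thesis
      unfolding edge_set_def by (simp add: image_Un image_UN image_image uid_def code_def)
  qed
  also have "(\<Union>c\<in>lst ` V. (\<lambda>g. (uid g, code c)) ` set c) = (\<Union>c\<in>V. (\<lambda>g. (uid g, vid c)) ` c)"
    using lst(2) by (simp add: vid_def)
  finally have "edge_set d y = incidence uid vid U V (dummy_set d)"
    unfolding incidence_def .
  with inj_u inj_v disj show ?thesis by blast
qed

text \<open>\<open>K + (K choose D)\<close> for \<open>D = Suc d\<close> and
  \<open>K = k + D + 1\<close>: the price of a clique together with all its hyperedges.\<close>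

definition theta :: "nat \<Rightarrow> nat \<Rightarrow> nat" where
  "theta d k = (k + Suc d + 1) + ((k + Suc d + 1) choose (Suc d))"

text \<open>\<open>(D - 1) * K + D * (K choose D)\<close>: the edges from a clique to the
  \<open>d = D - 1\<close> dummies and to all its hyperedges.\<close>

definition tau :: "nat \<Rightarrow> nat \<Rightarrow> nat" where
  "tau d k = d * (k + Suc d + 1) + Suc d * ((k + Suc d + 1) choose (Suc d))"

lemma mono_theta: "mono (theta d)" and mono_tau: "mono (tau d)"
  unfolding theta_def tau_def
  by (intro monoI add_le_mono mult_le_mono binomial_right_mono; simp)+

lemma ptime_nat_theta: "ptime_nat N \<Longrightarrow> ptime_nat (\<lambda>y. theta d (N y))"
  unfolding theta_def by (intro ptime_intros)

lemma ptime_nat_tau: "ptime_nat N \<Longrightarrow> ptime_nat (\<lambda>y. tau d (N y))"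
  unfolding tau_def by (intro ptime_intros)

context non_hierarchical_query
begin

lemma weighted_sat_iff_bag_set_max:
  assumes d: "1 \<le> d"
  shows "(dleft y, input_param y) \<in> weighted_sat d \<longleftrightarrow> tau d (input_param y) \<le>
    bag_set_max Q (base_db (edge_set d y) (dummy_set d)) (repair_db (edge_set d y)) (theta d
        (input_param y))"
proof -
  define U where "U = set (gaps d y)"
  define V where "V = {c. c \<subseteq> U \<and> card c = Suc d \<and> allowed lay hi lo (clauses_of (dleft y)) c}"
  define K where "K = input_param y + Suc d + 1"
  obtain uid vid where id: "inj_on uid U" "inj_on vid V" "vid ` V \<inter> dummy_set d = {}"
    "edge_set d y = incidence uid vid U V (dummy_set d)"
    using edge_set_eq_incidence[of d y] unfolding U_def V_def by blast
  have Z: "finite (dummy_set d)" "dummy_set d \<noteq> {}"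
    using card_dummy_set[of d] d by (auto simp: dummy_set_def)
  have V: "c \<subseteq> U \<and> c \<noteq> {}" if "c \<in> V" for c
    using that unfolding V_def by auto
  have finU: "finite U" by (simp add: U_def)
  have finE: "finite (edge_set d y)" by (simp add: edge_set_def)
  have dense: "(\<exists>A\<subseteq>fst ` edge_set d y. \<exists>B\<subseteq>snd ` edge_set d y - dummy_set d. card A + card B \<le> \<theta> \<and>
      \<tau> \<le> card {(u, v) \<in> edge_set d y. u \<in> A \<and> (v \<in> B \<or> v \<in> dummy_set d)}) \<longleftrightarrow>
    (\<exists>X\<subseteq>U. \<exists>F\<subseteq>V. card X + card F \<le> \<theta> \<and> \<tau> \<le> d * card X + (\<Sum>c\<in>F. card (c \<inter> X)))" for \<theta> \<tau>
    unfolding id(4)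
    by (rule dense_incidence_iff[OF finU _ id(1-3) Z, unfolded card_dummy_set]) (rule V)
  have "(dleft y, input_param y) \<in> weighted_sat d \<longleftrightarrow>
    (\<exists>G\<subseteq>U. card G = K \<and> (\<forall>c\<subseteq>G. card c = Suc d \<longrightarrow> c \<in> V))"
    unfolding weighted_sat_iff_hyperclique[OF d] U_def V_def K_def ..
  also have "\<dots> \<longleftrightarrow> (\<exists>X\<subseteq>U. \<exists>F\<subseteq>V. card X + card F \<le> theta d (input_param y) \<and>
      tau d (input_param y) \<le> (Suc d - 1) * card X + (\<Sum>c\<in>F. card (c \<inter> X)))"
  proof (rule hyperclique_iff_dense)
    show "c \<subseteq> U \<and> card c = Suc d" if "c \<in> V" for c using that unfolding V_def by simp
    show "2 \<le> Suc d" using d by simp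
    show "Suc d \<le> K" by (simp add: K_def)
    show "theta d (input_param y) = K + (K choose Suc d)" by (simp only: theta_def K_def)
    show "tau d (input_param y) = (Suc d - 1) * K + Suc d * (K choose Suc d)"
      by (simp only: tau_def K_def diff_Suc_1)
  qed (rule finU)
  also have "\<dots> \<longleftrightarrow> tau d (input_param y) \<le>
    bag_set_max Q (base_db (edge_set d y) (dummy_set d)) (repair_db (edge_set d y)) (theta d
        (input_param y))"
    unfolding bag_set_max_iff_dense[OF finE]
    unfolding dense diff_Suc_1 ..
  finally show ?thesis .
qed

section \<open>Writing the databases as trees\<close>

definition fact_code :: "query_atom \<Rightarrow> data \<Rightarrow> data \<Rightarrow> data" where
  "fact_code a u v = Br (enc_nat (fst a))
     (enc_list (map (\<lambda>z. if z = X then u else if z = Y then v else Tip) (sorted_list_of_set (snd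
         a))))"

lemma ptime_fact_code: "ptime F \<Longrightarrow> ptime G \<Longrightarrow> ptime (\<lambda>y. fact_code a (F y) (G y))"
  unfolding fact_code_def
  by (intro ptime_intros ptime_list_map_list) (simp add: ptime_const)

lemma finite_atom: "a \<in> Q \<Longrightarrow> finite (snd a)"
  using sjf unfolding sjf_bcq_def by (cases a) auto

text \<open>The default \<open>Tip\<close> in \<open>fact_code\<close> is the code of 0, the value
  that \<open>assignment\<close> gives to all other variables.\<close>

lemma enc_fact_fact_of:
  assumes "a \<in> Q"
  shows "enc_fact (fact_of a m n) = fact_code a (enc_nat m) (enc_nat n)"
proof -
  have "dom (assignment m n |` snd a) = snd a"
    using dom_fact_of[OF assms, of m n] by (simp add: fact_of_def)
  moreover have "map (\<lambda>z. enc_nat (the ((assignment m n |` snd a) z))) (sorted_list_of_set (snd a))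
      =
      map (\<lambda>z. if z = X then enc_nat m else if z = Y then enc_nat n else Tip) (sorted_list_of_set
          (snd a))"
  proof (rule map_cong[OF refl])
    fix z assume "z \<in> set (sorted_list_of_set (snd a))"
    then have "z \<in> snd a" using finite_atom[OF assms] by simp
    moreover from this have "z \<in> query_vars Q" using atom_vars[OF assms] by (rule subsetD[rotated])
    ultimately show "enc_nat (the ((assignment m n |` snd a) z)) =
        (if z = X then enc_nat m else if z = Y then enc_nat n else Tip)"
      by (simp add: assignment_def)
  qed
  ultimately show ?thesis
    unfolding enc_fact_def fact_of_def fact_code_def by simp
qed

text \<open>The code lists values without their variables. The relation symbol determines the atom,
  as there are no self-joins, and thereby the domain of the fact.\<close>

lemma inj_on_enc_fact: "inj_on enc_fact (facts_over Q)"
proof (rule inj_onI)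
  fix f f' assume "f \<in> facts_over Q" "f' \<in> facts_over Q" and eq: "enc_fact f = enc_fact f'"
  then obtain R x R' x' where f: "f = (R, x)" "(R, dom x) \<in> Q" "f' = (R', x')" "(R', dom x') \<in> Q"
    unfolding facts_over_def by auto
  have R: "R' = R" using eq unfolding f enc_fact_def by (simp add: enc_nat_inject)
  have dom: "dom x' = dom x" using atom_eqI[OF _ f(2,4)] R by simp
  have fin: "finite (dom x)" using finite_atom[OF f(2)] by simp
  have "map (\<lambda>v. enc_nat (the (x v))) (sorted_list_of_set (dom x)) =
      map (\<lambda>v. enc_nat (the (x' v))) (sorted_list_of_set (dom x))"
    using eq unfolding f enc_fact_def by (simp add: dom)
  then have val: "the (x v) = the (x' v)" if "v \<in> dom x" for v
    using that fin by (simp add: enc_nat_inject)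
  have "x v = x' v" for v
  proof (cases "v \<in> dom x")
    case True
    moreover from this have "v \<in> dom x'" using dom by simp
    ultimately show ?thesis using val[OF True] by force
  next
    case False
    moreover from this have "v \<notin> dom x'" using dom by simp
    ultimately show ?thesis by (simp add: domIff)
  qed
  then show "f = f'" using R f(1,3) by (simp add: ext)
qed

lemma db_codeI:
  assumes "db_instance Q D" "distinct cs" "set cs = enc_fact ` D"
  shows "db_code D (enc_list cs)"
proof -
  have inj: "inj_on enc_fact D"
    using assms(1) inj_on_subset[OF inj_on_enc_fact] unfolding db_instance_def by simp
  define fs where "fs = map (inv_into D enc_fact) cs"
  have "map enc_fact fs = map (\<lambda>c. c) cs"
    unfolding fs_def map_map by (rule map_cong) (simp_all add: f_inv_into_f assms(3))
  moreover have "distinct fs"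
    unfolding fs_def distinct_map using assms(2,3) inj_on_inv_into[of "set cs" enc_fact D] by simp
  moreover have "set fs = D"
    unfolding fs_def using assms(3) inj by (simp add: inv_into_image_cancel)
  ultimately show ?thesis unfolding db_code_def by (intro exI[of _ fs]) simp
qed

text \<open>The problem asks for some databases with the given codes; uniqueness ensures that these
  are the constructed ones.\<close>

lemma db_code_unique:
  assumes "db_code D c" "db_code D' c" "db_instance Q D" "db_instance Q D'"
  shows "D = D'"
proof -
  obtain fs fs' where fs: "set fs = D" "set fs' = D'" "c = enc_list (map enc_fact fs)"
    "c = enc_list (map enc_fact fs')"
    using assms(1,2) unfolding db_code_def by blast
  have "map enc_fact fs = map enc_fact fs'"
    using fs(3,4) by simp
  then have "set (map enc_fact fs) = set (map enc_fact fs')"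
    by (rule arg_cong)
  then have "enc_fact ` D = enc_fact ` D'"
    using fs(1,2) by simp
  then show ?thesis
    using inj_on_image_eq_iff[OF inj_on_enc_fact] assms(3,4) unfolding db_instance_def by simp
qed

lemma bag_set_max_decision_iff:
  assumes "db_instance Q D" "db_code D c" "db_instance Q Dr" "db_code Dr cr"
  shows "(enc_list [c, cr, enc_nat \<theta>, enc_nat \<tau>], \<kappa> \<theta> \<tau>) \<in> bag_set_max_decision Q \<kappa> \<longleftrightarrow>
    \<tau> \<le> bag_set_max Q D Dr \<theta>"
proof
  assume "(enc_list [c, cr, enc_nat \<theta>, enc_nat \<tau>], \<kappa> \<theta> \<tau>) \<in> bag_set_max_decision Q \<kappa>"
  then obtain c' cr' \<theta>' \<tau>' D' Dr' where *: "[c, cr, enc_nat \<theta>, enc_nat \<tau>] = [c', cr', enc_nat \<theta>',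
      enc_nat \<tau>']"
    "db_instance Q D'" "db_code D' c'" "db_instance Q Dr'" "db_code Dr' cr'" "\<tau>' \<le> bag_set_max Q D'
        Dr' \<theta>'"
    unfolding bag_set_max_decision_def mem_Collect_eq prod.inject enc_list_inject by metis
  have "c' = c" "cr' = cr" "\<theta>' = \<theta>" "\<tau>' = \<tau>" using *(1) by (simp_all add: enc_nat_inject)
  moreover from this have "D' = D" "Dr' = Dr" using *(2-5) assms db_code_unique by metis+
  ultimately show "\<tau> \<le> bag_set_max Q D Dr \<theta>" using *(6) by simp
next
  assume "\<tau> \<le> bag_set_max Q D Dr \<theta>"
  then show "(enc_list [c, cr, enc_nat \<theta>, enc_nat \<tau>], \<kappa> \<theta> \<tau>) \<in> bag_set_max_decision Q \<kappa>"
    using assms unfolding bag_set_max_decision_def by blast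
qed

definition other_atoms :: "query_atom list" where
  "other_atoms = (SOME as. set as = Q - {aX, aY})"

lemma set_other_atoms: "set other_atoms = Q - {aX, aY}"
proof -
  have "finite (Q - {aX, aY})" using sjf by (simp add: sjf_bcq_def)
  then show ?thesis unfolding other_atoms_def by (rule someI_ex[OF finite_list])
qed

definition base_codes :: "nat \<Rightarrow> data \<Rightarrow> data list" where
  "base_codes d y = remdups (
     concat (map (\<lambda>e. map (\<lambda>a. fact_code a (dleft e) (dright e)) other_atoms) (edges d y)) @
     concat (map (\<lambda>e. if dright e \<in> set (dummies d) then [fact_code aY (dleft e) (dright e)] else
         []) (edges d y)))"

definition repair_codes :: "nat \<Rightarrow> data \<Rightarrow> data list" where
  "repair_codes d y = remdups (
     concat (map (\<lambda>e. [fact_code aX (dleft e) (dright e), fact_code aY (dleft e) (dright e)]) (edges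
         d y)))"

lemma ptime_list_base_codes: "ptime_list (base_codes d)"
  unfolding base_codes_def[abs_def]
  by (intro ptime_intros ptime_list_edges ptime_list_map_list ptime_fact_code)

lemma ptime_list_repair_codes: "ptime_list (repair_codes d)"
  unfolding repair_codes_def[abs_def]
  by (intro ptime_intros ptime_list_edges ptime_fact_code)

lemma fact_code_edge:
  "a \<in> Q \<Longrightarrow> e \<in> set (edges d y) \<Longrightarrow>
    fact_code a (dleft e) (dright e) = enc_fact (fact_of a (dec_nat (dleft e)) (dec_nat (dright
        e)))"
  using num_code_edges[of e d y] by (simp add: enc_fact_fact_of enc_dec_nat)

lemma set_base_codes: "set (base_codes d y) = enc_fact ` base_db (edge_set d y) (dummy_set d)"
proof -
  \<comment> \<open>The program compares codes, \<open>base_db\<close> compares numbers; on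
    canonical codes both tests agree.\<close>
  have dummy: "dright e \<in> set (dummies d) \<longleftrightarrow> dec_nat (dright e) \<in> dummy_set d" if "e \<in> set (edges d
      y)" for e
  proof -
    have "dright e = z" if "z \<in> set (dummies d)" "dec_nat (dright e) = dec_nat z" for z
      using that num_code_edges[OF \<open>e \<in> set (edges d y)\<close>] num_code_dummies[OF that(1)]
      by (simp add: dec_nat_eq_iff)
    then show ?thesis unfolding dummy_set_def by auto
  qed
  let ?f = "\<lambda>a e. fact_of a (dec_nat (dleft e)) (dec_nat (dright e))"
  have "base_db E Z = (\<Union>(u, v)\<in>E. (\<lambda>a. fact_of a u v) ` (Q - {aX, aY})) \<union>
      (\<lambda>(u, v). fact_of aY u v) ` {p \<in> E. snd p \<in> Z}" for E Z
    unfolding base_db_def by force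
  moreover have "{p \<in> edge_set d y. snd p \<in> dummy_set d} = (\<lambda>e. (dec_nat (dleft e), dec_nat (dright
      e))) `
      {e \<in> set (edges d y). dec_nat (dright e) \<in> dummy_set d}"
    unfolding edge_set_def by auto
  ultimately have "base_db (edge_set d y) (dummy_set d) =
      (\<Union>e\<in>set (edges d y). (\<lambda>a. ?f a e) ` (Q - {aX, aY})) \<union>
      ?f aY ` {e \<in> set (edges d y). dec_nat (dright e) \<in> dummy_set d}"
    unfolding edge_set_def by (simp add: image_image)
  then have "enc_fact ` base_db (edge_set d y) (dummy_set d) =
      (\<Union>e\<in>set (edges d y). (\<lambda>a. enc_fact (?f a e)) ` (Q - {aX, aY})) \<union>
      (\<lambda>e. enc_fact (?f aY e)) ` {e \<in> set (edges d y). dec_nat (dright e) \<in> dummy_set d}"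
    by (simp add: image_Un image_UN image_image)
  also have "\<dots> = (\<Union>e\<in>set (edges d y). (\<lambda>a. fact_code a (dleft e) (dright e)) ` (Q - {aX, aY})) \<union>
      (\<lambda>e. fact_code aY (dleft e) (dright e)) ` {e \<in> set (edges d y). dright e \<in> set (dummies d)}"
    using fact_code_edge[of _ _ d y] aY(1) dummy by (intro arg_cong2[where f = "(\<union>)"] SUP_cong
        image_cong) auto
  also have "\<dots> = set (base_codes d y)"
    unfolding base_codes_def by (auto simp: set_other_atoms)
  finally show ?thesis by simp
qed

lemma set_repair_codes: "set (repair_codes d y) = enc_fact ` repair_db (edge_set d y)"
proof -
  let ?f = "\<lambda>a e. fact_of a (dec_nat (dleft e)) (dec_nat (dright e))"
  have "repair_db E = (\<Union>(u, v)\<in>E. {fact_of aX u v, fact_of aY u v})" for E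
    unfolding repair_db_def by blast
  then have "repair_db (edge_set d y) = (\<Union>e\<in>set (edges d y). {?f aX e, ?f aY e})"
    unfolding edge_set_def by simp
  then have "enc_fact ` repair_db (edge_set d y) =
      (\<Union>e\<in>set (edges d y). {enc_fact (?f aX e), enc_fact (?f aY e)})"
    by (simp add: image_UN)
  also have "\<dots> = (\<Union>e\<in>set (edges d y). {fact_code aX (dleft e) (dright e), fact_code aY (dleft e)
      (dright e)})"
    using fact_code_edge[OF aX(1)] fact_code_edge[OF aY(1)] by (intro SUP_cong) simp_all
  also have "\<dots> = set (repair_codes d y)"
    unfolding repair_codes_def by simp
  finally show ?thesis by simp
qed

definition instance_code :: "nat \<Rightarrow> data \<Rightarrow> data" where
  "instance_code d y = enc_list [enc_list (base_codes d y), enc_list (repair_codes d y),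
     enc_nat (theta d (input_param y)), enc_nat (tau d (input_param y))]"

lemma instance_code_mem_iff:
  assumes "1 \<le> d"
  shows "(instance_code d y, \<kappa> (theta d (input_param y)) (tau d (input_param y))) \<in>
      bag_set_max_decision Q \<kappa> \<longleftrightarrow>
    (dleft y, input_param y) \<in> weighted_sat d"
  unfolding instance_code_def weighted_sat_iff_bag_set_max[OF assms]
proof (rule bag_set_max_decision_iff)
  have fin: "finite (edge_set d y)" by (simp add: edge_set_def)
  show base: "db_instance Q (base_db (edge_set d y) (dummy_set d))" by (rule db_instance_base[OF
      fin])
  show repair: "db_instance Q (repair_db (edge_set d y))" by (rule db_instance_repair[OF fin])
  show "db_code (base_db (edge_set d y) (dummy_set d)) (enc_list (base_codes d y))"
    by (rule db_codeI[OF base _ set_base_codes]) (simp add: base_codes_def)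
  show "db_code (repair_db (edge_set d y)) (enc_list (repair_codes d y))"
    by (rule db_codeI[OF repair _ set_repair_codes]) (simp add: repair_codes_def)
qed

text \<open>Covers both parameterizations at once: \<open>theta\<close> and \<open>tau\<close>
  depend on \<open>k\<close> only, so any monotone polynomial-time \<open>\<kappa>\<close> yields a
  new parameter that is computable and bounded in terms of the old one.\<close>

lemma W1_hard_bag_set_max_decision:
  assumes \<kappa>: "\<And>M N. ptime_nat M \<Longrightarrow> ptime_nat N \<Longrightarrow> ptime_nat (\<lambda>y. \<kappa> (M y) (N y))"
    and mono: "\<And>m m' n n'. m \<le> m' \<Longrightarrow> n \<le> n' \<Longrightarrow> \<kappa> m n \<le> \<kappa> m' n'"
  shows "W1_hard (bag_set_max_decision Q \<kappa>)"
  unfolding W1_hard_def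
proof
  fix A assume "A \<in> W1"
  then obtain d where d: "1 \<le> d" and red: "fpt_reducible A (weighted_sat d)"
    unfolding W1_def by blast
  define \<kappa>' where "\<kappa>' k = \<kappa> (theta d k) (tau d k)" for k
  have ptime_nat: "ptime_nat (\<lambda>y. \<kappa>' (N y))" if "ptime_nat N" for N
    unfolding \<kappa>'_def using that by (intro \<kappa> ptime_nat_theta ptime_nat_tau)
  show "fpt_reducible A (bag_set_max_decision Q \<kappa>)"
  proof (rule fpt_reducible_ptime[OF red])
    show "ptime (\<lambda>y. Br (instance_code d y) (enc_unary (\<kappa>' (input_param y))))"
      unfolding instance_code_def
      by (intro ptime_intros ptime_list_base_codes ptime_list_repair_codes ptime_nat_theta
          ptime_nat_tau ptime_nat_input_param
          ptime_nat[unfolded ptime_nat_def] ptime_nat_input_param[unfolded ptime_nat_def])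
    show "ptime_nat (\<lambda>y. \<kappa>' (length (dec_list y)))"
      by (intro ptime_nat ptime_nat_length ptime_intros)
    show "mono \<kappa>'"
      unfolding \<kappa>'_def using mono_theta[of d] mono_tau[of d] by (intro monoI mono) (simp_all add:
          monoD)
    fix x k
    let ?y = "Br x (enc_unary k)"
    have "input_param ?y = k" by (simp add: input_param_def enc_unary_def)
    then show "\<exists>x'. Br (instance_code d ?y) (enc_unary (\<kappa>' (input_param ?y))) = Br x' (enc_unary (\<kappa>'
        k)) \<and>
        ((x, k) \<in> weighted_sat d \<longleftrightarrow> (x', \<kappa>' k) \<in> bag_set_max_decision Q \<kappa>)"
      using instance_code_mem_iff[OF d, of ?y \<kappa>] by (intro exI[of _ "instance_code d ?y"]) (simp
          add: \<kappa>'_def)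
  qed
qed

end

theorem corollary4p5:
  fixes Q :: query
  assumes "sjf_bcq Q" and "\<not> hierarchical Q"
  shows "W1_hard (bag_set_max_decision Q (\<lambda>\<theta> \<tau>. \<theta> + \<tau>)) \<and>
         W1_hard (bag_set_max_decision Q (\<lambda>\<theta> \<tau>. \<tau>))"
proof -
  obtain X Y where "\<not> atoms_of_var Q X \<subseteq> atoms_of_var Q Y" "\<not> atoms_of_var Q Y \<subseteq> atoms_of_var Q X"
    "atoms_of_var Q X \<inter> atoms_of_var Q Y \<noteq> {}"
    using assms(2) unfolding hierarchical_def by blast
  then obtain aX aXY aY where
    "aX \<in> atoms_of_var Q X" "aX \<notin> atoms_of_var Q Y"
    "aXY \<in> atoms_of_var Q X" "aXY \<in> atoms_of_var Q Y"
    "aY \<in> atoms_of_var Q Y" "aY \<notin> atoms_of_var Q X"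
    by blast
  then interpret non_hierarchical_query Q X Y aX aXY aY
    using assms(1) by unfold_locales (auto simp: atoms_of_var_def)
  show ?thesis
    by (intro conjI W1_hard_bag_set_max_decision ptime_nat_add add_le_mono)
qed

end
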